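(* Let $\Bbbk$ be a commutative ring and let $M$ be an $\mathrm{FI}$-module over $\Bbbk$ that is polynomial of degree $d$ starting at $m \geq 0$. For each $k \geq 0$, the map \[\mathrm{H}_k(\mathfrak{S}_n; M(\overline{n})) \to \mathrm{H}_k(\mathfrak{S}_{n+1}; M(\overline{n+1}))\] is an isomorphism for $n \geq 2k+\max(d,m-1)+2$ and a surjection for $n = 2k+\max(d,m-1)+1$.
   Context: $\mathrm{FI}$ is the category of finite sets and injections; an $\mathrm{FI}$-module over $\Bbbk$ is a functor from $\mathrm{FI}$ to $\Bbbk$-modules. Write $\overline{n}=\{1,\dots,n\}$; $\mathfrak{S}_n$ acts on $M(\overline{n})$ via automorphisms of $\overline n$. The map in question is induced by the inclusion $\mathfrak S_n\subset \mathfrak S_{n+1}$ and by $M(\overline n)\to M(\overline{n+1})$ induced by the inclusion $\overline n\hookrightarrow\overline{n+1}$. For a finite set $S$ let $S\sqcup\{\ast\}$ be $S$ with one new element (functorially). The derived module $DM$ is the $\mathrm{FI}$-module $DM(S)=M(S\sqcup\{\ast\})/\mathrm{Im}(M(S)\to M(S\sqcup\{\ast\}))$. $M$ is polynomial of degree $d\ge -1$ starting at $m\in\mathbb Z$ if: for $d=-1$, $M(S)=0$ whenever $|S|\ge m$; for $d\ge 0$, (i) for every injection $f\colon S\to T$ with $|S|\ge m$ the map $f_*\colon M(S)\to M(T)$ is injective, and (ii) $DM$ is polynomial of degree $d-1$ starting at $m-1$. *)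

theory Defs
  imports Complex_Main "HOL-Combinatorics.Permutations"
begin

text \<open>
  FI-modules are modelled on the skeleton of FI: objects are the natural numbers n
  (standing for the set {0,...,n-1}, i.e. {..<n}), a morphism a \<rightarrow> b is an injection
  f :: nat \<Rightarrow> nat from {..<a} into {..<b} (only its values on {..<a} matter).
  The k-modules M(n) are submodules V n of one ambient k-module 'v (scalar action scale),
  and act f a b is M(f) : M(a) \<rightarrow> M(b).
\<close>

type_synonym 'v fi_action = "(nat \<Rightarrow> nat) \<Rightarrow> nat \<Rightarrow> nat \<Rightarrow> 'v \<Rightarrow> 'v"

definition fi_mor :: "(nat \<Rightarrow> nat) \<Rightarrow> nat \<Rightarrow> nat \<Rightarrow> bool" where
  "fi_mor f a b \<longleftrightarrow> inj_on f {..<a} \<and> f ` {..<a} \<subseteq> {..<b}"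

definition fi_module ::
  "('k::comm_ring_1 \<Rightarrow> 'v::ab_group_add \<Rightarrow> 'v) \<Rightarrow> (nat \<Rightarrow> 'v set) \<Rightarrow> 'v fi_action \<Rightarrow> bool" where
  "fi_module scale V act \<longleftrightarrow>
     module scale \<and>
     (\<forall>n. 0 \<in> V n \<and> (\<forall>x\<in>V n. \<forall>y\<in>V n. x + y \<in> V n) \<and> (\<forall>c. \<forall>x\<in>V n. scale c x \<in> V n)) \<and>
     (\<forall>f a b. fi_mor f a b \<longrightarrow>
        (\<forall>x\<in>V a. act f a b x \<in> V b) \<and>
        (\<forall>x\<in>V a. \<forall>y\<in>V a. act f a b (x + y) = act f a b x + act f a b y) \<and>
        (\<forall>r. \<forall>x\<in>V a. act f a b (scale r x) = scale r (act f a b x))) \<and>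
     (\<forall>f g a b. fi_mor f a b \<and> (\<forall>i<a. f i = g i) \<longrightarrow> (\<forall>x\<in>V a. act f a b x = act g a b x)) \<and>
     (\<forall>a. \<forall>x\<in>V a. act id a a x = x) \<and>
     (\<forall>f g a b c. fi_mor f a b \<and> fi_mor g b c \<longrightarrow>
        (\<forall>x\<in>V a. act (g \<circ> f) a c x = act g b c (act f a b x)))"

text \<open>
  Subquotients: a pair (V, W) with W n \<subseteq> V n represents the FI-module n \<mapsto> V n / W n.
  An FI-module M is represented by W = (\<lambda>_. {0}).  The derived module is
  DM(n) = M(n+1) / Im(M(n) \<rightarrow> M(n+1)), where n \<rightarrow> n+1 is the inclusion (the identity
  function on {..<n}) and the new point * is n; a morphism f : a \<rightarrow> b induces
  f \<sqcup> * : a+1 \<rightarrow> b+1 sending a to b.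
\<close>

definition ext_star :: "(nat \<Rightarrow> nat) \<Rightarrow> nat \<Rightarrow> nat \<Rightarrow> nat \<Rightarrow> nat" where
  "ext_star f a b = (\<lambda>i. if i = a then b else f i)"

definition derived_V :: "(nat \<Rightarrow> 'v set) \<Rightarrow> nat \<Rightarrow> 'v set" where
  "derived_V V = (\<lambda>n. V (Suc n))"

definition derived_W :: "(nat \<Rightarrow> 'v set) \<Rightarrow> (nat \<Rightarrow> 'v set) \<Rightarrow> 'v fi_action \<Rightarrow> nat \<Rightarrow> 'v::ab_group_add set" where
  "derived_W V W act = (\<lambda>n. {x + y | x y. x \<in> W (Suc n) \<and> y \<in> act id n (Suc n) ` V n})"

definition derived_act :: "'v fi_action \<Rightarrow> 'v fi_action" where
  "derived_act act = (\<lambda>f a b. act (ext_star f a b) (Suc a) (Suc b))"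

text \<open>poly_sq e m V W act: the subquotient V/W is polynomial of degree e - 1 starting at m.\<close>
primrec poly_sq :: "nat \<Rightarrow> int \<Rightarrow> (nat \<Rightarrow> 'v set) \<Rightarrow> (nat \<Rightarrow> 'v::ab_group_add set) \<Rightarrow> 'v fi_action \<Rightarrow> bool" where
  "poly_sq 0 m V W act \<longleftrightarrow> (\<forall>n. int n \<ge> m \<longrightarrow> V n \<subseteq> W n)"
| "poly_sq (Suc e) m V W act \<longleftrightarrow>
     (\<forall>f a b. int a \<ge> m \<and> fi_mor f a b \<longrightarrow> (\<forall>x\<in>V a. act f a b x \<in> W b \<longrightarrow> x \<in> W a)) \<and>
     poly_sq e (m - 1) (derived_V V) (derived_W V W act) (derived_act act)"

definition polynomial :: "int \<Rightarrow> int \<Rightarrow> (nat \<Rightarrow> 'v::ab_group_add set) \<Rightarrow> 'v fi_action \<Rightarrow> bool" where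
  "polynomial d m V act \<longleftrightarrow> d \<ge> -1 \<and> poly_sq (nat (d + 1)) m V (\<lambda>_. {0}) act"

text \<open>
  Group homology H_k(S_n; M(n)) via the (normalised-free) bar complex
  C_k = functions (S_n)^k \<rightarrow> M(n), with M(n) a right module via v\<cdot>g = g^{-1} v:
  d(v[g1|...|gk]) = v g1 [g2|...|gk] + \<Sum>_{i=1}^{k-1} (-1)^i v[...|g_i g_{i+1}|...]
                     + (-1)^k v[g1|...|g_{k-1}].
  S_n = permutations of {..<n}; composition g \<circ> h is the product gh.
\<close>

definition ptuples :: "nat \<Rightarrow> nat \<Rightarrow> (nat \<Rightarrow> nat) list set" where
  "ptuples n k = {gs. length gs = k \<and> (\<forall>g\<in>set gs. g permutes {..<n})}"

definition chains :: "(nat \<Rightarrow> 'v::zero set) \<Rightarrow> nat \<Rightarrow> nat \<Rightarrow> ((nat \<Rightarrow> nat) list \<Rightarrow> 'v) set" where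
  "chains V n k = {c. (\<forall>gs\<in>ptuples n k. c gs \<in> V n) \<and> (\<forall>gs. gs \<notin> ptuples n k \<longrightarrow> c gs = 0)}"

definition face :: "'v fi_action \<Rightarrow> nat \<Rightarrow> nat \<Rightarrow> (nat \<Rightarrow> nat) list \<Rightarrow> 'v \<Rightarrow> (nat \<Rightarrow> nat) list \<times> 'v" where
  "face act n i gs v =
     (if i = 0 then (tl gs, act (inv (hd gs)) n n v)
      else if i = length gs then (butlast gs, v)
      else (take (i - 1) gs @ [gs ! (i - 1) \<circ> gs ! i] @ drop (i + 1) gs, v))"

definition bar_bd :: "'v::ab_group_add fi_action \<Rightarrow> nat \<Rightarrow> nat \<Rightarrow> ((nat \<Rightarrow> nat) list \<Rightarrow> 'v) \<Rightarrow> ((nat \<Rightarrow> nat) list \<Rightarrow> 'v)" where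
  "bar_bd act n k c = (\<lambda>hs. if k = 0 then 0 else
      (\<Sum>gs\<in>ptuples n k. \<Sum>i\<in>{0..k}.
         (if fst (face act n i gs (c gs)) = hs
          then (if even i then snd (face act n i gs (c gs)) else - snd (face act n i gs (c gs)))
          else 0)))"

definition cycles :: "(nat \<Rightarrow> 'v set) \<Rightarrow> 'v::ab_group_add fi_action \<Rightarrow> nat \<Rightarrow> nat \<Rightarrow> ((nat \<Rightarrow> nat) list \<Rightarrow> 'v) set" where
  "cycles V act n k = {c \<in> chains V n k. bar_bd act n k c = (\<lambda>_. 0)}"

definition boundaries :: "(nat \<Rightarrow> 'v set) \<Rightarrow> 'v::ab_group_add fi_action \<Rightarrow> nat \<Rightarrow> nat \<Rightarrow> ((nat \<Rightarrow> nat) list \<Rightarrow> 'v) set" where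
  "boundaries V act n k = bar_bd act n (Suc k) ` chains V n (Suc k)"

definition hom_rel :: "(nat \<Rightarrow> 'v set) \<Rightarrow> 'v::ab_group_add fi_action \<Rightarrow> nat \<Rightarrow> nat \<Rightarrow> (((nat \<Rightarrow> nat) list \<Rightarrow> 'v) \<times> ((nat \<Rightarrow> nat) list \<Rightarrow> 'v)) set" where
  "hom_rel V act n k = {(x, y). x \<in> cycles V act n k \<and> y \<in> cycles V act n k \<and>
                                (\<lambda>gs. x gs - y gs) \<in> boundaries V act n k}"

definition group_homology :: "(nat \<Rightarrow> 'v set) \<Rightarrow> 'v::ab_group_add fi_action \<Rightarrow> nat \<Rightarrow> nat \<Rightarrow> ((nat \<Rightarrow> nat) list \<Rightarrow> 'v) set set" where
  "group_homology V act n k = cycles V act n k // hom_rel V act n k"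

text \<open>Chain map induced by S_n \<subseteq> S_{n+1} (a permutation of {..<n} is one of {..<n+1})
  and M(n) \<rightarrow> M(n+1) induced by the inclusion (identity function).\<close>
definition chain_incl :: "'v::zero fi_action \<Rightarrow> nat \<Rightarrow> nat \<Rightarrow> ((nat \<Rightarrow> nat) list \<Rightarrow> 'v) \<Rightarrow> ((nat \<Rightarrow> nat) list \<Rightarrow> 'v)" where
  "chain_incl act n k c = (\<lambda>hs. if hs \<in> ptuples n k then act id n (Suc n) (c hs) else 0)"

definition homology_map :: "(nat \<Rightarrow> 'v set) \<Rightarrow> 'v::ab_group_add fi_action \<Rightarrow> nat \<Rightarrow> nat \<Rightarrow>
    ((nat \<Rightarrow> nat) list \<Rightarrow> 'v) set \<Rightarrow> ((nat \<Rightarrow> nat) list \<Rightarrow> 'v) set" where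
  "homology_map V act n k X = hom_rel V act (Suc n) k `` {chain_incl act n k (SOME x. x \<in> X)}"

end

theory Submission
  imports Defs "HOL-Library.Function_Algebras"
begin

text \<open>
  Consider the complex of injective words on {..<n} with coefficients in M, whose degree l part is
  induced from the S_(n-l)-module M(n-l).  Polynomiality makes it exact in a linear range, by
  induction on the degree.  On the homology of S_n with coefficients in this complex, Shapiro's
  lemma identifies the map from degree l + 1 to degree l with the alternating sum of l + 1 copies of the
  stabilisation map, that is with the stabilisation map for even l and with zero for odd l.  Instead of a
  spectral sequence, the exact rows are used to chase elements through the resulting double complex;
  stability in homological degree q for n follows from stability for smaller n.
\<close>

section \<open>FI-modules on finite sets of natural numbers\<close>

text \<open>The derived module is a quotient, so the induction on the degree is run for subquotients
  V/W: chains take values in \<open>V\<close>, while cycles and boundaries are understood modulo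
  \<open>W\<close>. Likewise invariants stand in for coinvariants, which is legitimate for a finite
  group acting freely, so chains are functions and not classes. Origin of the range, with e = d + 1:
  the complex on n letters is exact in degree l once n \<ge> l + max m e. Here e enters because each
  passage to the derived module uses up a letter, which has to exist. Stability for S_(n-1) -> S_n
  in homological degree q is obtained for n \<ge> 2 q + 1 + max m e. The summand 1 is already
  visible for q = 0, where rows 0 and 1 have to be exact. The slope 2 reproduces itself: the chase
  uses the map from word degree l + 2 to l + 1 on homology of degree j only for odd l with l + 2 j <
  2 q. That map is stabilisation S_(n-l-2) -> S_(n-l-1), and l + 1 + 2 j \<le> 2 q keeps it in the
  same range. Injectivity holds where surjectivity does because the map from word degree 2 to 1 is
  zero on homology.\<close>

definition nth_of :: "nat set \<Rightarrow> nat \<Rightarrow> nat" where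
  "nth_of S i = sorted_list_of_set S ! i"

definition index_of :: "nat set \<Rightarrow> nat \<Rightarrow> nat" where
  "index_of S = the_inv_into {..<card S} (nth_of S)"

lemma nth_of_bij: "finite S \<Longrightarrow> bij_betw (nth_of S) {..<card S} S"
  using bij_betw_nth[of "sorted_list_of_set S" "{..<card S}" S]
  by (simp add: nth_of_def[abs_def])

lemma nth_of_mem: "finite S \<Longrightarrow> i < card S \<Longrightarrow> nth_of S i \<in> S"
  using nth_of_bij bij_betwE by blast

lemma index_of_nth_of: "finite S \<Longrightarrow> i < card S \<Longrightarrow> index_of S (nth_of S i) = i"
  unfolding index_of_def using nth_of_bij[of S] by (simp add: bij_betw_def the_inv_into_f_f)

lemma nth_of_index_of: "finite S \<Longrightarrow> x \<in> S \<Longrightarrow> nth_of S (index_of S x) = x"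
  unfolding index_of_def using nth_of_bij[of S] by (simp add: bij_betw_def f_the_inv_into_f)

lemma index_of_less: "finite S \<Longrightarrow> x \<in> S \<Longrightarrow> index_of S x < card S"
  unfolding index_of_def using nth_of_bij[of S] the_inv_into_into[of "nth_of S" "{..<card S}" x "{..<card S}"]
  by (auto simp add: bij_betw_def)

lemma nth_of_lessThan: "i < n \<Longrightarrow> nth_of {..<n} i = i"
  unfolding nth_of_def lessThan_atLeast0 by simp

lemma index_of_lessThan: "i < n \<Longrightarrow> index_of {..<n} i = i"
  using index_of_nth_of[of "{..<n}" i] by (simp add: nth_of_lessThan)

lemma sorted_list_insert_top:
  assumes "finite S" "\<forall>x\<in>S. x < (s::nat)"
  shows "sorted_list_of_set (insert s S) = sorted_list_of_set S @ [s]"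
proof (rule sorted_distinct_set_unique)
  show "sorted (sorted_list_of_set S @ [s])"
    using assms by (auto simp: sorted_append intro: less_imp_le)
  show "distinct (sorted_list_of_set S @ [s])" using assms by auto
qed (use assms in \<open>simp_all del: sorted_list_of_set_insert_remove\<close>)

lemma nth_of_insert_top:
  assumes "finite S" "\<forall>x\<in>S. x < s"
  shows "i < card S \<Longrightarrow> nth_of (insert s S) i = nth_of S i" "nth_of (insert s S) (card S) = s"
  using assms by (simp_all del: sorted_list_of_set_insert_remove add: nth_of_def sorted_list_insert_top nth_append)

lemma index_of_insert_top:
  assumes "finite S" "\<forall>x\<in>S. x < s"
  shows "x \<in> S \<Longrightarrow> index_of (insert s S) x = index_of S x" "index_of (insert s S) s = card S"
proof -
  have c: "card (insert s S) = Suc (card S)" using assms by (metis card_insert_disjoint nat_less_le)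
  show "index_of (insert s S) x = index_of S x" if "x \<in> S"
    using index_of_nth_of[of "insert s S" "index_of S x"] nth_of_insert_top(1)[OF assms, of "index_of S x"] index_of_less[OF assms(1) that]
      nth_of_index_of[OF assms(1) that] assms c by auto
  show "index_of (insert s S) s = card S"
    using index_of_nth_of[of "insert s S" "card S"] nth_of_insert_top(2)[OF assms] assms c by auto
qed

text \<open>
  The FI-module is extended from the sets {..<n} to all finite sets S of natural numbers by
  identifying S with {..<card S} through the increasing enumeration.  Adding to S an element larger
  than all of S then corresponds to the passage from n to n + 1 in the derived module.
\<close>

definition setact :: "'v fi_action \<Rightarrow> (nat \<Rightarrow> nat) \<Rightarrow> nat set \<Rightarrow> nat set \<Rightarrow> 'v \<Rightarrow> 'v" where
  "setact act f S T = act (index_of T \<circ> f \<circ> nth_of S) (card S) (card T)"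

text \<open>The additive form of an FI-module, with \<open>V_uminus\<close> coming from
  multiplication by -1. It applies equally to \<open>V\<close>, to the submodule \<open>W\<close> of
  a subquotient with the same \<open>act\<close>, and to derived modules.\<close>

locale fi_mod =
  fixes V :: "nat \<Rightarrow> 'v::ab_group_add set" and act :: "'v fi_action"
  assumes V_0 [simp]: "0 \<in> V n"
    and V_add [simp]: "x \<in> V n \<Longrightarrow> y \<in> V n \<Longrightarrow> x + y \<in> V n"
    and V_uminus [simp]: "x \<in> V n \<Longrightarrow> - x \<in> V n"
    and act_V: "fi_mor f a b \<Longrightarrow> x \<in> V a \<Longrightarrow> act f a b x \<in> V b"
    and act_add: "fi_mor f a b \<Longrightarrow> x \<in> V a \<Longrightarrow> y \<in> V a \<Longrightarrow> act f a b (x + y) = act f a b x + act f a b y"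
    and act_cong: "fi_mor f a b \<Longrightarrow> (\<And>i. i < a \<Longrightarrow> f i = g i) \<Longrightarrow> x \<in> V a \<Longrightarrow> act f a b x = act g a b x"
    and act_id: "x \<in> V a \<Longrightarrow> act id a a x = x"
    and act_comp: "fi_mor f a b \<Longrightarrow> fi_mor g b c \<Longrightarrow> x \<in> V a \<Longrightarrow> act (g \<circ> f) a c x = act g b c (act f a b x)"
begin

lemma V_diff [simp]: "x \<in> V n \<Longrightarrow> y \<in> V n \<Longrightarrow> x - y \<in> V n"
  using V_add[of x n "- y"] by simp

lemma V_sum: "(\<And>i. i \<in> I \<Longrightarrow> x i \<in> V n) \<Longrightarrow> sum x I \<in> V n"
  by (induction I rule: infinite_finite_induct) auto

lemma act_0 [simp]: "fi_mor f a b \<Longrightarrow> act f a b 0 = 0"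
  using act_add[of f a b 0 0] by simp

lemma fi_mor_setact:
  assumes "finite S" "finite T" "inj_on f S" "f ` S \<subseteq> T"
  shows "fi_mor (index_of T \<circ> f \<circ> nth_of S) (card S) (card T)"
  unfolding fi_mor_def
proof
  show "inj_on (index_of T \<circ> f \<circ> nth_of S) {..<card S}"
  proof (rule inj_onI)
    fix i j assume ij: "i \<in> {..<card S}" "j \<in> {..<card S}"
      and eq: "(index_of T \<circ> f \<circ> nth_of S) i = (index_of T \<circ> f \<circ> nth_of S) j"
    have "f (nth_of S i) \<in> T" "f (nth_of S j) \<in> T" using ij assms nth_of_mem by blast+
    then have "f (nth_of S i) = f (nth_of S j)" using eq nth_of_index_of assms(2) by (metis comp_apply)
    then have "nth_of S i = nth_of S j" using ij assms nth_of_mem by (meson inj_on_eq_iff lessThan_iff)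
    then show "i = j" using ij index_of_nth_of assms(1) by (metis lessThan_iff)
  qed
  show "(index_of T \<circ> f \<circ> nth_of S) ` {..<card S} \<subseteq> {..<card T}"
  proof clarsimp
    fix i assume "i < card S"
    then show "index_of T (f (nth_of S i)) < card T" using assms nth_of_mem[of S i] by (intro index_of_less) auto
  qed
qed

lemma setact_V:
  "finite S \<Longrightarrow> finite T \<Longrightarrow> inj_on f S \<Longrightarrow> f ` S \<subseteq> T \<Longrightarrow> x \<in> V (card S) \<Longrightarrow> setact act f S T x \<in> V (card T)"
  unfolding setact_def by (rule act_V[OF fi_mor_setact])

lemma setact_add:
  "finite S \<Longrightarrow> finite T \<Longrightarrow> inj_on f S \<Longrightarrow> f ` S \<subseteq> T \<Longrightarrow> x \<in> V (card S) \<Longrightarrow> y \<in> V (card S) \<Longrightarrow>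
   setact act f S T (x + y) = setact act f S T x + setact act f S T y"
  unfolding setact_def by (rule act_add[OF fi_mor_setact])

lemma setact_0 [simp]:
  "finite S \<Longrightarrow> finite T \<Longrightarrow> inj_on f S \<Longrightarrow> f ` S \<subseteq> T \<Longrightarrow> setact act f S T 0 = 0"
  unfolding setact_def by (rule act_0[OF fi_mor_setact])

lemma setact_uminus:
  assumes "finite S" "finite T" "inj_on f S" "f ` S \<subseteq> T" "x \<in> V (card S)"
  shows "setact act f S T (- x) = - setact act f S T x"
  using setact_add[OF assms(1-4), of x "- x"] setact_0[OF assms(1-4)] assms(5)
  by (simp add: eq_neg_iff_add_eq_0 add.commute)

lemma setact_diff:
  assumes "finite S" "finite T" "inj_on f S" "f ` S \<subseteq> T" "x \<in> V (card S)" "y \<in> V (card S)"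
  shows "setact act f S T (x - y) = setact act f S T x - setact act f S T y"
  using setact_add[OF assms(1-4), of x "- y"] setact_uminus[OF assms(1-4), of y] assms(5,6) by simp

lemma setact_sum:
  assumes "finite S" "finite T" "inj_on f S" "f ` S \<subseteq> T" "\<And>i. i \<in> I \<Longrightarrow> x i \<in> V (card S)"
  shows "setact act f S T (sum x I) = (\<Sum>i\<in>I. setact act f S T (x i))"
  using assms(5)
  by (induction I rule: infinite_finite_induct) (auto simp: assms setact_add V_sum)

lemma setact_ident:
  assumes "finite S" "\<And>i. i \<in> S \<Longrightarrow> f i = i" "x \<in> V (card S)"
  shows "setact act f S S x = x"
proof -
  have "setact act f S S x = act id (card S) (card S) x"
    unfolding setact_def
    by (rule act_cong[OF fi_mor_setact]) (use assms nth_of_mem index_of_nth_of in \<open>auto simp: inj_on_def\<close>)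
  then show ?thesis using act_id assms by simp
qed

lemma setact_comp:
  assumes "finite S" "finite T" "finite U" "inj_on f S" "f ` S \<subseteq> T" "inj_on g T" "g ` T \<subseteq> U" "x \<in> V (card S)"
  shows "setact act g T U (setact act f S T x) = setact act (g \<circ> f) S U x"
proof -
  have i: "inj_on (g \<circ> f) S" using assms by (meson comp_inj_on inj_on_subset)
  have "setact act g T U (setact act f S T x)
      = act ((index_of U \<circ> g \<circ> nth_of T) \<circ> (index_of T \<circ> f \<circ> nth_of S)) (card S) (card U) x"
    unfolding setact_def
    by (rule act_comp[symmetric]) (use assms fi_mor_setact in auto)
  also have "\<dots> = act (index_of U \<circ> (g \<circ> f) \<circ> nth_of S) (card S) (card U) x"
  proof (rule act_cong[symmetric, OF fi_mor_setact])
    fix j assume "j < card S"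
    then have "f (nth_of S j) \<in> T" using assms nth_of_mem by blast
    then show "(index_of U \<circ> (g \<circ> f) \<circ> nth_of S) j = (index_of U \<circ> g \<circ> nth_of T \<circ> (index_of T \<circ> f \<circ> nth_of S)) j"
      using assms(2) by (simp add: nth_of_index_of)
  qed (use assms i in auto)
  finally show ?thesis by (simp add: setact_def)
qed

lemma setact_lessThan:
  assumes "fi_mor f a b" "x \<in> V a"
  shows "setact act f {..<a} {..<b} x = act f a b x"
proof -
  have "act f a b x = act (index_of {..<b} \<circ> f \<circ> nth_of {..<a}) a b x"
    by (rule act_cong[OF assms(1) _ assms(2)])
      (use assms in \<open>auto simp: fi_mor_def nth_of_lessThan index_of_lessThan image_subset_iff\<close>)
  then show ?thesis by (simp add: setact_def)
qed

end

section \<open>Injective words with coefficients in an FI-module\<close>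

definition words :: "nat set \<Rightarrow> nat \<Rightarrow> nat list set" where
  "words X l = {w. distinct w \<and> set w \<subseteq> X \<and> length w = l}"

text \<open>No condition is put on values away from \<open>words X l\<close>. One and the same
  function can thus be a chain on \<open>X\<close> with values in \<open>V\<close> and a chain on
  \<open>X - {s}\<close> with values in the derived module.\<close>

definition is_chain :: "(nat \<Rightarrow> 'v set) \<Rightarrow> nat set \<Rightarrow> nat \<Rightarrow> (nat list \<Rightarrow> 'v) \<Rightarrow> bool" where
  "is_chain V X l c \<longleftrightarrow> (\<forall>w\<in>words X l. c w \<in> V (card X - l))"

text \<open>The i-th face of the chain \<open>c\<close>, evaluated at \<open>w\<close>: it collects
  all words from which deleting the letter in position \<open>i\<close> yields \<open>w\<close>,
  each transported along the inclusion of complements.\<close>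

definition ins_sum :: "'v::ab_group_add fi_action \<Rightarrow> nat \<Rightarrow> nat set \<Rightarrow> (nat list \<Rightarrow> 'v) \<Rightarrow> nat list \<Rightarrow> 'v" where
  "ins_sum act i X c w =
     (\<Sum>x\<in>X - set w. setact act id (X - set w - {x}) (X - set w) (c (take i w @ x # drop i w)))"

text \<open>
  The complex of injective words on X with coefficients in M: a chain of degree l assigns to each
  injective word w of length l an element of M(X - w), and the face deleting the i-th letter of
  a word is induced by the inclusion of X - w in the complement of the shorter word.  In terms of
  functions on words, the boundary at w is the alternating sum over all insertions of a letter into w;
  the recursion separates the insertion in front of the first letter.
\<close>

primrec word_bd :: "'v::ab_group_add fi_action \<Rightarrow> nat list \<Rightarrow> nat set \<Rightarrow> (nat list \<Rightarrow> 'v) \<Rightarrow> 'v" where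
  "word_bd act [] X c = ins_sum act 0 X c []"
| "word_bd act (a # w) X c = ins_sum act 0 X c (a # w) - word_bd act w (X - {a}) (\<lambda>u. c (a # u))"

lemma words_Cons: "a # w \<in> words X (Suc l) \<longleftrightarrow> a \<in> X \<and> w \<in> words (X - {a}) l"
  by (auto simp: words_def)

lemma words_ins:
  "w \<in> words X l \<Longrightarrow> x \<in> X - set w \<Longrightarrow> take i w @ x # drop i w \<in> words X (Suc l)"
  unfolding words_def
  by (auto dest: in_set_takeD in_set_dropD simp: set_take_disj_set_drop_if_distinct)

lemma card_words_compl: "finite X \<Longrightarrow> w \<in> words X l \<Longrightarrow> card (X - set w) = card X - l"
  by (auto simp: words_def card_Diff_subset distinct_card)

lemma words_length_le: "finite X \<Longrightarrow> w \<in> words X l \<Longrightarrow> l \<le> card X"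
  by (auto simp: words_def) (metis card_mono distinct_card)

lemma is_chain_Cons:
  "is_chain V X (Suc l) c \<Longrightarrow> a \<in> X \<Longrightarrow> finite X \<Longrightarrow> is_chain V (X - {a}) l (\<lambda>u. c (a # u))"
  by (auto simp: is_chain_def words_Cons)

lemma ins_sum_Cons: "ins_sum act (Suc i) X c (a # w) = ins_sum act i (X - {a}) (\<lambda>u. c (a # u)) w"
proof -
  have "X - set (a # w) = X - {a} - set w" by auto
  then show ?thesis by (simp add: ins_sum_def)
qed

text \<open>The recursion suits inductions that strip the first letter; this form serves additivity
  and equivariance, which hold for each face separately.\<close>

lemma word_bd_eq_sum:
  "word_bd act w X c = (\<Sum>i\<le>length w. if even i then ins_sum act i X c w else - ins_sum act i X c w)"
proof (induction w arbitrary: X c)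
  case (Cons a w)
  have "word_bd act (a # w) X c = ins_sum act 0 X c (a # w) +
      (\<Sum>i\<le>length w. - (if even i then ins_sum act (Suc i) X c (a # w) else - ins_sum act (Suc i) X c (a # w)))"
    unfolding word_bd.simps Cons.IH sum_negf ins_sum_Cons by simp
  also have "\<dots> = (\<Sum>i\<le>length (a # w). if even i then ins_sum act i X c (a # w) else - ins_sum act i X c (a # w))"
    unfolding length_Cons sum.atMost_Suc_shift by (auto intro!: sum.cong)
  finally show ?case .
qed simp

lemma ins_sum_cong:
  "(\<And>x. x \<in> X - set w \<Longrightarrow> c (take i w @ x # drop i w) = c' (take i w @ x # drop i w)) \<Longrightarrow>
   ins_sum act i X c w = ins_sum act i X c' w"
  unfolding ins_sum_def by (intro sum.cong) auto

lemma word_bd_cong: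
  assumes "w \<in> words X l" "\<And>u. u \<in> words X (Suc l) \<Longrightarrow> c u = c' u"
  shows "word_bd act w X c = word_bd act w X c'"
proof -
  have "ins_sum act i X c w = ins_sum act i X c' w" for i
    by (rule ins_sum_cong) (use assms words_ins in blast)
  then show ?thesis by (simp add: word_bd_eq_sum cong: if_cong)
qed

context fi_mod begin

lemma ins_sum_term_V:
  assumes "finite X" "w \<in> words X l" "x \<in> X - set w" "v \<in> V (card X - Suc l)"
  shows "setact act id (X - set w - {x}) (X - set w) v \<in> V (card X - l)"
    and "v \<in> V (card (X - set w - {x}))"
proof -
  have *: "card (X - set w) = card X - l" using assms card_words_compl by blast
  then show "v \<in> V (card (X - set w - {x}))" using assms by simp
  then show "setact act id (X - set w - {x}) (X - set w) v \<in> V (card X - l)"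
    using setact_V[of "X - set w - {x}" "X - set w" id v] assms * by auto
qed

lemma ins_sum_V:
  assumes "finite X" "is_chain V X (Suc l) c" "w \<in> words X l"
  shows "ins_sum act i X c w \<in> V (card X - l)"
  unfolding ins_sum_def
  using assms words_ins by (intro V_sum ins_sum_term_V) (auto simp: is_chain_def)

lemma word_bd_V:
  assumes "finite X" "is_chain V X (Suc l) c" "w \<in> words X l"
  shows "word_bd act w X c \<in> V (card X - l)"
  unfolding word_bd_eq_sum by (intro V_sum) (use ins_sum_V[OF assms] in auto)

lemma ins_sum_sum:
  assumes "finite X" "\<And>k. k \<in> K \<Longrightarrow> is_chain V X (Suc l) (c k)" "w \<in> words X l"
  shows "ins_sum act i X (\<lambda>u. \<Sum>k\<in>K. c k u) w = (\<Sum>k\<in>K. ins_sum act i X (c k) w)"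
proof -
  have "ins_sum act i X (\<lambda>u. \<Sum>k\<in>K. c k u) w =
     (\<Sum>x\<in>X - set w. \<Sum>k\<in>K. setact act id (X - set w - {x}) (X - set w) (c k (take i w @ x # drop i w)))"
    unfolding ins_sum_def
  proof (intro sum.cong refl setact_sum)
    fix x k assume x: "x \<in> X - set w" and k: "k \<in> K"
    show "c k (take i w @ x # drop i w) \<in> V (card (X - set w - {x}))"
      using ins_sum_term_V(2)[OF assms(1,3) x] assms(2)[OF k] words_ins[OF assms(3) x] by (auto simp: is_chain_def)
  qed (use assms in auto)
  then show ?thesis unfolding ins_sum_def using sum.swap by simp
qed

lemma word_bd_sum:
  assumes "finite X" "\<And>k. k \<in> K \<Longrightarrow> is_chain V X (Suc l) (c k)" "w \<in> words X l"
  shows "word_bd act w X (\<lambda>u. \<Sum>k\<in>K. c k u) = (\<Sum>k\<in>K. word_bd act w X (c k))"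
proof -
  have "word_bd act w X (\<lambda>u. \<Sum>k\<in>K. c k u) =
    (\<Sum>i\<le>length w. \<Sum>k\<in>K. if even i then ins_sum act i X (c k) w else - ins_sum act i X (c k) w)"
    unfolding word_bd_eq_sum by (intro sum.cong refl) (simp add: ins_sum_sum[OF assms] sum_negf)
  then show ?thesis unfolding word_bd_eq_sum using sum.swap by simp
qed

lemma ins_sum_add:
  assumes "finite X" "is_chain V X (Suc l) c" "is_chain V X (Suc l) c'" "w \<in> words X l"
  shows "ins_sum act i X (\<lambda>u. c u + c' u) w = ins_sum act i X c w + ins_sum act i X c' w"
  using ins_sum_sum[of X "UNIV::bool set" l "\<lambda>b. if b then c else c'" w i] assms by (simp add: UNIV_bool add.commute)

lemma ins_sum_0 [simp]: "finite X \<Longrightarrow> ins_sum act i X (\<lambda>u. 0) w = 0"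
  unfolding ins_sum_def by (intro sum.neutral) auto

lemma ins_sum_uminus:
  assumes "finite X" "is_chain V X (Suc l) c" "w \<in> words X l"
  shows "ins_sum act i X (\<lambda>u. - c u) w = - ins_sum act i X c w"
proof -
  have "is_chain V X (Suc l) (\<lambda>u. - c u)" using assms by (simp add: is_chain_def)
  from ins_sum_add[OF assms(1,2) this assms(3), of i] show ?thesis
    using assms(1) by (simp add: eq_neg_iff_add_eq_0 add.commute)
qed

lemma ins_sum_diff:
  assumes "finite X" "is_chain V X (Suc l) c" "is_chain V X (Suc l) c'" "w \<in> words X l"
  shows "ins_sum act i X (\<lambda>u. c u - c' u) w = ins_sum act i X c w - ins_sum act i X c' w"
proof -
  have "is_chain V X (Suc l) (\<lambda>u. - c' u)" using assms by (simp add: is_chain_def)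
  from ins_sum_add[OF assms(1,2) this assms(4), of i] show ?thesis
    using ins_sum_uminus[OF assms(1,3,4), of i] by simp
qed

lemma word_bd_0 [simp]: "finite X \<Longrightarrow> word_bd act w X (\<lambda>u. 0) = 0"
  unfolding word_bd_eq_sum by (intro sum.neutral) auto

lemma word_bd_add:
  assumes "finite X" "is_chain V X (Suc l) c" "is_chain V X (Suc l) c'" "w \<in> words X l"
  shows "word_bd act w X (\<lambda>u. c u + c' u) = word_bd act w X c + word_bd act w X c'"
  using word_bd_sum[of X "UNIV::bool set" l "\<lambda>b. if b then c else c'" w] assms by (simp add: UNIV_bool add.commute)

lemma word_bd_uminus:
  assumes "finite X" "is_chain V X (Suc l) c" "w \<in> words X l"
  shows "word_bd act w X (\<lambda>u. - c u) = - word_bd act w X c"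
  unfolding word_bd_eq_sum sum_negf[symmetric]
  by (intro sum.cong refl) (simp add: ins_sum_uminus[OF assms])

lemma word_bd_diff:
  assumes "finite X" "is_chain V X (Suc l) c" "is_chain V X (Suc l) c'" "w \<in> words X l"
  shows "word_bd act w X (\<lambda>u. c u - c' u) = word_bd act w X c - word_bd act w X c'"
  unfolding word_bd_eq_sum sum_subtractf[symmetric]
  by (intro sum.cong refl) (simp add: ins_sum_diff[OF assms])

lemma word_bd_zero:
  assumes "finite X" "\<And>i x. i \<le> length w \<Longrightarrow> x \<in> X - set w \<Longrightarrow> c (take i w @ x # drop i w) = 0"
  shows "word_bd act w X c = 0"
proof -
  have "ins_sum act i X c w = ins_sum act i X (\<lambda>u. 0) w" if "i \<le> length w" for i
    using assms(2) that by (intro ins_sum_cong) auto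
  then show ?thesis unfolding word_bd_eq_sum using assms(1) by (intro sum.neutral) auto
qed

lemma front_sum_comp:
  assumes "finite X" "is_chain V X (Suc (Suc l)) c" "w \<in> words X l"
  shows "ins_sum act 0 X (\<lambda>u. ins_sum act 0 X c u) w =
    (\<Sum>x\<in>X - set w. \<Sum>y\<in>X - set w - {x}. setact act id (X - set w - {x} - {y}) (X - set w) (c (y # x # w)))"
proof -
  have "setact act id (X - set w - {x}) (X - set w) (ins_sum act 0 X c (x # w)) =
     (\<Sum>y\<in>X - set w - {x}. setact act id (X - set w - {x} - {y}) (X - set w) (c (y # x # w)))"
    if x: "x \<in> X - set w" for x
  proof -
    have S: "X - set (x # w) = X - set w - {x}" by auto
    have xw: "x # w \<in> words X (Suc l)" using words_ins[OF assms(3) x, of 0] by simp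
    have yxw: "c (y # x # w) \<in> V (card (X - set w - {x} - {y}))" if "y \<in> X - set w - {x}" for y
      using ins_sum_term_V(2)[OF assms(1) xw, of y "c (y # x # w)"] that assms(2)
        words_ins[OF xw, of y 0] unfolding S is_chain_def by auto
    have "setact act id (X - set w - {x}) (X - set w) (ins_sum act 0 X c (x # w)) =
      (\<Sum>y\<in>X - set w - {x}. setact act id (X - set w - {x}) (X - set w)
         (setact act id (X - set w - {x} - {y}) (X - set w - {x}) (c (y # x # w))))"
      unfolding ins_sum_def S
      by (simp, rule setact_sum) (use assms(1) yxw in \<open>auto intro!: setact_V\<close>)
    also have "\<dots> = (\<Sum>y\<in>X - set w - {x}. setact act id (X - set w - {x} - {y}) (X - set w) (c (y # x # w)))"
      by (intro sum.cong refl, subst setact_comp) (use assms(1) yxw in auto)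
    finally show ?thesis .
  qed
  then show ?thesis unfolding ins_sum_def[of act 0 X "\<lambda>u. ins_sum act 0 X c u"] by simp
qed

lemma front_sum_swap:
  assumes "finite S"
  shows "(\<Sum>x\<in>S. \<Sum>y\<in>S - {x}. F x y) = (\<Sum>x\<in>S. \<Sum>y\<in>S - {x}. (F y x :: 'v))"
proof -
  have "(\<Sum>x\<in>S. \<Sum>y\<in>S - {x}. F x y) = (\<Sum>x\<in>S. \<Sum>y\<in>S. if y = x then 0 else F x y)"
    by (rule sum.cong[OF refl], rule sum.mono_neutral_cong_left) (use assms in auto)
  also have "\<dots> = (\<Sum>x\<in>S. \<Sum>y\<in>S. if x = y then 0 else F y x)" by (rule sum.swap)
  also have "\<dots> = (\<Sum>x\<in>S. \<Sum>y\<in>S - {x}. F y x)"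
    by (rule sum.cong[OF refl], rule sum.mono_neutral_cong_right) (use assms in auto)
  finally show ?thesis .
qed

text \<open>The boundary passes through insertion in front. Two letters inserted in front may be
  exchanged (\<open>front_sum_swap\<close>), since both orders use the same inclusion of
  complements; what happens behind the first letter \<open>a\<close> is the induction hypothesis.
  Combined with the recursive clause of \<open>word_bd\<close> this makes the boundary square to
  zero.\<close>

lemma word_bd_front_sum:
  assumes "finite X" "is_chain V X (Suc (Suc l)) c" "w \<in> words X l"
  shows "word_bd act w X (\<lambda>u. ins_sum act 0 X c u) =
    (\<Sum>x\<in>X - set w. setact act id (X - set w - {x}) (X - set w) (word_bd act w (X - {x}) (\<lambda>u. c (x # u))))"
  using assms
proof (induction w arbitrary: X c l)
  case Nil
  have "ins_sum act 0 X (\<lambda>u. ins_sum act 0 X c u) [] =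
     (\<Sum>x\<in>X. \<Sum>y\<in>X - {x}. setact act id (X - {x} - {y}) X (c [y, x]))"
    using front_sum_comp[OF Nil] by simp
  also have "\<dots> = (\<Sum>x\<in>X. \<Sum>y\<in>X - {x}. setact act id (X - {y} - {x}) X (c [x, y]))"
    using Nil by (subst front_sum_swap) auto
  also have "\<dots> = (\<Sum>x\<in>X. setact act id (X - {x}) X (ins_sum act 0 (X - {x}) (\<lambda>u. c (x # u)) []))"
  proof (intro sum.cong refl)
    fix x assume x: "x \<in> X"
    have ch: "is_chain V (X - {x}) 1 (\<lambda>u. c (x # u))" using is_chain_Cons[OF Nil(2) x Nil(1)] Nil by (auto simp: words_def)
    have m: "c [x, y] \<in> V (card (X - {x} - {y}))" if "y \<in> X - {x}" for y
    proof -
      have "[x, y] \<in> words X (Suc (Suc 0))" using x that by (auto simp: words_def)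
      then show ?thesis using Nil x that by (auto simp: is_chain_def words_def)
    qed
    have "setact act id (X - {x}) X (ins_sum act 0 (X - {x}) (\<lambda>u. c (x # u)) []) =
      (\<Sum>y\<in>X - {x}. setact act id (X - {x}) X (setact act id (X - {x} - {y}) (X - {x}) (c [x, y])))"
      unfolding ins_sum_def using Nil m
      by (simp, intro setact_sum) (auto intro!: setact_V)
    also have "\<dots> = (\<Sum>y\<in>X - {x}. setact act id (X - {x} - {y}) X (c [x, y]))"
      by (intro sum.cong refl, subst setact_comp) (use Nil m in auto)
    finally show "(\<Sum>y\<in>X - {x}. setact act id (X - {y} - {x}) X (c [x, y])) =
       setact act id (X - {x}) X (ins_sum act 0 (X - {x}) (\<lambda>u. c (x # u)) [])"
      by (simp add: Diff_insert[symmetric] insert_commute)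
  qed
  finally show ?case by (simp only: word_bd.simps list.set Diff_empty)
next
  case (Cons a w)
  then obtain l' where l: "l = Suc l'" by (auto simp: words_def)
  have a: "a \<in> X" and w: "w \<in> words (X - {a}) l'" using Cons.prems l words_Cons by auto
  let ?S = "X - set (a # w)"
  have S: "X - {a} - set w = ?S" by auto
  \<comment> \<open>Inserting in front of \<open>a # u\<close> leaves \<open>a\<close> in second
    place; \<open>?c2\<close> puts it there, so that front insertion on \<open>X\<close> becomes
    front insertion on \<open>X - {a}\<close>.\<close>
  let ?c2 = "\<lambda>u. c (hd u # a # tl u)"
  have c2: "is_chain V (X - {a}) (Suc (Suc l')) ?c2"
    unfolding is_chain_def
  proof
    fix u assume u: "u \<in> words (X - {a}) (Suc (Suc l'))"
    then obtain y v where "u = y # v" by (cases u) (auto simp: words_def)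
    then have "hd u # a # tl u \<in> words X (Suc (Suc l))" using u a l by (auto simp: words_def)
    then have "?c2 u \<in> V (card X - Suc (Suc l))" using Cons.prems(2) by (auto simp: is_chain_def)
    then show "?c2 u \<in> V (card (X - {a}) - Suc (Suc l'))" using a l Cons.prems(1) by simp
  qed
  have e1: "ins_sum act 0 X c (a # u) = ins_sum act 0 (X - {a}) ?c2 u" for u
  proof -
    have "X - set (a # u) = X - {a} - set u" by auto
    then show ?thesis by (simp add: ins_sum_def)
  qed
  have fa: "finite (X - {a})" using Cons.prems by simp
  have IH: "word_bd act w (X - {a}) (\<lambda>u. ins_sum act 0 X c (a # u)) =
     (\<Sum>x\<in>?S. setact act id (?S - {x}) ?S (word_bd act w (X - {a} - {x}) (\<lambda>u. c (x # a # u))))"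
    unfolding e1 using Cons.IH[OF fa c2 w] by (simp only: S list.sel)
  have fr: "ins_sum act 0 X (\<lambda>u. ins_sum act 0 X c u) (a # w) =
     (\<Sum>x\<in>?S. \<Sum>y\<in>?S - {x}. setact act id (?S - {y} - {x}) ?S (c (x # y # a # w)))"
    using front_sum_comp[OF Cons.prems] front_sum_swap[of ?S] Cons.prems(1) by simp
  have "setact act id (?S - {x}) ?S (word_bd act (a # w) (X - {x}) (\<lambda>u. c (x # u))) =
      (\<Sum>y\<in>?S - {x}. setact act id (?S - {y} - {x}) ?S (c (x # y # a # w))) -
      setact act id (?S - {x}) ?S (word_bd act w (X - {a} - {x}) (\<lambda>u. c (x # a # u)))"
    if x: "x \<in> ?S" for x :: nat
  proof -
    have xX: "x \<in> X" "a \<noteq> x" using x by auto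
    have aw: "a # w \<in> words (X - {x}) l" using Cons.prems(3) x by (auto simp: words_def)
    have ch: "is_chain V (X - {x}) (Suc l) (\<lambda>u. c (x # u))" using is_chain_Cons[OF Cons.prems(2) xX(1) Cons.prems(1)] .
    have ch2: "is_chain V (X - {x} - {a}) (Suc l') (\<lambda>u. c (x # a # u))"
      using is_chain_Cons[of V "X - {x}" "Suc l'" "\<lambda>u. c (x # u)" a] ch l a xX Cons.prems(1) by auto
    have comm: "X - {a} - {x} = X - {x} - {a}" by auto
    have Sx: "X - {x} - set (a # w) = ?S - {x}" by auto
    have cS: "card (?S - {x}) = card (X - {x}) - l" using card_words_compl[OF _ aw] Sx Cons.prems(1) by simp
    have cS2: "card (X - {x} - {a}) - l' = card (X - {x}) - l" using a xX l Cons.prems(1) by simp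
    have w2: "w \<in> words (X - {x} - {a}) l'" using aw l words_Cons by auto
    have m1: "ins_sum act 0 (X - {x}) (\<lambda>u. c (x # u)) (a # w) \<in> V (card (?S - {x}))"
      using ins_sum_V[OF _ ch aw] cS Cons.prems(1) by simp
    have m2: "word_bd act w (X - {x} - {a}) (\<lambda>u. c (x # a # u)) \<in> V (card (?S - {x}))"
      using word_bd_V[OF _ ch2 w2] cS cS2 Cons.prems(1) by simp
    have m3: "c (x # y # a # w) \<in> V (card (?S - {x} - {y}))" if y: "y \<in> ?S - {x}" for y
    proof -
      have yaw: "y # a # w \<in> words (X - {x}) (Suc l)" using words_ins[OF aw, of y 0] y by auto
      then have "c (x # y # a # w) \<in> V (card (X - {x}) - Suc l)" using ch by (auto simp: is_chain_def)
      moreover have "card (?S - {x} - {y}) = card (X - {x}) - Suc l" using cS y Cons.prems(1) by auto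
      ultimately show ?thesis by simp
    qed
    have "setact act id (?S - {x}) ?S (ins_sum act 0 (X - {x}) (\<lambda>u. c (x # u)) (a # w)) =
      (\<Sum>y\<in>?S - {x}. setact act id (?S - {x}) ?S (setact act id (?S - {x} - {y}) (?S - {x}) (c (x # y # a # w))))"
      unfolding ins_sum_def Sx using Cons.prems(1) m3
      by (simp, intro setact_sum) (auto intro!: setact_V)
    also have "\<dots> = (\<Sum>y\<in>?S - {x}. setact act id (?S - {y} - {x}) ?S (c (x # y # a # w)))"
    proof (intro sum.cong refl, subst setact_comp)
      fix y assume "y \<in> ?S - {x}"
      show "setact act (id \<circ> id) (?S - {x} - {y}) ?S (c (x # y # a # w)) =
        setact act id (?S - {y} - {x}) ?S (c (x # y # a # w))"
        by (simp add: Diff_insert[symmetric] insert_commute)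
    qed (use Cons.prems(1) m3 in auto)
    finally show ?thesis using setact_diff[OF _ _ _ _ m1 m2, of ?S id] Cons.prems(1)
      unfolding comm by simp
  qed
  note * = this
  show ?case unfolding word_bd.simps(2)[of act a w X] IH fr sum_subtractf[symmetric]
    by (rule sum.cong[OF refl], rule *[symmetric])
qed

text \<open>Split the inner boundary into front insertion and the rest \<open>?F\<close>. By
  \<open>word_bd_front_sum\<close> the outer boundary of the front insertion equals the front
  insertion of \<open>?F\<close>, and what remains is the square of the boundary on the letters
  behind the first one.\<close>

lemma word_bd_word_bd:
  assumes "finite X" "is_chain V X (Suc (Suc l)) c" "w \<in> words X l"
  shows "word_bd act w X (\<lambda>u. word_bd act u X c) = 0"
  using assms
proof (induction w arbitrary: X c l)
  case Nil
  have l: "l = 0" using Nil by (simp add: words_def)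
  have e: "is_chain V X 1 (\<lambda>u. ins_sum act 0 X c u)" "is_chain V X 1 (\<lambda>u. word_bd act (tl u) (X - {hd u}) (\<lambda>v. c (hd u # v)))"
  proof -
    show "is_chain V X 1 (\<lambda>u. ins_sum act 0 X c u)"
      using ins_sum_V[of X 1 c] Nil l by (auto simp: is_chain_def)
    show "is_chain V X 1 (\<lambda>u. word_bd act (tl u) (X - {hd u}) (\<lambda>v. c (hd u # v)))"
      unfolding is_chain_def
    proof
      fix u assume "u \<in> words X 1"
      then obtain x where x: "u = [x]" "x \<in> X" by (auto simp: words_def length_Suc_conv)
      have "is_chain V (X - {x}) 1 (\<lambda>v. c (x # v))" using is_chain_Cons[OF Nil(2) x(2) Nil(1)] l by simp
      then show "word_bd act (tl u) (X - {hd u}) (\<lambda>v. c (hd u # v)) \<in> V (card X - 1)"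
        using word_bd_V[of "X - {x}" 0 "\<lambda>v. c (x # v)" "[]"] x Nil(1) by (auto simp: words_def)
    qed
  qed
  have "word_bd act [] X (\<lambda>u. word_bd act u X c) = word_bd act [] X (\<lambda>u. ins_sum act 0 X c u - word_bd act (tl u) (X - {hd u}) (\<lambda>v. c (hd u # v)))"
    unfolding word_bd.simps(1) by (rule ins_sum_cong) simp
  also have "\<dots> = word_bd act [] X (\<lambda>u. ins_sum act 0 X c u) - word_bd act [] X (\<lambda>u. word_bd act (tl u) (X - {hd u}) (\<lambda>v. c (hd u # v)))"
    by (rule word_bd_diff) (use Nil e l in auto)
  also have "word_bd act [] X (\<lambda>u. word_bd act (tl u) (X - {hd u}) (\<lambda>v. c (hd u # v))) = word_bd act [] X (\<lambda>u. ins_sum act 0 X c u)"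
    using word_bd_front_sum[OF Nil] by (simp add: ins_sum_def)
  finally show ?case by simp
next
  case (Cons a w)
  then obtain l' where l: "l = Suc l'" by (auto simp: words_def)
  have a: "a \<in> X" and w: "w \<in> words (X - {a}) l'" using Cons.prems l words_Cons by auto
  let ?S = "X - set (a # w)"
  have fa: "finite (X - {a})" using Cons.prems by simp
  have ca: "is_chain V (X - {a}) (Suc (Suc l')) (\<lambda>u. c (a # u))"
    using is_chain_Cons[OF Cons.prems(2) a Cons.prems(1)] l by simp
  let ?F = "\<lambda>u. word_bd act (tl u) (X - {hd u}) (\<lambda>v. c (hd u # v))"
  have ch1: "is_chain V X (Suc l) (\<lambda>u. ins_sum act 0 X c u)"
    using ins_sum_V[OF Cons.prems(1,2)] by (auto simp: is_chain_def)
  have ch2: "is_chain V X (Suc l) ?F"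
    unfolding is_chain_def
  proof
    fix u assume u: "u \<in> words X (Suc l)"
    then obtain x v where x: "u = x # v" by (cases u) (auto simp: words_def)
    then have xX: "x \<in> X" "v \<in> words (X - {x}) l" using u words_Cons by auto
    show "?F u \<in> V (card X - Suc l)"
      using word_bd_V[OF _ is_chain_Cons[OF Cons.prems(2) xX(1) Cons.prems(1)] xX(2)] x xX Cons.prems(1) by auto
  qed
  have ch1a: "is_chain V (X - {a}) (Suc l') (\<lambda>u. ins_sum act 0 X c (a # u))"
    using is_chain_Cons[of V X "Suc l'" _ a] ch1 l a Cons.prems(1) by blast
  have ch3: "is_chain V (X - {a}) (Suc l') (\<lambda>u. word_bd act u (X - {a}) (\<lambda>v. c (a # v)))"
    using word_bd_V[OF fa ca] by (auto simp: is_chain_def)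
  have A: "ins_sum act 0 X (\<lambda>u. word_bd act u X c) (a # w) = ins_sum act 0 X (\<lambda>u. ins_sum act 0 X c u - ?F u) (a # w)"
    by (rule ins_sum_cong) simp
  have B: "ins_sum act 0 X (\<lambda>u. word_bd act u X c) (a # w) =
      ins_sum act 0 X (\<lambda>u. ins_sum act 0 X c u) (a # w) - ins_sum act 0 X ?F (a # w)"
    unfolding A by (rule ins_sum_diff[OF Cons.prems(1) ch1 ch2 Cons.prems(3)])
  have C: "word_bd act w (X - {a}) (\<lambda>u. word_bd act (a # u) X c) = word_bd act w (X - {a}) (\<lambda>u. ins_sum act 0 X c (a # u))"
    unfolding word_bd.simps(2) using word_bd_diff[OF fa ch1a ch3 w] Cons.IH[OF fa ca w] by simp
  have "word_bd act (a # w) X (\<lambda>u. ins_sum act 0 X c u) = ins_sum act 0 X ?F (a # w)"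
    using word_bd_front_sum[OF Cons.prems] by (simp add: ins_sum_def)
  moreover have "word_bd act (a # w) X (\<lambda>u. word_bd act u X c) =
      ins_sum act 0 X (\<lambda>u. word_bd act u X c) (a # w) - word_bd act w (X - {a}) (\<lambda>u. word_bd act (a # u) X c)"
    by (rule word_bd.simps(2))
  moreover have "word_bd act (a # w) X (\<lambda>u. ins_sum act 0 X c u) =
      ins_sum act 0 X (\<lambda>u. ins_sum act 0 X c u) (a # w) - word_bd act w (X - {a}) (\<lambda>u. ins_sum act 0 X c (a # u))"
    by (rule word_bd.simps(2))
  ultimately show ?case using B C by (simp only: diff_eq_eq) simp
qed

end

section \<open>Exactness of the complex of injective words\<close>

text \<open>Cycles modulo \<open>W\<close>, that is for the coefficients V/W. Degree 0 consists of
  the empty word and ends the complex, so every chain of degree 0 is a cycle.\<close>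

definition is_cyc :: "(nat \<Rightarrow> 'v::ab_group_add set) \<Rightarrow> 'v fi_action \<Rightarrow> nat set \<Rightarrow> nat \<Rightarrow> (nat list \<Rightarrow> 'v) \<Rightarrow> bool" where
  "is_cyc W act X l c \<longleftrightarrow> (\<forall>k w. l = Suc k \<longrightarrow> w \<in> words X k \<longrightarrow> word_bd act w X c \<in> W (card X - k))"

definition fi_sq :: "(nat \<Rightarrow> 'v::ab_group_add set) \<Rightarrow> (nat \<Rightarrow> 'v set) \<Rightarrow> 'v fi_action \<Rightarrow> bool" where
  "fi_sq V W act \<longleftrightarrow> fi_mod V act \<and> fi_mod W act \<and> (\<forall>n. W n \<subseteq> V n)"

lemma fi_mor_ext_star: "fi_mor f a b \<Longrightarrow> fi_mor (ext_star f a b) (Suc a) (Suc b)"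
  unfolding fi_mor_def ext_star_def inj_on_def image_subset_iff
  by (auto simp: less_Suc_eq)

lemma fi_mor_id: "a \<le> b \<Longrightarrow> fi_mor id a b"
  by (auto simp: fi_mor_def)

lemma fi_mor_comp: "fi_mor f a b \<Longrightarrow> fi_mor g b c \<Longrightarrow> fi_mor (g \<circ> f) a c"
  unfolding fi_mor_def by (metis comp_inj_on image_comp image_mono inj_on_subset order_trans)

lemma fi_mod_derived_V:
  assumes "fi_mod V act"
  shows "fi_mod (derived_V V) (derived_act act)"
proof -
  interpret fi_mod V act by fact
  show ?thesis
  proof (unfold_locales, unfold derived_V_def derived_act_def)
    fix f g a b x assume f: "fi_mor f a b" and eq: "\<And>i. i < a \<Longrightarrow> f i = g i" and x: "x \<in> V (Suc a)"
    show "act (ext_star f a b) (Suc a) (Suc b) x = act (ext_star g a b) (Suc a) (Suc b) x"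
      by (rule act_cong[OF fi_mor_ext_star[OF f] _ x]) (use eq in \<open>auto simp: ext_star_def\<close>)
  next
    fix x a assume x: "x \<in> V (Suc a)"
    have "act (ext_star id a a) (Suc a) (Suc a) x = act id (Suc a) (Suc a) x"
      by (rule act_cong[OF fi_mor_ext_star[OF fi_mor_id] _ x]) (auto simp: ext_star_def)
    then show "act (ext_star id a a) (Suc a) (Suc a) x = x" using act_id[OF x] by simp
  next
    fix f g a b c x assume f: "fi_mor f a b" and g: "fi_mor g b c" and x: "x \<in> V (Suc a)"
    have "act (ext_star (g \<circ> f) a c) (Suc a) (Suc c) x = act (ext_star g b c \<circ> ext_star f a b) (Suc a) (Suc c) x"
      by (rule act_cong[OF fi_mor_ext_star[OF fi_mor_comp[OF f g]] _ x])
        (use f in \<open>auto simp: ext_star_def fi_mor_def image_subset_iff less_Suc_eq\<close>)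
    then show "act (ext_star (g \<circ> f) a c) (Suc a) (Suc c) x =
        act (ext_star g b c) (Suc b) (Suc c) (act (ext_star f a b) (Suc a) (Suc b) x)"
      using act_comp[OF fi_mor_ext_star[OF f] fi_mor_ext_star[OF g] x] by simp
  qed (auto intro: act_V act_add fi_mor_ext_star)
qed

text \<open>The extension of \<open>f\<close> by the new point restricts to \<open>f\<close> on the
  old points, so it maps the image of M(a) into the image of M(b). This naturality makes the
  enlarged submodule stable under the derived action.\<close>

lemma fi_sq_derived:
  assumes "fi_sq V W act"
  shows "fi_sq (derived_V V) (derived_W V W act) (derived_act act)"
proof -
  interpret V: fi_mod V act using assms by (simp add: fi_sq_def)
  interpret W: fi_mod W act using assms by (simp add: fi_sq_def)
  interpret D: fi_mod "derived_V V" "derived_act act" by (rule fi_mod_derived_V) unfold_locales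
  have WV: "x \<in> W n \<Longrightarrow> x \<in> V n" for x n using assms by (auto simp: fi_sq_def)
  have img: "act id n (Suc n) y \<in> V (Suc n)" if "y \<in> V n" for y n
    using V.act_V[OF fi_mor_id that] by simp
  have sub: "derived_W V W act n \<subseteq> derived_V V n" for n
    using WV img by (auto simp: derived_W_def derived_V_def)
  have I: "x + act id n (Suc n) y \<in> derived_W V W act n" if "x \<in> W (Suc n)" "y \<in> V n" for x y n
    using that by (auto simp: derived_W_def)
  have E: "\<exists>x y. z = x + act id n (Suc n) y \<and> x \<in> W (Suc n) \<and> y \<in> V n" if "z \<in> derived_W V W act n" for z n
    using that by (auto simp: derived_W_def)
  have mem: "z \<in> derived_V V n" if "z \<in> derived_W V W act n" for z n using sub that by blast
  have "fi_mod (derived_W V W act) (derived_act act)"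
  proof
    show "0 \<in> derived_W V W act n" for n using I[of 0 n 0] by (simp add: fi_mor_id)
  next
    fix n x y assume "x \<in> derived_W V W act n" "y \<in> derived_W V W act n"
    then obtain x1 x2 y1 y2 where *: "x = x1 + act id n (Suc n) x2" "x1 \<in> W (Suc n)" "x2 \<in> V n"
      "y = y1 + act id n (Suc n) y2" "y1 \<in> W (Suc n)" "y2 \<in> V n" using E by metis
    have "x + y = (x1 + y1) + act id n (Suc n) (x2 + y2)"
      using * V.act_add[OF fi_mor_id, of n "Suc n" x2 y2] by (simp add: add_ac)
    then show "x + y \<in> derived_W V W act n" using I[of "x1 + y1" n "x2 + y2"] * by (simp only: V.V_add W.V_add)
  next
    fix n x assume "x \<in> derived_W V W act n"
    then obtain x1 x2 where *: "x = x1 + act id n (Suc n) x2" "x1 \<in> W (Suc n)" "x2 \<in> V n" using E by metis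
    have "act id n (Suc n) (x2 + - x2) = act id n (Suc n) x2 + act id n (Suc n) (- x2)"
      by (rule V.act_add) (use * fi_mor_id in auto)
    then have "act id n (Suc n) (- x2) = - act id n (Suc n) x2"
      by (simp add: fi_mor_id eq_neg_iff_add_eq_0 add.commute)
    then have "- x = - x1 + act id n (Suc n) (- x2)" using * by simp
    then show "- x \<in> derived_W V W act n" using I[of "- x1" n "- x2"] * by simp
  next
    fix f a b x assume f: "fi_mor f a b" and "x \<in> derived_W V W act a"
    then obtain x1 x2 where *: "x = x1 + act id a (Suc a) x2" "x1 \<in> W (Suc a)" "x2 \<in> V a" using E by metis
    have m: "act id a (Suc a) x2 \<in> V (Suc a)" using * img by simp
    have "act (ext_star f a b) (Suc a) (Suc b) (act id a (Suc a) x2) = act (ext_star f a b \<circ> id) a (Suc b) x2"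
      by (rule V.act_comp[symmetric]) (use * f fi_mor_id fi_mor_ext_star in auto)
    also have "\<dots> = act (id \<circ> f) a (Suc b) x2"
      by (rule V.act_cong[OF fi_mor_comp[OF fi_mor_id fi_mor_ext_star[OF f]]])
        (use * in \<open>auto simp: ext_star_def\<close>)
    also have "\<dots> = act id b (Suc b) (act f a b x2)"
      by (rule V.act_comp) (use * f fi_mor_id in auto)
    finally have "derived_act act f a b x = act (ext_star f a b) (Suc a) (Suc b) x1 + act id b (Suc b) (act f a b x2)"
      unfolding derived_act_def *(1) using V.act_add[OF fi_mor_ext_star[OF f] WV[OF *(2)] m] by simp
    then show "derived_act act f a b x \<in> derived_W V W act b"
      using I W.act_V[OF fi_mor_ext_star[OF f] *(2)] V.act_V[OF f *(3)] by simp
  next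
    fix f a b x y assume "fi_mor f a b" "x \<in> derived_W V W act a" "y \<in> derived_W V W act a"
    then show "derived_act act f a b (x + y) = derived_act act f a b x + derived_act act f a b y"
      using D.act_add mem by blast
  next
    fix f g a b x assume "fi_mor f a b" "\<And>i. i < a \<Longrightarrow> f i = g i" "x \<in> derived_W V W act a"
    then show "derived_act act f a b x = derived_act act g a b x"
      using D.act_cong mem by blast
  next
    fix x a assume "x \<in> derived_W V W act a"
    then show "derived_act act id a a x = x" using D.act_id mem by blast
  next
    fix f g a b c x assume "fi_mor f a b" "fi_mor g b c" "x \<in> derived_W V W act a"
    then show "derived_act act (g \<circ> f) a c x = derived_act act g b c (derived_act act f a b x)"
      using D.act_comp mem by blast
  qed
  then show ?thesis unfolding fi_sq_def using sub D.fi_mod_axioms by auto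
qed

lemma (in fi_mod) setact_derived:
  assumes "finite T" "S \<subseteq> T" "\<forall>x\<in>T. x < s" "v \<in> V (Suc (card S))"
  shows "setact (derived_act act) id S T v = setact act id (insert s S) (insert s T) v"
proof -
  have fS: "finite S" "\<forall>x\<in>S. x < s" using assms finite_subset by blast+
  have cS: "card (insert s S) = Suc (card S)" using fS by (metis card_insert_disjoint nat_less_le)
  have cT: "card (insert s T) = Suc (card T)" using assms by (metis card_insert_disjoint nat_less_le)
  have "fi_mor (index_of T \<circ> id \<circ> nth_of S) (card S) (card T)"
    by (rule fi_mor_setact) (use assms fS in auto)
  then have "act (ext_star (index_of T \<circ> id \<circ> nth_of S) (card S) (card T)) (Suc (card S)) (Suc (card T)) v
     = act (index_of (insert s T) \<circ> id \<circ> nth_of (insert s S)) (Suc (card S)) (Suc (card T)) v"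
  proof (intro act_cong fi_mor_ext_star)
    fix i assume "i < Suc (card S)"
    then consider "i < card S" | "i = card S" by linarith
    then show "ext_star (index_of T \<circ> id \<circ> nth_of S) (card S) (card T) i = (index_of (insert s T) \<circ> id \<circ> nth_of (insert s S)) i"
    proof cases
      case 1
      then have "nth_of S i \<in> T" using nth_of_mem[OF fS(1)] assms(2) by blast
      then show ?thesis using 1 assms fS by (simp add: ext_star_def nth_of_insert_top index_of_insert_top)
    qed (use assms fS in \<open>simp add: ext_star_def nth_of_insert_top index_of_insert_top\<close>)
  qed (use assms in auto)
  then show ?thesis by (simp add: setact_def derived_act_def cS cT)
qed

abbreviation sgn_pow :: "nat \<Rightarrow> 'v::ab_group_add \<Rightarrow> 'v" where
  "sgn_pow i x \<equiv> (if even i then x else - x)"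

text \<open>Inserting a letter into \<open>a @ s # u\<close> at or before \<open>s\<close> pushes
  \<open>s\<close> beyond position \<open>length a\<close>, where \<open>c\<close> vanishes. Only
  insertions into \<open>u\<close> survive; their positions are shifted by
  \<open>length a + 1\<close>, whence the sign.\<close>

lemma (in fi_mod) word_bd_prefix:
  assumes "finite X" "\<And>v. s \<in> set (drop (Suc (length a)) v) \<Longrightarrow> c v = 0"
  shows "word_bd act (a @ s # u) X c = sgn_pow (Suc (length a)) (word_bd act u (X - set a - {s}) (\<lambda>v. c (a @ s # v)))"
  using assms
proof (induction a arbitrary: X c)
  case Nil
  have "ins_sum act 0 X c (s # u) = ins_sum act 0 X (\<lambda>_. 0) (s # u)"
    by (rule ins_sum_cong) (simp add: Nil(2))
  then show ?case using Nil(1) by simp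
next
  case (Cons h a)
  have "ins_sum act 0 X c (h # a @ s # u) = ins_sum act 0 X (\<lambda>_. 0) (h # a @ s # u)"
    by (rule ins_sum_cong) (simp add: Cons(3))
  then have "word_bd act ((h # a) @ s # u) X c = - word_bd act (a @ s # u) (X - {h}) (\<lambda>v. c (h # v))"
    using Cons by simp
  also have "word_bd act (a @ s # u) (X - {h}) (\<lambda>v. c (h # v)) =
      sgn_pow (Suc (length a)) (word_bd act u (X - {h} - set a - {s}) (\<lambda>v. c (h # a @ s # v)))"
    using Cons.prems by (intro Cons.IH) auto
  also have "X - {h} - set a - {s} = X - set (h # a) - {s}" by auto
  finally show ?case by simp
qed

text \<open>An insertion never moves a letter to an earlier position. Hence a chain that vanishes on
  words with \<open>s\<close> late has a boundary with the same property.\<close>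

lemma set_drop_ins: "set (drop n w) \<subseteq> set (drop n (take j w @ x # drop j w))"
proof (induction w arbitrary: n j)
  case (Cons a w)
  show ?case
  proof (cases n)
    case 0
    then show ?thesis using set_append[of "take j (a # w)" "drop j (a # w)"] append_take_drop_id[of j "a # w"] by auto
  next
    case (Suc n')
    show ?thesis
    proof (cases j)
      case 0
      then show ?thesis using Suc set_drop_subset_set_drop[of n' "Suc n'" "a # w"] by simp
    next
      case (Suc j')
      then show ?thesis using Cons.IH[of n' j'] \<open>n = Suc n'\<close> by simp
    qed
  qed
qed simp

text \<open>Boundaries have boundary zero, and \<open>W\<close> is itself an FI-module, so chains
  with values in \<open>W\<close> have boundaries in \<open>W\<close>.\<close>

lemma is_cyc_modulo:
  assumes "fi_sq V W act" "finite X" "is_chain V X l c" "is_cyc W act X l c" "is_chain V X (Suc l) b"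
    "is_chain V X l c'" "is_chain W X l (\<lambda>w. c w - word_bd act w X b - c' w)"
  shows "is_cyc W act X l c'"
  unfolding is_cyc_def
proof (intro allI impI)
  fix k w assume l: "l = Suc k" and w: "w \<in> words X k"
  interpret V: fi_mod V act using assms by (simp add: fi_sq_def)
  interpret W: fi_mod W act using assms by (simp add: fi_sq_def)
  have ch: "is_chain V X (Suc k) (\<lambda>w. word_bd act w X b)" "is_chain V X (Suc k) (\<lambda>w. c w - word_bd act w X b)"
    using V.word_bd_V[OF assms(2,5)] assms(3) l by (auto simp: is_chain_def)
  have "word_bd act w X (\<lambda>w. c w - word_bd act w X b - c' w) = word_bd act w X c - word_bd act w X c'"
    using V.word_bd_diff[OF assms(2) ch(2) _ w, of c'] V.word_bd_diff[OF assms(2) _ ch(1) w, of c]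
      V.word_bd_word_bd[OF assms(2) _ w, of b] assms(3,5,6) l by simp
  then have "word_bd act w X c' = word_bd act w X c - word_bd act w X (\<lambda>w. c w - word_bd act w X b - c' w)" by simp
  moreover have "word_bd act w X (\<lambda>w. c w - word_bd act w X b - c' w) \<in> W (card X - k)"
    using W.word_bd_V[OF assms(2) _ w] assms(7) l by simp
  ultimately show "word_bd act w X c' \<in> W (card X - k)" using assms(4) l w by (auto simp: is_cyc_def)
qed

text \<open>A word with \<open>s\<close> in position \<open>i\<close> is a prefix \<open>a\<close>
  of length \<open>i\<close>, then \<open>s\<close>, then a word \<open>u\<close>. For fixed
  \<open>a\<close> the values \<open>c (a @ s # u)\<close> form, by \<open>word_bd_prefix\<close>, a
  cycle in \<open>u\<close> on the smaller set without \<open>a\<close> and \<open>s\<close>, with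
  unchanged coefficients. Degree and cardinality both drop by i + 1, so the range is kept and
  \<open>IH\<close> bounds this cycle. The bounding chains for all prefixes together clear position
  \<open>i\<close>.\<close>

lemma eliminate_position:
  assumes sq: "fi_sq V W act" and X: "finite X" "s \<in> X"
    and IH: "\<And>Z k c. finite Z \<Longrightarrow> card Z < card X \<Longrightarrow> int (card Z) \<ge> int k + M \<Longrightarrow> is_chain V Z k c \<Longrightarrow>
        is_cyc W act Z k c \<Longrightarrow> \<exists>b. is_chain V Z (Suc k) b \<and> is_chain W Z k (\<lambda>w. c w - word_bd act w Z b)"
    and cX: "int (card X) \<ge> int l + M"
    and c: "is_chain V X l c" "is_cyc W act X l c"
    and van: "\<And>w. s \<in> set (drop (Suc i) w) \<Longrightarrow> c w = 0"
  shows "\<exists>b c'. is_chain V X (Suc l) b \<and> is_chain V X l c' \<and>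
     is_chain W X l (\<lambda>w. c w - word_bd act w X b - c' w) \<and> (\<forall>w. s \<in> set (drop i w) \<longrightarrow> c' w = 0)"
proof -
  interpret V: fi_mod V act using sq by (simp add: fi_sq_def)
  interpret W: fi_mod W act using sq by (simp add: fi_sq_def)
  let ?zero = "\<lambda>c w. if s \<in> set (drop i w) then 0 else c w"
  show ?thesis
  proof (cases "i < l")
    case False
    show ?thesis
    proof (intro exI conjI allI impI)
      show "is_chain V X (Suc l) (\<lambda>_. 0)" by (simp add: is_chain_def)
      show "is_chain V X l (?zero c)" using c by (auto simp: is_chain_def)
      show "is_chain W X l (\<lambda>w. c w - word_bd act w X (\<lambda>_. 0) - ?zero c w)"
        using False X by (auto simp: is_chain_def words_def)
    qed auto
  next
    case True
    then obtain k where l: "l = Suc (i + k)" using less_iff_Suc_add by auto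
    let ?Z = "\<lambda>a. X - set a - {s}"
    have "\<forall>a\<in>words (X - {s}) i. \<exists>B. is_chain V (?Z a) (Suc k) B \<and>
       is_chain W (?Z a) k (\<lambda>u. c (a @ s # u) - word_bd act u (?Z a) B)"
    proof
      fix a assume a: "a \<in> words (X - {s}) i"
      have la: "length a = i" using a by (simp add: words_def)
      have cZ: "card (?Z a) = card X - Suc i"
        using card_words_compl[OF _ a] X by (simp add: Diff_insert2[symmetric] Diff_insert[symmetric] insert_commute)
      have "card X > 0" using X card_gt_0_iff by blast
      then have le: "Suc i \<le> card X" using words_length_le[OF _ a] X by simp
      have w: "a @ s # u \<in> words X (Suc (i + j))" if "u \<in> words (?Z a) j" for u j
        using that a X by (auto simp: words_def)
      show "\<exists>B. is_chain V (?Z a) (Suc k) B \<and>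
          is_chain W (?Z a) k (\<lambda>u. c (a @ s # u) - word_bd act u (?Z a) B)"
      proof (rule IH)
        show "finite (?Z a)" "card (?Z a) < card X" using X cZ le by auto
        show "int k + M \<le> int (card (?Z a))" using cX l le cZ by simp
        show "is_chain V (?Z a) k (\<lambda>u. c (a @ s # u))"
          unfolding is_chain_def
        proof
          fix u assume "u \<in> words (?Z a) k"
          then have "c (a @ s # u) \<in> V (card X - l)" using c(1) w l by (auto simp: is_chain_def)
          then show "c (a @ s # u) \<in> V (card (?Z a) - k)" using cZ l by simp
        qed
        show "is_cyc W act (?Z a) k (\<lambda>u. c (a @ s # u))"
          unfolding is_cyc_def
        proof (intro allI impI)
          fix k' u assume k': "k = Suc k'" and u: "u \<in> words (?Z a) k'"
          have "word_bd act (a @ s # u) X c \<in> W (card X - (i + k))"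
            using c(2) w[OF u] l k' unfolding is_cyc_def by (metis add_Suc_right)
          moreover have "word_bd act (a @ s # u) X c = sgn_pow (Suc i) (word_bd act u (?Z a) (\<lambda>v. c (a @ s # v)))"
            using V.word_bd_prefix[OF X(1), of s a c u] van la by simp
          ultimately have "word_bd act u (?Z a) (\<lambda>v. c (a @ s # v)) \<in> W (card X - (i + k))"
            using W.V_uminus[of "- word_bd act u (?Z a) (\<lambda>v. c (a @ s # v))" "card X - (i + k)"] by (auto split: if_splits)
          then show "word_bd act u (?Z a) (\<lambda>u. c (a @ s # u)) \<in> W (card (?Z a) - k')" using cZ k' by simp
        qed
      qed
    qed
    from bchoice[OF this] obtain B where B: "\<And>a. a \<in> words (X - {s}) i \<Longrightarrow> is_chain V (?Z a) (Suc k) (B a)"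
      "\<And>a. a \<in> words (X - {s}) i \<Longrightarrow> is_chain W (?Z a) k (\<lambda>u. c (a @ s # u) - word_bd act u (?Z a) (B a))"
      by auto
    \<comment> \<open>The sign cancels the one that \<open>word_bd_prefix\<close> produces when the
      boundary of \<open>b\<close> is taken.\<close>
    define b where "b w = (if w \<in> words X (length w) \<and> i < length w \<and> w ! i = s
       then sgn_pow (Suc i) (B (take i w) (drop (Suc i) w)) else 0)" for w
    have split: "w = take i w @ s # drop (Suc i) w" "take i w \<in> words (X - {s}) i" "drop (Suc i) w \<in> words (?Z (take i w)) (length w - Suc i)"
      "card (?Z (take i w)) = card X - Suc i"
      if "w \<in> words X (length w)" "i < length w" "w ! i = s" for w
    proof -
      show e: "w = take i w @ s # drop (Suc i) w" using that id_take_nth_drop by blast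
      have "distinct (take i w @ s # drop (Suc i) w)" using that e by (simp add: words_def)
      moreover have "set w \<subseteq> X" using that by (simp add: words_def)
      ultimately show a: "take i w \<in> words (X - {s}) i" "drop (Suc i) w \<in> words (?Z (take i w)) (length w - Suc i)"
        using that(2) by (auto simp: words_def dest: in_set_takeD in_set_dropD)
      show "card (?Z (take i w)) = card X - Suc i"
        using card_words_compl[OF _ a(1)] X by (simp add: Diff_insert2[symmetric] Diff_insert[symmetric] insert_commute)
    qed
    have bch: "is_chain V X (Suc l) b"
      unfolding is_chain_def
    proof
      fix w assume w: "w \<in> words X (Suc l)"
      then have lw: "length w = Suc l" by (simp add: words_def)
      show "b w \<in> V (card X - Suc l)"
      proof (cases "w ! i = s")
        case True
        have *: "w \<in> words X (length w)" "i < length w" using w lw l by auto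
        have "B (take i w) (drop (Suc i) w) \<in> V (card (?Z (take i w)) - Suc k)"
          using B(1)[OF split(2)[OF * True]] split(3)[OF * True] lw l by (auto simp: is_chain_def)
        then have "B (take i w) (drop (Suc i) w) \<in> V (card X - Suc l)"
          unfolding split(4)[OF * True] using l by simp
        then show ?thesis unfolding b_def by simp
      qed (simp add: b_def)
    qed
    have bvan: "b w = 0" if "s \<in> set (drop (Suc i) w)" for w
    proof (rule ccontr)
      assume "b w \<noteq> 0"
      then have *: "w \<in> words X (length w)" "i < length w" "w ! i = s" unfolding b_def by (auto split: if_splits)
      have "distinct (take i w @ s # drop (Suc i) w)" using * split(1)[OF *] by (simp add: words_def)
      then show False using that by simp
    qed
    \<comment> \<open>On words with \<open>s\<close> in position \<open>i\<close> the difference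
      lies in \<open>W\<close> but need not vanish. It is set to 0, since treating the next earlier
      position requires exact vanishing.\<close>
    let ?c' = "?zero (\<lambda>w. c w - word_bd act w X b)"
    show ?thesis
    proof (intro exI conjI allI impI)
      show "is_chain V X (Suc l) b" by (fact bch)
      show "is_chain V X l ?c'" using c(1) V.word_bd_V[OF X(1) bch] by (auto simp: is_chain_def)
      show "is_chain W X l (\<lambda>w. c w - word_bd act w X b - ?c' w)"
        unfolding is_chain_def
      proof
        fix w assume w: "w \<in> words X l"
        then have lw: "length w = l" by (simp add: words_def)
        have ww: "w \<in> words X (length w)" "i < length w" using w lw True by auto
        consider "s \<notin> set (drop i w)" | "w ! i = s" | "s \<in> set (drop (Suc i) w)"
          using ww(2) Cons_nth_drop_Suc[of i w] by (metis set_ConsD)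
        then show "c w - word_bd act w X b - ?c' w \<in> W (card X - l)"
        proof cases
          case 2
          let ?a = "take i w" and ?u = "drop (Suc i) w"
          note sp = split[OF ww 2]
          have la: "length ?a = i" using ww by simp
          have sw: "s \<in> set (drop i w)" using 2 ww by (metis Cons_nth_drop_Suc list.set_intros(1))
          have uk: "?u \<in> words (?Z ?a) k" using sp(3) lw l by simp
          have fZ: "finite (?Z ?a)" using X by simp
          have "word_bd act w X b = sgn_pow (Suc i) (word_bd act ?u (?Z ?a) (\<lambda>v. b (?a @ s # v)))"
            using V.word_bd_prefix[OF X(1), of s ?a b ?u] bvan la sp(1) by simp
          also have "word_bd act ?u (?Z ?a) (\<lambda>v. b (?a @ s # v)) = word_bd act ?u (?Z ?a) (\<lambda>v. sgn_pow (Suc i) (B ?a v))"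
          proof (rule word_bd_cong[OF uk])
            fix v assume v: "v \<in> words (?Z ?a) (Suc k)"
            have "?a @ s # v \<in> words X (length (?a @ s # v))" using v sp(2) X by (auto simp: words_def)
            moreover have "(?a @ s # v) ! i = s" "i < length (?a @ s # v)"
                "take i (?a @ s # v) = ?a" "drop (Suc i) (?a @ s # v) = v"
              using la by (auto simp: nth_append)
            ultimately show "b (?a @ s # v) = sgn_pow (Suc i) (B ?a v)" unfolding b_def by auto
          qed
          also have "\<dots> = sgn_pow (Suc i) (word_bd act ?u (?Z ?a) (B ?a))"
            using V.word_bd_uminus[OF fZ B(1)[OF sp(2)] uk] by auto
          finally have "word_bd act w X b = word_bd act ?u (?Z ?a) (B ?a)" by (auto split: if_splits)
          moreover have "c (?a @ s # ?u) - word_bd act ?u (?Z ?a) (B ?a) \<in> W (card (?Z ?a) - k)"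
            using B(2)[OF sp(2)] uk by (auto simp: is_chain_def)
          moreover have "c w = c (?a @ s # ?u)" using sp(1) by metis
          ultimately show ?thesis using sw sp(4) l by simp
        next
          case 3
          then have "s \<in> set (drop i w)" using set_drop_subset_set_drop[of i "Suc i" w] by auto
          moreover have "word_bd act w X b = 0"
            by (intro V.word_bd_zero[OF X(1)] bvan subsetD[OF set_drop_ins] 3)
          ultimately show ?thesis using van[OF 3] by simp
        qed simp
      qed
    qed auto
  qed
qed

text \<open>The descent begins beyond the last letter of all words of length \<open>l\<close> and
  stops at position 1. Words with \<open>s\<close> in front are kept: inserting \<open>s\<close> in
  front contributes the image of M(n) in M(n + 1), which is zero in the derived module.\<close>

lemma eliminate_late_positions:
  assumes sq: "fi_sq V W act" and X: "finite X" "s \<in> X"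
    and IH: "\<And>Z k c. finite Z \<Longrightarrow> card Z < card X \<Longrightarrow> int (card Z) \<ge> int k + M \<Longrightarrow> is_chain V Z k c \<Longrightarrow>
        is_cyc W act Z k c \<Longrightarrow> \<exists>b. is_chain V Z (Suc k) b \<and> is_chain W Z k (\<lambda>w. c w - word_bd act w Z b)"
    and cX: "int (card X) \<ge> int l + M"
    and c: "is_chain V X l c" "is_cyc W act X l c"
  shows "\<exists>b c'. is_chain V X (Suc l) b \<and> is_chain V X l c' \<and>
     is_chain W X l (\<lambda>w. c w - word_bd act w X b - c' w) \<and> (\<forall>w. s \<in> set (drop 1 w) \<longrightarrow> c' w = 0)"
    (is "?P 1")
proof -
  interpret V: fi_mod V act using sq by (simp add: fi_sq_def)
  interpret W: fi_mod W act using sq by (simp add: fi_sq_def)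
  have "1 \<le> Suc l" by simp
  then show "?P 1"
  proof (induction rule: inc_induct)
    case base
    show ?case
    proof (intro exI conjI allI impI)
      let ?c' = "\<lambda>w. if s \<in> set (drop (Suc l) w) then 0 else c w"
      show "is_chain V X (Suc l) (\<lambda>_. 0)" by (simp add: is_chain_def)
      show "is_chain V X l ?c'" using c by (auto simp: is_chain_def)
      show "is_chain W X l (\<lambda>w. c w - word_bd act w X (\<lambda>_. 0) - ?c' w)"
        using X by (auto simp: is_chain_def words_def)
    qed auto
  next
    case (step i)
    then obtain b c1 where 1: "is_chain V X (Suc l) b" "is_chain V X l c1"
       "is_chain W X l (\<lambda>w. c w - word_bd act w X b - c1 w)" "\<And>w. s \<in> set (drop (Suc i) w) \<Longrightarrow> c1 w = 0" by blast
    have "is_cyc W act X l c1" by (rule is_cyc_modulo[OF sq X(1) c 1(1-3)])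
    from eliminate_position[OF sq X IH cX 1(2) this 1(4)]
    obtain b2 c2 where 2: "is_chain V X (Suc l) b2" "is_chain V X l c2"
       "is_chain W X l (\<lambda>w. c1 w - word_bd act w X b2 - c2 w)" "\<forall>w. s \<in> set (drop i w) \<longrightarrow> c2 w = 0" by blast
    have "is_chain W X l (\<lambda>w. c w - word_bd act w X (\<lambda>u. b u + b2 u) - c2 w)"
      unfolding is_chain_def
    proof
      fix w assume w: "w \<in> words X l"
      have "c w - word_bd act w X (\<lambda>u. b u + b2 u) - c2 w = (c w - word_bd act w X b - c1 w) + (c1 w - word_bd act w X b2 - c2 w)"
        using V.word_bd_add[OF X(1) 1(1) 2(1) w] by simp
      moreover have "(c w - word_bd act w X b - c1 w) + (c1 w - word_bd act w X b2 - c2 w) \<in> W (card X - l)"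
        by (rule W.V_add) (use 1(3) 2(3) w in \<open>simp_all only: is_chain_def\<close>)
      ultimately show "c w - word_bd act w X (\<lambda>u. b u + b2 u) - c2 w \<in> W (card X - l)" by (simp only:)
    qed
    moreover have "is_chain V X (Suc l) (\<lambda>u. b u + b2 u)" using 1 2 by (simp add: is_chain_def)
    ultimately show ?case using 2 by blast
  qed
qed

lemma ins_sum_remove:
  assumes "finite X" "s \<in> X" "w \<in> words (X - {s}) l"
  shows "ins_sum act i X c w =
    setact act id (X - {s} - set w) (X - set w) (c (take i w @ s # drop i w)) +
    (\<Sum>x\<in>X - {s} - set w. setact act id (insert s (X - {s} - set w - {x})) (insert s (X - {s} - set w))
        (c (take i w @ x # drop i w)))"
proof -
  have s: "s \<notin> set w" using assms by (auto simp: words_def)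
  have e: "insert s (X - {s} - set w) = X - set w" "X - set w - {s} = X - {s} - set w" using s assms(2) by auto
  have e2: "insert s (X - {s} - set w - {x}) = X - set w - {x}" if "x \<in> X - {s} - set w" for x
    using that s assms(2) by auto
  have "ins_sum act i X c w =
    setact act id (X - set w - {s}) (X - set w) (c (take i w @ s # drop i w)) +
    (\<Sum>x\<in>X - set w - {s}. setact act id (X - set w - {x}) (X - set w) (c (take i w @ x # drop i w)))"
    unfolding ins_sum_def by (rule sum.remove) (use assms s in auto)
  then show ?thesis unfolding e(2) using e e2 by simp
qed

text \<open>When a letter other than \<open>s\<close> is inserted into a word avoiding
  \<open>s\<close>, both complements contain \<open>s\<close> as largest element, so these
  insertions form the boundary for the derived module. Inserting \<open>s\<close> itself counts in
  front only, because \<open>c\<close> vanishes wherever \<open>s\<close> comes later.\<close>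

lemma (in fi_mod) word_bd_remove_top:
  assumes X: "finite X" "s \<in> X" "\<forall>x\<in>X - {s}. x < s" and c: "is_chain V X (Suc l) c"
    and w: "w \<in> words (X - {s}) l"
    and van: "\<And>w. s \<in> set (drop 1 w) \<Longrightarrow> c w = 0"
  shows "word_bd act w X c = word_bd (derived_act act) w (X - {s}) c + setact act id (X - {s} - set w) (X - set w) (c (s # w))"
proof -
  let ?Y = "X - {s}"
  have lw: "length w = l" using w by (simp add: words_def)
  have s: "s \<notin> set w" using w by (auto simp: words_def)
  have wX: "w \<in> words X l" using w by (auto simp: words_def)
  have D: "ins_sum (derived_act act) i ?Y c w =
     (\<Sum>x\<in>?Y - set w. setact act id (insert s (?Y - set w - {x})) (insert s (?Y - set w)) (c (take i w @ x # drop i w)))" for i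
    unfolding ins_sum_def
  proof (intro sum.cong refl setact_derived)
    fix x assume x: "x \<in> ?Y - set w"
    have "X - set w - {x} = insert s (?Y - set w - {x})" using x s X(2) by auto
    moreover have "s \<notin> ?Y - set w - {x}" by simp
    ultimately have "card (X - set w - {x}) = Suc (card (?Y - set w - {x}))" using X(1) by (metis card_insert_disjoint finite_Diff)
    moreover have "c (take i w @ x # drop i w) \<in> V (card (X - set w - {x}))"
      using ins_sum_term_V(2)[OF X(1) wX, of x] x words_ins[OF wX, of x i] c by (auto simp: is_chain_def)
    ultimately show "c (take i w @ x # drop i w) \<in> V (Suc (card (?Y - set w - {x})))" by simp
  qed (use X in auto)
  have z: "setact act id (?Y - set w) (X - set w) (c (take i w @ s # drop i w)) =
     (if i = 0 then setact act id (?Y - set w) (X - set w) (c (s # w)) else 0)" if "i \<le> l" for i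
  proof (cases i)
    case (Suc j)
    then have "take i w \<noteq> []" using that lw by auto
    then have "s \<in> set (drop 1 (take i w @ s # drop i w))" by (cases "take i w") auto
    then have "c (take i w @ s # drop i w) = 0" by (rule van)
    moreover have "setact act id (?Y - set w) (X - set w) 0 = 0" by (rule setact_0) (use X in auto)
    ultimately show ?thesis using Suc by simp
  qed simp
  have "word_bd act w X c = (\<Sum>i\<le>l. (if even i then ins_sum (derived_act act) i ?Y c w else - ins_sum (derived_act act) i ?Y c w)
     + (if i = 0 then setact act id (?Y - set w) (X - set w) (c (s # w)) else 0))"
    unfolding word_bd_eq_sum lw
    by (intro sum.cong refl) (simp add: ins_sum_remove[OF X(1,2) w] D z add.commute)
  then show ?thesis unfolding sum.distrib word_bd_eq_sum lw by simp
qed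

text \<open>
  Let s be the largest element of X.  A cycle is first modified so that it vanishes on the words in
  which s occurs after the first position (by induction on the cardinality of X, starting with the
  latest position).  Its restriction to the words without s is then a cycle for the derived
  module, hence a boundary up to the image of M, and that image is the boundary of a chain on words
  starting with s.  What remains lives on words starting with s, and injectivity kills it.
\<close>

theorem word_complex_exact:
  assumes "fi_sq V W act" "poly_sq e m V W act" "finite X" "int (card X) \<ge> int l + max m (int e)"
    "is_chain V X l c" "is_cyc W act X l c"
  shows "\<exists>b. is_chain V X (Suc l) b \<and> is_chain W X l (\<lambda>w. c w - word_bd act w X b)"
  using assms
proof (induction e arbitrary: m V W act X l c)
  case 0
  interpret V: fi_mod V act using 0 by (simp add: fi_sq_def)
  have "is_chain W X l (\<lambda>w. c w - word_bd act w X (\<lambda>_. 0))"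
    unfolding is_chain_def
  proof
    fix w assume w: "w \<in> words X l"
    have "int (card X - l) \<ge> m" using 0(4) words_length_le[OF 0(3) w] by simp
    then have "V (card X - l) \<subseteq> W (card X - l)" using 0(2) by simp
    then show "c w - word_bd act w X (\<lambda>_. 0) \<in> W (card X - l)" using 0(3,5) w by (auto simp: is_chain_def)
  qed
  moreover have "is_chain V X (Suc l) (\<lambda>_. 0)" by (simp add: is_chain_def)
  ultimately show ?case by blast
next
  case (Suc e)
  note IHe = Suc.IH
  note sq = Suc.prems(1)
  note pol = Suc.prems(2)
  interpret V: fi_mod V act using sq by (simp add: fi_sq_def)
  interpret W: fi_mod W act using sq by (simp add: fi_sq_def)
  have inj: "x \<in> W a" if "int a \<ge> m" "fi_mor f a b" "x \<in> V a" "act f a b x \<in> W b" for f a b x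
    using pol that by auto
  have polD: "poly_sq e (m - 1) (derived_V V) (derived_W V W act) (derived_act act)" using pol by simp
  from Suc.prems(3-6) show ?case
  proof (induction "card X" arbitrary: X l c rule: less_induct)
    case less
    note X = \<open>finite X\<close> and cX = less.prems(2) and c = less.prems(3,4)
    define s where "s = Max X"
    \<comment> \<open>The term \<open>Suc e\<close> in the range provides a letter to remove; this
      is how the degree enters the bound.\<close>
    have Xne: "X \<noteq> {}" using cX by auto
    have s: "s \<in> X" "\<forall>x\<in>X - {s}. x < s"
      using Max_in[OF X Xne] Max_ge[OF X] unfolding s_def by (auto simp: less_le)
    let ?Y = "X - {s}"
    have fY: "finite ?Y" and cY: "card X = Suc (card ?Y)"
      using X s card_Suc_Diff1[of X s] by auto
    from eliminate_late_positions[OF sq X s(1) less.hyps cX c]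
    obtain b1 c1 where 1: "is_chain V X (Suc l) b1" "is_chain V X l c1"
       "is_chain W X l (\<lambda>w. c w - word_bd act w X b1 - c1 w)" "\<And>w. s \<in> set (drop 1 w) \<Longrightarrow> c1 w = 0" by blast
    have cyc1: "is_cyc W act X l c1" by (rule is_cyc_modulo[OF sq X c 1(1-3)])
    \<comment> \<open>As \<open>s\<close> is the largest letter, the inclusion of complements that
      adds \<open>s\<close> becomes the standard inclusion of initial segments after
      renumbering.\<close>
    have top: "setact act id (?Y - set w) (X - set w) v = act id (card X - Suc k) (Suc (card X - Suc k)) v"
      and cw: "card (?Y - set w) = card X - Suc k" "card (X - set w) = Suc (card X - Suc k)" "Suc k \<le> card X"
      if w: "w \<in> words ?Y k" "v \<in> V (card X - Suc k)" for w k v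
    proof -
      show cc: "card (?Y - set w) = card X - Suc k" using card_words_compl[OF fY w(1)] cY by simp
      have "s \<notin> set w" using w by (auto simp: words_def)
      then have ins: "X - set w = insert s (?Y - set w)" using s by auto
      then show cc2: "card (X - set w) = Suc (card X - Suc k)" using cc X by simp
      show "Suc k \<le> card X" using words_length_le[OF fY w(1)] cY by simp
      let ?T = "?Y - set w"
      have fT: "finite ?T" "\<forall>x\<in>?T. x < s" using X s by auto
      have "act id (card X - Suc k) (Suc (card X - Suc k)) v = act (index_of (insert s ?T) \<circ> id \<circ> nth_of ?T) (card X - Suc k) (Suc (card X - Suc k)) v"
        by (rule V.act_cong[OF fi_mor_id _ w(2)])
          (use fT cc nth_of_mem[OF fT(1)] index_of_nth_of[OF fT(1)] in \<open>simp_all add: index_of_insert_top\<close>)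
      then show "setact act id (?Y - set w) (X - set w) v = act id (card X - Suc k) (Suc (card X - Suc k)) v"
        unfolding setact_def cc cc2 unfolding ins by simp
    qed
    have chD: "is_chain (derived_V V) ?Y l c1"
      unfolding is_chain_def derived_V_def
    proof
      fix w assume w: "w \<in> words ?Y l"
      then have "w \<in> words X l" by (auto simp: words_def)
      then have "c1 w \<in> V (card X - l)" using 1(2) by (auto simp: is_chain_def)
      moreover have "l \<le> card ?Y" using words_length_le[OF fY w] .
      ultimately show "c1 w \<in> V (Suc (card ?Y - l))" using cY by (simp add: Suc_diff_le)
    qed
    \<comment> \<open>The boundary for the derived module differs from that of \<open>c1\<close> by
      the image of \<open>c1 (s # w)\<close>, which is zero modulo \<open>derived_W\<close>.\<close>
    have cycD: "is_cyc (derived_W V W act) (derived_act act) ?Y l c1"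
      unfolding is_cyc_def
    proof (intro allI impI)
      fix k w assume l: "l = Suc k" and w: "w \<in> words ?Y k"
      have wX: "w \<in> words X k" using w by (auto simp: words_def)
      have "s # w \<in> words X l" using w l s by (auto simp: words_def)
      then have v: "c1 (s # w) \<in> V (card X - Suc k)" using 1(2) l by (auto simp: is_chain_def)
      have "word_bd act w X c1 \<in> W (card X - k)" using cyc1 wX l by (auto simp: is_cyc_def)
      moreover have e: "card X - k = Suc (card ?Y - k)" "card X - Suc k = card ?Y - k"
        using cw(3)[OF w v] cY by auto
      moreover have "word_bd act w X c1 = word_bd (derived_act act) w ?Y c1 + act id (card ?Y - k) (Suc (card ?Y - k)) (c1 (s # w))"
        using V.word_bd_remove_top[OF X s _ w 1(4)] 1(2) l top[OF w v] e by simp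
      moreover have "word_bd act w X c1 + act id (card ?Y - k) (Suc (card ?Y - k)) (- c1 (s # w)) =
         word_bd act w X c1 - act id (card ?Y - k) (Suc (card ?Y - k)) (c1 (s # w))"
        using V.act_add[of id "card ?Y - k" "Suc (card ?Y - k)" "c1 (s # w)" "- c1 (s # w)"] v e
        by (simp add: fi_mor_id add_eq_0_iff)
      ultimately have "word_bd (derived_act act) w ?Y c1 = word_bd act w X c1 + act id (card ?Y - k) (Suc (card ?Y - k)) (- c1 (s # w))"
        by simp
      then show "word_bd (derived_act act) w ?Y c1 \<in> derived_W V W act (card ?Y - k)"
        unfolding derived_W_def using \<open>word_bd act w X c1 \<in> W (card X - k)\<close> v e
        by (intro CollectI exI conjI, simp, simp) (rule imageI, simp)
    qed
    \<comment> \<open>Cardinality, starting point and degree drop by one together, so the range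
      survives with \<open>l\<close> unchanged.\<close>
    have "int (card ?Y) \<ge> int l + max (m - 1) (int e)" using cX cY by simp
    from IHe[OF fi_sq_derived[OF sq] polD fY this chD cycD]
    obtain e' where e': "is_chain (derived_V V) ?Y (Suc l) e'"
      "is_chain (derived_W V W act) ?Y l (\<lambda>w. c1 w - word_bd (derived_act act) w ?Y e')" by blast
    have "\<forall>w\<in>words ?Y l. \<exists>z. z \<in> V (card X - Suc l) \<and>
        c1 w - word_bd (derived_act act) w ?Y e' - act id (card X - Suc l) (Suc (card X - Suc l)) z \<in> W (card X - l)"
    proof
      fix w assume w: "w \<in> words ?Y l"
      then have "c1 w - word_bd (derived_act act) w ?Y e' \<in> derived_W V W act (card ?Y - l)" using e' by (auto simp: is_chain_def)
      then obtain x z where xz: "c1 w - word_bd (derived_act act) w ?Y e' = x + act id (card ?Y - l) (Suc (card ?Y - l)) z"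
        "x \<in> W (Suc (card ?Y - l))" "z \<in> V (card ?Y - l)" by (auto simp: derived_W_def)
      moreover have "card X - l = Suc (card ?Y - l)" "card X - Suc l = card ?Y - l"
        using words_length_le[OF fY w] cY by auto
      ultimately show "\<exists>z. z \<in> V (card X - Suc l) \<and>
        c1 w - word_bd (derived_act act) w ?Y e' - act id (card X - Suc l) (Suc (card X - Suc l)) z \<in> W (card X - l)"
        by (intro exI[of _ z]) simp
    qed
    from bchoice[OF this] obtain z where z: "\<And>w. w \<in> words ?Y l \<Longrightarrow> z w \<in> V (card X - Suc l)"
        "\<And>w. w \<in> words ?Y l \<Longrightarrow>
           c1 w - word_bd (derived_act act) w ?Y e' - act id (card X - Suc l) (Suc (card X - Suc l)) (z w) \<in> W (card X - l)" by blast
    \<comment> \<open>On words beginning with \<open>s\<close> the values are the preimages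
      \<open>z\<close>. At a word without \<open>s\<close> they only add the image of
      \<open>z\<close> to the boundary, which removes exactly the defect that the derived module
      does not see.\<close>
    define b2 where "b2 w = (if s \<notin> set w then e' w else if s \<notin> set (tl w) then z (tl w) else 0)" for w
    have b2van: "b2 w = 0" if "s \<in> set (drop 1 w)" for w
      using that by (cases w) (auto simp: b2_def)
    have b2ch: "is_chain V X (Suc l) b2"
      unfolding is_chain_def
    proof
      fix w assume w: "w \<in> words X (Suc l)"
      show "b2 w \<in> V (card X - Suc l)"
      proof (cases "s \<in> set w")
        case False
        then have w': "w \<in> words ?Y (Suc l)" using w by (auto simp: words_def)
        then have "e' w \<in> V (Suc (card ?Y - Suc l))" using e'(1) by (auto simp: is_chain_def derived_V_def)
        then show ?thesis using False words_length_le[OF fY w'] cY by (simp add: b2_def Suc_diff_Suc)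
      next
        case True
        show ?thesis
        proof (cases "s \<in> set (tl w)")
          case False
          then obtain u where "w = s # u" "u \<in> words ?Y l" using True w by (cases w) (auto simp: words_def)
          then show ?thesis using z(1) False by (auto simp: b2_def)
        qed (use True in \<open>simp add: b2_def\<close>)
      qed
    qed
    let ?c2 = "\<lambda>w. c1 w - word_bd act w X b2"
    have late: "?c2 w = 0" if "s \<in> set (drop 1 w)" for w
    proof -
      have "word_bd act w X b2 = 0"
        by (intro V.word_bd_zero[OF X] b2van subsetD[OF set_drop_ins] that)
      then show ?thesis using 1(4)[OF that] by simp
    qed
    have noS: "?c2 w \<in> W (card X - l)" if w: "w \<in> words ?Y l" for w
    proof -
      have "word_bd act w X b2 = word_bd (derived_act act) w ?Y b2 + setact act id (?Y - set w) (X - set w) (b2 (s # w))"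
        by (rule V.word_bd_remove_top[OF X s b2ch w b2van])
      also have "word_bd (derived_act act) w ?Y b2 = word_bd (derived_act act) w ?Y e'"
        by (rule word_bd_cong[OF w]) (auto simp: b2_def words_def)
      also have "b2 (s # w) = z w" using w by (auto simp: b2_def words_def)
      also have "setact act id (?Y - set w) (X - set w) (z w) = act id (card X - Suc l) (Suc (card X - Suc l)) (z w)"
        by (rule top[OF w z(1)[OF w]])
      finally have "?c2 w = c1 w - word_bd (derived_act act) w ?Y e' - act id (card X - Suc l) (Suc (card X - Suc l)) (z w)"
        by simp
      then show ?thesis using z(2)[OF w] by (simp only:)
    qed
    define c3 where "c3 w = (if w \<noteq> [] \<and> hd w = s then ?c2 w else 0)" for w
    have c3van: "c3 w = 0" if "s \<in> set (drop 1 w)" for w using late[OF that] by (simp add: c3_def)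
    have c3ch: "is_chain V X l c3"
      using 1(2) V.word_bd_V[OF X b2ch] by (auto simp: is_chain_def c3_def)
    have c3mod: "is_chain W X l (\<lambda>w. c1 w - word_bd act w X b2 - c3 w)"
      unfolding is_chain_def
    proof
      fix w assume w: "w \<in> words X l"
      show "c1 w - word_bd act w X b2 - c3 w \<in> W (card X - l)"
      proof (cases "w \<noteq> [] \<and> hd w = s")
        case False
        show ?thesis
        proof (cases "s \<in> set w")
          case True
          then have "s \<in> set (drop 1 w)" using False by (cases w) auto
          from late[OF this] have "c1 w - word_bd act w X b2 - c3 w = 0" using c3van[OF \<open>s \<in> set (drop 1 w)\<close>] by simp
          then show ?thesis by (simp only: W.V_0)
        next
          case F: False
          then have "w \<in> words ?Y l" using w by (auto simp: words_def)
          from noS[OF this] show ?thesis using False by (auto simp: c3_def)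
        qed
      qed (simp add: c3_def)
    qed
    have cyc3: "is_cyc W act X l c3" by (rule is_cyc_modulo[OF sq X 1(2) cyc1 b2ch c3ch c3mod])
    have c3W: "is_chain W X l c3"
      unfolding is_chain_def
    proof
      fix w assume w: "w \<in> words X l"
      show "c3 w \<in> W (card X - l)"
      proof (cases "w \<noteq> [] \<and> hd w = s \<and> l \<noteq> 0")
        case False
        then show ?thesis using w by (auto simp: c3_def words_def)
      next
        case True
        then obtain u k where u: "w = s # u" "l = Suc k" "u \<in> words ?Y k"
          using w by (cases w) (auto simp: words_def)
        have uX: "u \<in> words X k" using u by (auto simp: words_def)
        have v: "c3 w \<in> V (card X - Suc k)" using c3ch w u by (auto simp: is_chain_def)
        have "word_bd act u X c3 = word_bd (derived_act act) u ?Y c3 + setact act id (?Y - set u) (X - set u) (c3 (s # u))"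
          by (rule V.word_bd_remove_top[OF X s _ u(3) c3van]) (use c3ch u in auto)
        also have "word_bd (derived_act act) u ?Y c3 = word_bd (derived_act act) u ?Y (\<lambda>_. 0)"
        proof (rule word_bd_cong[OF u(3)])
          fix v assume "v \<in> words ?Y (Suc k)"
          then show "c3 v = 0" by (cases v) (auto simp: c3_def words_def)
        qed
        also have "\<dots> = 0" using fi_mod.word_bd_0[OF fi_mod_derived_V[OF V.fi_mod_axioms] fY] .
        also have "setact act id (?Y - set u) (X - set u) (c3 (s # u)) = act id (card X - Suc k) (Suc (card X - Suc k)) (c3 w)"
          using top[OF u(3) v] u by simp
        finally have "act id (card X - Suc k) (Suc (card X - Suc k)) (c3 w) = word_bd act u X c3" by simp
        moreover have "word_bd act u X c3 \<in> W (card X - k)" using cyc3 uX u by (auto simp: is_cyc_def)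
        moreover have "Suc (card X - Suc k) = card X - k" using cw(3)[OF u(3) v] by simp
        ultimately have "act id (card X - Suc k) (Suc (card X - Suc k)) (c3 w) \<in> W (Suc (card X - Suc k))" by simp
        \<comment> \<open>The coefficients in degree l = k + 1 live on card X - l points, at least
          \<open>m\<close> of them, which is where injectivity of M(n) -> M(n + 1) modulo
          \<open>W\<close> is available.\<close>
        moreover have "int (card X - Suc k) \<ge> m" using cX cw(3)[OF u(3) v] u by simp
        ultimately show ?thesis using inj[OF _ fi_mor_id _ _ ] v u by (metis le_SucI order_refl)
      qed
    qed
    have "is_chain W X l (\<lambda>w. c w - word_bd act w X (\<lambda>u. b1 u + b2 u))"
      unfolding is_chain_def
    proof
      fix w assume w: "w \<in> words X l"
      have "c w - word_bd act w X (\<lambda>u. b1 u + b2 u) = (c w - word_bd act w X b1 - c1 w) + ((c1 w - word_bd act w X b2 - c3 w) + c3 w)"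
        using V.word_bd_add[OF X 1(1) b2ch w] by simp
      moreover have "\<dots> \<in> W (card X - l)"
        by (intro W.V_add) (use 1(3) c3mod c3W w in \<open>simp_all only: is_chain_def\<close>)
      ultimately show "c w - word_bd act w X (\<lambda>u. b1 u + b2 u) \<in> W (card X - l)" by (simp only:)
    qed
    moreover have "is_chain V X (Suc l) (\<lambda>u. b1 u + b2 u)" using 1(1) b2ch by (simp add: is_chain_def)
    ultimately show ?case by blast
  qed
qed

section \<open>Tuples in a finite set and the prism operator\<close>

text \<open>
  Chains are functions on tuples over E and the boundary sums over all insertions of an
  element of E.  The prism operator is the usual homotopy between the identity and the map induced by
  \<open>\<beta>\<close>; all three operators are defined by recursion on the first entry.
\<close>

primrec tuple_bd :: "'e set \<Rightarrow> 'e list \<Rightarrow> ('e list \<Rightarrow> 'v::ab_group_add) \<Rightarrow> 'v" where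
  "tuple_bd E [] g = (\<Sum>y\<in>E. g [y])"
| "tuple_bd E (x # xs) g = (\<Sum>y\<in>E. g (y # x # xs)) - tuple_bd E xs (\<lambda>ys. g (x # ys))"

primrec pushforward :: "'e set \<Rightarrow> ('e \<Rightarrow> 'e) \<Rightarrow> 'e list \<Rightarrow> ('e list \<Rightarrow> 'v::ab_group_add) \<Rightarrow> 'v" where
  "pushforward E \<beta> [] g = g []"
| "pushforward E \<beta> (x # xs) g = (\<Sum>y\<in>{y\<in>E. \<beta> y = x}. pushforward E \<beta> xs (\<lambda>ys. g (y # ys)))"

text \<open>The transpose of the operator that sends (y_0, ..., y_j) to the alternating sum over i
  of (y_0, ..., y_i, \<beta> y_i, ..., \<beta> y_j). The test on the head of \<open>xs\<close>
  detects the entry \<beta> y_i following y_i.\<close>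

primrec prism :: "'e set \<Rightarrow> ('e \<Rightarrow> 'e) \<Rightarrow> 'e list \<Rightarrow> ('e list \<Rightarrow> 'v::ab_group_add) \<Rightarrow> 'v" where
  "prism E \<beta> [] g = 0"
| "prism E \<beta> (x # xs) g =
     (if xs \<noteq> [] \<and> hd xs = \<beta> x then pushforward E \<beta> (tl xs) (\<lambda>ys. g (x # ys)) else 0)
     - prism E \<beta> xs (\<lambda>ys. g (x # ys))"

lemma tuple_bd_cong:
  assumes "\<And>ys. length ys = Suc (length xs) \<Longrightarrow> set ys \<subseteq> E \<union> set xs \<Longrightarrow> g ys = g' ys"
  shows "tuple_bd E xs g = tuple_bd E xs g'"
  using assms
proof (induction xs arbitrary: g g')
  case (Cons x xs)
  have 1: "tuple_bd E xs (\<lambda>ys. g (x # ys)) = tuple_bd E xs (\<lambda>ys. g' (x # ys))"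
    by (rule Cons.IH) (rule Cons.prems, auto)
  have 2: "(\<Sum>y\<in>E. g (y # x # xs)) = (\<Sum>y\<in>E. g' (y # x # xs))"
    by (rule sum.cong[OF refl], rule Cons.prems) auto
  show ?case by (simp add: 1 2)
qed (auto intro: sum.cong)

text \<open>The maps \<open>h\<close> to come are additive on a carrier set only, hence the subgroup
  \<open>H\<close>. Membership and additivity are proved together; with \<open>h = id\<close> the
  lemma serves for membership alone.\<close>

lemma sum_hom_0_mem:
  fixes h :: "'v::ab_group_add \<Rightarrow> 'u::ab_group_add"
  assumes H: "0 \<in> H" "\<And>x y. x \<in> H \<Longrightarrow> y \<in> H \<Longrightarrow> x - y \<in> H"
    and h: "h 0 = 0" "\<And>x y. x \<in> H \<Longrightarrow> y \<in> H \<Longrightarrow> h (x - y) = h x - h y"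
    and f: "\<And>y. y \<in> A \<Longrightarrow> f y \<in> H"
  shows "sum f A \<in> H \<and> h (sum f A) = (\<Sum>y\<in>A. h (f y))"
proof -
  have um: "- x \<in> H \<and> h (- x) = - h x" if "x \<in> H" for x
    using H(2)[of 0 x] h(2)[of 0 x] H(1) h(1) that by simp
  have add: "x + y \<in> H \<and> h (x + y) = h x + h y" if "x \<in> H" "y \<in> H" for x y
    using H(2)[of x "- y"] h(2)[of x "- y"] um that by simp
  show ?thesis using f by (induction A rule: infinite_finite_induct) (auto simp: H h add)
qed

lemma tuple_bd_hom:
  assumes H: "0 \<in> H" "\<And>x y. x \<in> H \<Longrightarrow> y \<in> H \<Longrightarrow> x - y \<in> H"
    and h: "h 0 = 0" "\<And>x y. x \<in> H \<Longrightarrow> y \<in> H \<Longrightarrow> h (x - y) = h x - h y"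
    and g: "\<And>ys. length ys = Suc (length xs) \<Longrightarrow> set ys \<subseteq> E \<union> set xs \<Longrightarrow> g ys \<in> H"
  shows "tuple_bd E xs g \<in> H \<and> h (tuple_bd E xs g) = tuple_bd E xs (\<lambda>ys. h (g ys))"
proof -
  note su = sum_hom_0_mem[where h = h, OF H h]
  show ?thesis using g
  proof (induction xs arbitrary: g)
    case Nil
    then show ?case using su[where A = E and f = "\<lambda>y. g [y]"] by simp
  next
    case (Cons x xs)
    have 1: "tuple_bd E xs (\<lambda>ys. g (x # ys)) \<in> H \<and> h (tuple_bd E xs (\<lambda>ys. g (x # ys))) = tuple_bd E xs (\<lambda>ys. h (g (x # ys)))"
      by (rule Cons.IH) (rule Cons.prems, auto)
    have 2: "(\<Sum>y\<in>E. g (y # x # xs)) \<in> H \<and> h (\<Sum>y\<in>E. g (y # x # xs)) = (\<Sum>y\<in>E. h (g (y # x # xs)))"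
    proof (rule su[where A = E and f = "\<lambda>y. g (y # x # xs)"])
      show "g (y # x # xs) \<in> H" if "y \<in> E" for y by (rule Cons.prems) (use that in auto)
    qed
    show ?case using 1 2 H h by simp
  qed
qed

lemma tuple_bd_0 [simp]: "tuple_bd E xs (\<lambda>_. 0) = 0"
  by (induction xs) auto

lemma tuple_bd_add: "tuple_bd E xs (\<lambda>ys. g ys + g' ys) = tuple_bd E xs g + tuple_bd E xs g'"
  by (induction xs arbitrary: g g') (auto simp: sum.distrib)

lemma tuple_bd_uminus: "tuple_bd E xs (\<lambda>ys. - g ys) = - tuple_bd E xs g"
  by (induction xs arbitrary: g) (auto simp: sum_negf)

lemma tuple_bd_diff: "tuple_bd E xs (\<lambda>ys. g ys - g' ys) = tuple_bd E xs g - tuple_bd E xs g'"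
  using tuple_bd_add[of E xs g "\<lambda>ys. - g' ys"] by (simp add: tuple_bd_uminus)

lemma tuple_bd_sum: "tuple_bd E xs (\<lambda>ys. \<Sum>k\<in>K. g k ys) = (\<Sum>k\<in>K. tuple_bd E xs (g k))"
  by (induction K rule: infinite_finite_induct) (auto simp: tuple_bd_add)

lemma tuple_bd_tuple_bd: "tuple_bd E xs (\<lambda>ys. tuple_bd E ys g) = 0"
proof (induction xs arbitrary: g)
  case Nil
  have "(\<Sum>y\<in>E. \<Sum>z\<in>E. g [z, y]) = (\<Sum>y\<in>E. \<Sum>z\<in>E. g [y, z])" by (rule sum.swap)
  then show ?case by (simp add: sum_subtractf)
next
  case (Cons x xs)
  have "(\<Sum>y\<in>E. \<Sum>z\<in>E. g (z # y # x # xs)) = (\<Sum>y\<in>E. \<Sum>z\<in>E. g (y # z # x # xs))" by (rule sum.swap)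
  then show ?case by (simp add: sum_subtractf tuple_bd_diff tuple_bd_sum Cons.IH)
qed

lemma tuple_bd_eq_sum:
  "tuple_bd E xs g = (\<Sum>i\<le>length xs. \<Sum>y\<in>E. if even i then g (take i xs @ y # drop i xs) else - g (take i xs @ y # drop i xs))"
proof (induction xs arbitrary: g)
  case (Cons x xs)
  show ?case unfolding length_Cons sum.atMost_Suc_shift tuple_bd.simps Cons.IH
    by (simp add: sum_negf[symmetric] if_distrib cong: if_cong) (intro sum.cong refl, auto)
qed simp

lemma tuple_bd_map:
  assumes "bij_betw \<gamma> E E"
  shows "tuple_bd E (map \<gamma> xs) g = tuple_bd E xs (\<lambda>ys. g (map \<gamma> ys))"
proof (induction xs arbitrary: g)
  case Nil
  show ?case using sum.reindex_bij_betw[OF assms, of "\<lambda>y. g [y]"] by simp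
next
  case (Cons x xs)
  show ?case using sum.reindex_bij_betw[OF assms, of "\<lambda>y. g (y # \<gamma> x # map \<gamma> xs)"] by (simp add: Cons.IH)
qed

lemma pushforward_cong:
  assumes "\<And>ys. length ys = length xs \<Longrightarrow> set ys \<subseteq> E \<Longrightarrow> map \<beta> ys = xs \<Longrightarrow> g ys = g' ys"
  shows "pushforward E \<beta> xs g = pushforward E \<beta> xs g'"
  using assms
proof (induction xs arbitrary: g g')
  case (Cons x xs)
  have "pushforward E \<beta> xs (\<lambda>ys. g (y # ys)) = pushforward E \<beta> xs (\<lambda>ys. g' (y # ys))" if "y \<in> E" "\<beta> y = x" for y
    by (rule Cons.IH) (rule Cons.prems, use that in auto)
  then show ?case by (auto intro: sum.cong)
qed simp

lemma pushforward_add: "pushforward E \<beta> xs (\<lambda>ys. g ys + g' ys) = pushforward E \<beta> xs g + pushforward E \<beta> xs g'"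
  by (induction xs arbitrary: g g') (auto simp: sum.distrib)

lemma pushforward_0 [simp]: "pushforward E \<beta> xs (\<lambda>_. 0) = 0"
  by (induction xs) auto

lemma pushforward_uminus: "pushforward E \<beta> xs (\<lambda>ys. - g ys) = - pushforward E \<beta> xs g"
  by (induction xs arbitrary: g) (auto simp: sum_negf)

lemma pushforward_diff: "pushforward E \<beta> xs (\<lambda>ys. g ys - g' ys) = pushforward E \<beta> xs g - pushforward E \<beta> xs g'"
  using pushforward_add[of E \<beta> xs g "\<lambda>ys. - g' ys"] by (simp add: pushforward_uminus)

lemma pushforward_sum: "pushforward E \<beta> xs (\<lambda>ys. \<Sum>k\<in>K. g k ys) = (\<Sum>k\<in>K. pushforward E \<beta> xs (g k))"
  by (induction K rule: infinite_finite_induct) (auto simp: pushforward_add)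

lemma prism_cong:
  assumes "\<And>ys. Suc (length ys) = length xs \<Longrightarrow> set ys \<subseteq> E \<union> set xs \<Longrightarrow> g ys = g' ys"
  shows "prism E \<beta> xs g = prism E \<beta> xs g'"
  using assms
proof (induction xs arbitrary: g g')
  case (Cons x xs)
  have 1: "prism E \<beta> xs (\<lambda>ys. g (x # ys)) = prism E \<beta> xs (\<lambda>ys. g' (x # ys))"
    by (rule Cons.IH) (rule Cons.prems, auto)
  have 2: "pushforward E \<beta> (tl xs) (\<lambda>ys. g (x # ys)) = pushforward E \<beta> (tl xs) (\<lambda>ys. g' (x # ys))" if "xs \<noteq> []"
    by (rule pushforward_cong) (rule Cons.prems, use that in \<open>cases xs, auto\<close>)
  show ?case using 1 2 by auto
qed simp

lemma prism_add: "prism E \<beta> xs (\<lambda>ys. g ys + g' ys) = prism E \<beta> xs g + prism E \<beta> xs g'"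
  by (induction xs arbitrary: g g') (auto simp: pushforward_add)

lemma prism_0 [simp]: "prism E \<beta> xs (\<lambda>_. 0) = 0"
  by (induction xs) auto

lemma prism_uminus: "prism E \<beta> xs (\<lambda>ys. - g ys) = - prism E \<beta> xs g"
  by (induction xs arbitrary: g) (auto simp: pushforward_uminus)

lemma prism_diff: "prism E \<beta> xs (\<lambda>ys. g ys - g' ys) = prism E \<beta> xs g - prism E \<beta> xs g'"
  using prism_add[of E \<beta> xs g "\<lambda>ys. - g' ys"] by (simp add: prism_uminus)

lemma prism_sum: "prism E \<beta> xs (\<lambda>ys. \<Sum>k\<in>K. g k ys) = (\<Sum>k\<in>K. prism E \<beta> xs (g k))"
  by (induction K rule: infinite_finite_induct) (auto simp: prism_add)

lemma sum_fibres:
  assumes "finite E" "\<And>y. y \<in> E \<Longrightarrow> \<beta> y \<in> E"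
  shows "(\<Sum>x\<in>E. \<Sum>y\<in>{y\<in>E. \<beta> y = x}. f y) = (\<Sum>y\<in>E. (f y :: 'v::ab_group_add))"
  by (rule sum.group) (use assms in auto)

text \<open>The fibres of \<beta> partition \<open>E\<close>, so summing over an inserted element
  after applying \<beta> is summing over its preimages before.\<close>

lemma pushforward_chain_map:
  assumes "finite E" "\<And>y. y \<in> E \<Longrightarrow> \<beta> y \<in> E"
  shows "tuple_bd E xs (\<lambda>ys. pushforward E \<beta> ys g) = pushforward E \<beta> xs (\<lambda>ys. tuple_bd E ys g)"
proof (induction xs arbitrary: g)
  case Nil
  show ?case using sum_fibres[OF assms, where f = "\<lambda>y. g [y]"] by simp
next
  case (Cons x xs)
  have A: "(\<Sum>y\<in>E. pushforward E \<beta> (y # x # xs) g) = (\<Sum>z\<in>E. pushforward E \<beta> (x # xs) (\<lambda>ys. g (z # ys)))"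
    using sum_fibres[OF assms, where f = "\<lambda>z. pushforward E \<beta> (x # xs) (\<lambda>ys. g (z # ys))"] by simp
  have B: "tuple_bd E xs (\<lambda>ys. pushforward E \<beta> (x # ys) g) = (\<Sum>z\<in>{z\<in>E. \<beta> z = x}. pushforward E \<beta> xs (\<lambda>ys. tuple_bd E ys (\<lambda>us. g (z # us))))"
    by (simp add: tuple_bd_sum Cons.IH)
  have "pushforward E \<beta> (x # xs) (\<lambda>ys. tuple_bd E ys g) =
     (\<Sum>z\<in>{z\<in>E. \<beta> z = x}. (\<Sum>y\<in>E. pushforward E \<beta> xs (\<lambda>ys. g (y # z # ys))) - pushforward E \<beta> xs (\<lambda>ys. tuple_bd E ys (\<lambda>us. g (z # us))))"
    by (simp add: pushforward_diff pushforward_sum)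
  also have "\<dots> = (\<Sum>z\<in>E. pushforward E \<beta> (x # xs) (\<lambda>ys. g (z # ys))) -
     (\<Sum>z\<in>{z\<in>E. \<beta> z = x}. pushforward E \<beta> xs (\<lambda>ys. tuple_bd E ys (\<lambda>us. g (z # us))))"
    unfolding sum_subtractf by (subst sum.swap) simp
  finally show ?case using A B by simp
qed

text \<open>The leading term of the prism, where the entry \<open>x\<close> is followed by \<beta>
  x. Inserting \<beta> x directly behind \<open>x\<close> contributes the pushforward itself; the
  later insertions pass through \<beta> by \<open>pushforward_chain_map\<close>.\<close>

lemma prism_shift:
  assumes "finite E" "\<And>y. y \<in> E \<Longrightarrow> \<beta> y \<in> E" "x \<in> E"
  shows "tuple_bd E xs (\<lambda>ys. if ys \<noteq> [] \<and> hd ys = \<beta> x then pushforward E \<beta> (tl ys) g else 0) =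
    pushforward E \<beta> xs g - (if xs \<noteq> [] \<and> hd xs = \<beta> x then pushforward E \<beta> (tl xs) (\<lambda>ys. tuple_bd E ys g) else 0)"
proof (cases xs)
  case Nil
  then show ?thesis using assms by (simp add: sum.delta)
next
  case (Cons x' xs')
  have "(\<Sum>y\<in>E. if y = \<beta> x then pushforward E \<beta> (x' # xs') g else 0) = pushforward E \<beta> (x' # xs') g"
    using assms by (subst sum.delta) auto
  moreover have "tuple_bd E xs' (\<lambda>ys. if x' = \<beta> x then pushforward E \<beta> ys g else 0) =
     (if x' = \<beta> x then pushforward E \<beta> xs' (\<lambda>ys. tuple_bd E ys g) else 0)"
    using pushforward_chain_map[OF assms(1,2), where xs = xs' and g = g] by simp
  ultimately show ?thesis using Cons by (simp cong: if_cong)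
qed

lemma prism_homotopy:
  assumes "finite E" "\<And>y. y \<in> E \<Longrightarrow> \<beta> y \<in> E" "set xs \<subseteq> E"
  shows "tuple_bd E xs (\<lambda>ys. prism E \<beta> ys g) + prism E \<beta> xs (\<lambda>ys. tuple_bd E ys g) = pushforward E \<beta> xs g - g xs"
  using assms(3)
proof (induction xs arbitrary: g)
  case Nil
  show ?case by simp
next
  case (Cons x xs)
  let ?g = "\<lambda>x ys. g (x # ys)"
  let ?c = "xs \<noteq> [] \<and> hd xs = \<beta> x"
  have xE: "x \<in> E" using Cons.prems by simp
  have IH: "tuple_bd E xs (\<lambda>ys. prism E \<beta> ys (?g x)) + prism E \<beta> xs (\<lambda>ys. tuple_bd E ys (?g x)) = pushforward E \<beta> xs (?g x) - g (x # xs)"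
    using Cons by simp
  have 1: "(\<Sum>y\<in>E. prism E \<beta> (y # x # xs) g) = pushforward E \<beta> (x # xs) g - (\<Sum>y\<in>E. prism E \<beta> (x # xs) (?g y))"
  proof -
    have "(\<Sum>y\<in>E. if x = \<beta> y then pushforward E \<beta> xs (?g y) else 0) = (\<Sum>y\<in>{y\<in>E. \<beta> y = x}. pushforward E \<beta> xs (?g y))"
      using assms(1) by (intro sum.mono_neutral_cong_right) auto
    then show ?thesis by (simp add: sum_subtractf cong: if_cong)
  qed
  have 2: "(\<Sum>y\<in>E. prism E \<beta> (x # xs) (?g y)) =
      (if ?c then \<Sum>y\<in>E. pushforward E \<beta> (tl xs) (\<lambda>ys. g (y # x # ys)) else 0) - (\<Sum>y\<in>E. prism E \<beta> xs (\<lambda>ys. g (y # x # ys)))"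
    by (simp add: sum_subtractf)
  have 3: "tuple_bd E xs (\<lambda>ys. prism E \<beta> (x # ys) g) =
      pushforward E \<beta> xs (?g x) - (if ?c then pushforward E \<beta> (tl xs) (\<lambda>ys. tuple_bd E ys (?g x)) else 0) - tuple_bd E xs (\<lambda>ys. prism E \<beta> ys (?g x))"
    using prism_shift[where \<beta> = \<beta>, OF assms(1,2) xE, where xs = xs and g = "?g x"] by (simp add: tuple_bd_diff)
  have 4: "prism E \<beta> (x # xs) (\<lambda>ys. tuple_bd E ys g) =
     (if ?c then (\<Sum>y\<in>E. pushforward E \<beta> (tl xs) (\<lambda>ys. g (y # x # ys))) - pushforward E \<beta> (tl xs) (\<lambda>ys. tuple_bd E ys (?g x)) else 0)
     - ((\<Sum>y\<in>E. prism E \<beta> xs (\<lambda>ys. g (y # x # ys))) - prism E \<beta> xs (\<lambda>ys. tuple_bd E ys (?g x)))"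
    by (simp add: pushforward_diff pushforward_sum prism_diff prism_sum)
  have "tuple_bd E (x # xs) (\<lambda>ys. prism E \<beta> ys g) = (\<Sum>y\<in>E. prism E \<beta> (y # x # xs) g) - tuple_bd E xs (\<lambda>ys. prism E \<beta> (x # ys) g)"
    by (simp only: tuple_bd.simps)
  \<comment> \<open>The bookkeeping left after the four evaluations: \<open>S\<close>,
    \<open>T\<close> and \<open>U\<close> cancel, and R + R' is the homotopy for \<open>xs\<close>,
    evaluated by the induction hypothesis.\<close>
  moreover have "R + R' = Q - u \<Longrightarrow>
     (P - ((if c then S else 0) - T)) - (Q - (if c then U else 0) - R) + ((if c then S - U else 0) - (T - R')) = P - u"
    for P Q R R' S T U u :: 'b and c
    by (auto simp: algebra_simps)
  ultimately show ?case using IH unfolding 1 2 3 4 by (simp only:)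
qed

lemma pushforward_map:
  assumes "inj_on \<gamma> E" "\<gamma> ` E = E" "\<And>y. y \<in> E \<Longrightarrow> \<beta> y \<in> E \<and> \<beta>' y \<in> E \<and> \<beta> (\<gamma> y) = \<gamma> (\<beta>' y)" "set xs \<subseteq> E"
  shows "pushforward E \<beta> (map \<gamma> xs) g = pushforward E \<beta>' xs (\<lambda>ys. g (map \<gamma> ys))"
  using assms(4)
proof (induction xs arbitrary: g)
  case (Cons x xs)
  have b: "bij_betw \<gamma> {y \<in> E. \<beta>' y = x} {y \<in> E. \<beta> y = \<gamma> x}"
    unfolding bij_betw_def
  proof
    show "inj_on \<gamma> {y \<in> E. \<beta>' y = x}" using assms(1) by (rule inj_on_subset) auto
    show "\<gamma> ` {y \<in> E. \<beta>' y = x} = {y \<in> E. \<beta> y = \<gamma> x}"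
    proof (intro equalityI subsetI)
      fix z assume "z \<in> {y \<in> E. \<beta> y = \<gamma> x}"
      then obtain y where y: "y \<in> E" "z = \<gamma> y" using assms(2) by blast
      then have "\<gamma> (\<beta>' y) = \<gamma> x" using \<open>z \<in> {y \<in> E. \<beta> y = \<gamma> x}\<close> assms(3) by auto
      then have "\<beta>' y = x" using assms(1,3) y Cons.prems by (meson inj_onD list.set_intros(1) subsetD)
      then show "z \<in> \<gamma> ` {y \<in> E. \<beta>' y = x}" using y by auto
    qed (use assms in auto)
  qed
  show ?case using sum.reindex_bij_betw[OF b, of "\<lambda>y. pushforward E \<beta> (map \<gamma> xs) (\<lambda>ys. g (y # ys))"] Cons by simp
qed simp

text \<open>Allowing \<beta> and \<beta>' to differ lets the map depend on a word: \<gamma> will be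
  translation by \<open>g\<close>, and the two maps belong to \<open>map g w\<close> and to
  \<open>w\<close>.\<close>

lemma prism_map:
  assumes "inj_on \<gamma> E" "\<gamma> ` E = E" "\<And>y. y \<in> E \<Longrightarrow> \<beta> y \<in> E \<and> \<beta>' y \<in> E \<and> \<beta> (\<gamma> y) = \<gamma> (\<beta>' y)" "set xs \<subseteq> E"
  shows "prism E \<beta> (map \<gamma> xs) g = prism E \<beta>' xs (\<lambda>ys. g (map \<gamma> ys))"
  using assms(4)
proof (induction xs arbitrary: g)
  case (Cons x xs)
  have h: "(map \<gamma> xs \<noteq> [] \<and> hd (map \<gamma> xs) = \<beta> (\<gamma> x)) = (xs \<noteq> [] \<and> hd xs = \<beta>' x)"
  proof (cases xs)
    case (Cons x' xs')
    then have "x' \<in> E" "x \<in> E" using Cons.prems by auto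
    then show ?thesis using Cons assms by (auto dest: inj_onD)
  qed simp
  have tl: "set (tl xs) \<subseteq> E" using Cons.prems by (cases xs) auto
  have "pushforward E \<beta> (map \<gamma> (tl xs)) (\<lambda>ys. g (\<gamma> x # ys)) = pushforward E \<beta>' (tl xs) (\<lambda>ys. g (\<gamma> x # map \<gamma> ys))"
    by (rule pushforward_map[where \<beta> = \<beta> and \<beta>' = \<beta>' and \<gamma> = \<gamma> and E = E]) (use assms(1-3) tl in auto)
  then show ?case unfolding list.map prism.simps h map_tl[symmetric] using Cons by simp
qed simp

lemma pushforward_inj:
  assumes "finite E" "inj_on \<beta> E" "set ys \<subseteq> E"
  shows "pushforward E \<beta> (map \<beta> ys) g = g ys"
  using assms(3)
proof (induction ys arbitrary: g)
  case (Cons y ys)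
  have "{z \<in> E. \<beta> z = \<beta> y} = {y}" using assms(2) Cons.prems by (auto dest: inj_onD)
  then show ?case using Cons by simp
qed simp

lemma pushforward_hom:
  assumes H: "0 \<in> H" "\<And>x y. x \<in> H \<Longrightarrow> y \<in> H \<Longrightarrow> x - y \<in> H"
    and h: "h 0 = 0" "\<And>x y. x \<in> H \<Longrightarrow> y \<in> H \<Longrightarrow> h (x - y) = h x - h y"
    and g: "\<And>ys. length ys = length xs \<Longrightarrow> set ys \<subseteq> E \<Longrightarrow> g ys \<in> H"
  shows "pushforward E \<beta> xs g \<in> H \<and> h (pushforward E \<beta> xs g) = pushforward E \<beta> xs (\<lambda>ys. h (g ys))"
  using g
proof (induction xs arbitrary: g)
  case (Cons x xs)
  have "pushforward E \<beta> xs (\<lambda>ys. g (y # ys)) \<in> H \<and>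
     h (pushforward E \<beta> xs (\<lambda>ys. g (y # ys))) = pushforward E \<beta> xs (\<lambda>ys. h (g (y # ys)))" if "y \<in> E" for y
    by (rule Cons.IH) (rule Cons.prems, use that in auto)
  then show ?case
    using sum_hom_0_mem[where h = h and A = "{y \<in> E. \<beta> y = x}" and f = "\<lambda>y. pushforward E \<beta> xs (\<lambda>ys. g (y # ys))", OF H h]
    by simp
qed simp

lemma prism_hom:
  assumes H: "0 \<in> H" "\<And>x y. x \<in> H \<Longrightarrow> y \<in> H \<Longrightarrow> x - y \<in> H"
    and h: "h 0 = 0" "\<And>x y. x \<in> H \<Longrightarrow> y \<in> H \<Longrightarrow> h (x - y) = h x - h y"
    and g: "\<And>ys. Suc (length ys) = length xs \<Longrightarrow> set ys \<subseteq> E \<union> set xs \<Longrightarrow> g ys \<in> H"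
  shows "prism E \<beta> xs g \<in> H \<and> h (prism E \<beta> xs g) = prism E \<beta> xs (\<lambda>ys. h (g ys))"
  using g
proof (induction xs arbitrary: g)
  case (Cons x xs)
  have 1: "prism E \<beta> xs (\<lambda>ys. g (x # ys)) \<in> H \<and>
     h (prism E \<beta> xs (\<lambda>ys. g (x # ys))) = prism E \<beta> xs (\<lambda>ys. h (g (x # ys)))"
    by (rule Cons.IH) (rule Cons.prems, auto)
  have 2: "pushforward E \<beta> (tl xs) (\<lambda>ys. g (x # ys)) \<in> H \<and>
     h (pushforward E \<beta> (tl xs) (\<lambda>ys. g (x # ys))) = pushforward E \<beta> (tl xs) (\<lambda>ys. h (g (x # ys)))" if "xs \<noteq> []"
    by (rule pushforward_hom[where h = h, OF H h]) (auto intro!: Cons.prems simp: that)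
  show ?case using 1 2 H h by auto
qed (use H h in simp)

section \<open>Stability in double complexes\<close>

text \<open>\<open>T j l\<close> sits in homological degree \<open>j\<close> and word degree
  \<open>l\<close>. All degrees share one type and one pair of maps, and the differentials commute
  without a sign, since elements are chased without forming a total complex.\<close>

locale double_complex =
  fixes T :: "nat \<Rightarrow> nat \<Rightarrow> 'a::ab_group_add set" and D1 D2 :: "'a \<Rightarrow> 'a"
  assumes T_0: "0 \<in> T j l" and T_diff: "x \<in> T j l \<Longrightarrow> y \<in> T j l \<Longrightarrow> x - y \<in> T j l"
    and D1_T: "x \<in> T (Suc j) l \<Longrightarrow> D1 x \<in> T j l" and D1_T0: "x \<in> T 0 l \<Longrightarrow> D1 x = 0"
    and D2_T: "x \<in> T j (Suc l) \<Longrightarrow> D2 x \<in> T j l" and D2_T0: "x \<in> T j 0 \<Longrightarrow> D2 x = 0"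
    and D1_diff: "x \<in> T j l \<Longrightarrow> y \<in> T j l \<Longrightarrow> D1 (x - y) = D1 x - D1 y"
    and D2_diff: "x \<in> T j l \<Longrightarrow> y \<in> T j l \<Longrightarrow> D2 (x - y) = D2 x - D2 y"
    and D1_D1: "x \<in> T j l \<Longrightarrow> D1 (D1 x) = 0" and D2_D2: "x \<in> T j l \<Longrightarrow> D2 (D2 x) = 0"
    and D1_D2: "x \<in> T j l \<Longrightarrow> D1 (D2 x) = D2 (D1 x)"
begin

text \<open>\<open>D2\<close> maps column \<open>l + 1\<close> to column \<open>l\<close> and so
  induces a map on the \<open>D1\<close>-homology of degree \<open>j\<close>. This and the next two
  definitions express through cycles and boundaries that the induced map is onto, injective or
  zero.\<close>

definition surj_H :: "nat \<Rightarrow> nat \<Rightarrow> bool" where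
  "surj_H j l \<longleftrightarrow> (\<forall>y\<in>T j l. D1 y = 0 \<longrightarrow> (\<exists>a\<in>T j (Suc l). D1 a = 0 \<and> (\<exists>b\<in>T (Suc j) l. y = D2 a + D1 b)))"

definition inj_H :: "nat \<Rightarrow> nat \<Rightarrow> bool" where
  "inj_H j l \<longleftrightarrow> (\<forall>s\<in>T j (Suc l). D1 s = 0 \<longrightarrow> (\<exists>b\<in>T (Suc j) l. D2 s = D1 b) \<longrightarrow> (\<exists>e\<in>T (Suc j) (Suc l). s = D1 e))"

definition zero_H :: "nat \<Rightarrow> nat \<Rightarrow> bool" where
  "zero_H j l \<longleftrightarrow> (\<forall>s\<in>T j (Suc l). D1 s = 0 \<longrightarrow> (\<exists>b\<in>T (Suc j) l. D2 s = D1 b))"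

definition row_exact :: "nat \<Rightarrow> bool" where
  "row_exact l \<longleftrightarrow> (\<forall>j. \<forall>z\<in>T j l. D2 z = 0 \<longrightarrow> (\<exists>y\<in>T j (Suc l). D2 y = z))"

text \<open>
  For odd l this plays the role of the vanishing E2-terms in the usual spectral sequence argument.
\<close>

definition kernel_acyclic :: "nat \<Rightarrow> nat \<Rightarrow> bool" where
  "kernel_acyclic l j \<longleftrightarrow> (\<forall>z\<in>T j l. D1 z = 0 \<longrightarrow> D2 z = 0 \<longrightarrow> (\<exists>u\<in>T (Suc j) l. D2 u = 0 \<and> D1 u = z))"

lemma T_uminus: "x \<in> T j l \<Longrightarrow> - x \<in> T j l"
  using T_diff[OF T_0, of x j l] by simp

lemma T_add: "x \<in> T j l \<Longrightarrow> y \<in> T j l \<Longrightarrow> x + y \<in> T j l"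
  using T_diff[of x j l "- y"] T_uminus by simp

lemma D1_0 [simp]: "D1 0 = 0"
  using D1_diff[OF T_0 T_0] by simp

lemma D2_0 [simp]: "D2 0 = 0"
  using D2_diff[OF T_0 T_0] by simp

lemma D1_uminus: "x \<in> T j l \<Longrightarrow> D1 (- x) = - D1 x"
  using D1_diff[OF T_0, of x j l] by simp

lemma D2_uminus: "x \<in> T j l \<Longrightarrow> D2 (- x) = - D2 x"
  using D2_diff[OF T_0, of x j l] by simp

lemma D1_add: "x \<in> T j l \<Longrightarrow> y \<in> T j l \<Longrightarrow> D1 (x + y) = D1 x + D1 y"
  using D1_diff[of x j l "- y"] T_uminus D1_uminus[of y j l] by simp

lemma D2_add: "x \<in> T j l \<Longrightarrow> y \<in> T j l \<Longrightarrow> D2 (x + y) = D2 x + D2 y"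
  using D2_diff[of x j l "- y"] T_uminus D2_uminus[of y j l] by simp

text \<open>Its use is to replace \<open>y\<close> by \<open>y - D2 e\<close>, a
  \<open>D1\<close>-cycle with the same \<open>D2\<close>. Exactness lifts \<open>D1 y\<close> to
  some \<open>s\<close> in column l + 1; \<open>kernel_acyclic\<close> corrects \<open>s\<close>
  within the kernel of \<open>D2\<close> to a \<open>D1\<close>-cycle, and injectivity makes that
  cycle a boundary \<open>D1 e\<close>.\<close>

lemma lift_boundary:
  assumes y: "y \<in> T (Suc j) l" and D2y: "D2 (D1 y) = 0"
    and ex: "row_exact l" and inj: "inj_H j l" and ka: "\<And>i. j = Suc i \<Longrightarrow> kernel_acyclic (Suc l) i"
  shows "\<exists>e\<in>T (Suc j) (Suc l). D1 (D2 e) = D1 y"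
proof -
  from ex D1_T[OF y] D2y obtain s where s: "s \<in> T j (Suc l)" "D2 s = D1 y" unfolding row_exact_def by blast
  have "\<exists>u\<in>T j (Suc l). D2 u = 0 \<and> D1 u = D1 s"
  proof (cases j)
    case 0
    then have "D1 s = 0" using s D1_T0 by simp
    then show ?thesis by (intro bexI[of _ 0]) (simp_all add: T_0)
  next
    case (Suc i)
    have "D1 s \<in> T i (Suc l)" using s Suc D1_T by simp
    moreover have "D1 (D1 s) = 0" using D1_D1[OF s(1)] .
    moreover have "D2 (D1 s) = 0" using D1_D2[OF s(1)] s(2) D1_D1[OF y] by simp
    ultimately show ?thesis using ka[OF Suc] Suc unfolding kernel_acyclic_def by blast
  qed
  then obtain u where u: "u \<in> T j (Suc l)" "D2 u = 0" "D1 u = D1 s" by blast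
  have "s - u \<in> T j (Suc l)" "D1 (s - u) = 0" "D2 (s - u) = D1 y"
    using T_diff D1_diff[OF s(1) u(1)] D2_diff[OF s(1) u(1)] s u by auto
  then obtain e where e: "e \<in> T (Suc j) (Suc l)" "s - u = D1 e"
    using inj y unfolding inj_H_def by metis
  have "D1 (D2 e) = D1 y" using D1_D2[OF e(1)] e(2) \<open>D2 (s - u) = D1 y\<close> by simp
  then show ?thesis using e by blast
qed

text \<open>Lift \<open>z\<close> to column l + 1 and correct the lift to a \<open>D1\<close>-cycle.
  Surjectivity writes it as \<open>D2 a + D1 b\<close>, so that \<open>z = D1 (D2 b)\<close>. The
  correction costs the same claim for column l + 2 in degree j - 2, which preserves the parity of
  \<open>l\<close>.\<close>

lemma kernel_acyclicI:
  assumes ex: "row_exact l" "j > 0 \<Longrightarrow> row_exact (Suc l)"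
    and surj: "surj_H j (Suc l)" and inj: "\<And>i. j = Suc i \<Longrightarrow> inj_H i (Suc l)"
    and ka: "\<And>i. j = Suc (Suc i) \<Longrightarrow> kernel_acyclic (Suc (Suc l)) i"
  shows "kernel_acyclic l j"
  unfolding kernel_acyclic_def
proof (intro ballI impI)
  fix z assume z: "z \<in> T j l" "D1 z = 0" "D2 z = 0"
  then obtain y where y: "y \<in> T j (Suc l)" "D2 y = z" using ex unfolding row_exact_def by blast
  have "\<exists>e\<in>T j (Suc (Suc l)). D1 (D2 e) = D1 y"
  proof (cases j)
    case 0
    then have "D1 y = 0" using y D1_T0 by simp
    then show ?thesis by (intro bexI[of _ 0]) (simp_all add: T_0)
  next
    case (Suc i)
    have "D2 (D1 y) = 0" using D1_D2[OF y(1)] y z by simp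
    then show ?thesis using lift_boundary[of y i "Suc l"] y Suc ex inj ka by auto
  qed
  then obtain e where e: "e \<in> T j (Suc (Suc l))" "D1 (D2 e) = D1 y" by blast
  let ?y = "y - D2 e"
  have y': "?y \<in> T j (Suc l)" "D1 ?y = 0" "D2 ?y = z"
    using T_diff D2_T[OF e(1)] D1_diff[OF y(1) D2_T[OF e(1)]] D2_diff[OF y(1) D2_T[OF e(1)]] D2_D2[OF e(1)] e y by auto
  then obtain a b where ab: "a \<in> T j (Suc (Suc l))" "D1 a = 0" "b \<in> T (Suc j) (Suc l)" "?y = D2 a + D1 b"
    using surj unfolding surj_H_def by metis
  have "z = D2 (D1 b)"
    using y' ab D2_add[OF D2_T[OF ab(1)] D1_T[OF ab(3)]] D2_D2[OF ab(1)] by simp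
  then show "\<exists>u\<in>T (Suc j) l. D2 u = 0 \<and> D1 u = z"
    using D2_T[OF ab(3)] D2_D2[OF ab(3)] D1_D2[OF ab(3)] by metis
qed

text \<open>The condition l + 2 j < 2 q is inherited by (l + 2, j - 2), so
  \<open>kernel_acyclic\<close> holds on all odd columns concerned. For surjectivity a lift of
  \<open>z\<close> to column 1 is corrected by \<open>kernel_acyclic\<close> there. For injectivity
  the chase moves on to column 2 and ends with a cycle whose \<open>D2\<close> is a boundary because
  the map from column 2 to column 1 is zero on homology.\<close>

theorem stability_step:
  assumes ex: "\<And>l. l \<le> 2 * q + 1 \<Longrightarrow> row_exact l"
    and surj: "\<And>j l. odd l \<Longrightarrow> l + 2 * j < 2 * q \<Longrightarrow> surj_H j (Suc l)"
    and inj: "\<And>j l. odd l \<Longrightarrow> l + 2 * j < 2 * q \<Longrightarrow> inj_H j (Suc l)"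
    and zero: "zero_H q 1"
  shows "surj_H q 0" "inj_H q 0"
proof -
  have ka: "kernel_acyclic l j" if "odd l" "l + 2 * j < 2 * q" for j l
    using that
  proof (induction j arbitrary: l rule: less_induct)
    case (less j)
    show ?case
    proof (rule kernel_acyclicI)
      show "row_exact l" "j > 0 \<Longrightarrow> row_exact (Suc l)" by (rule ex, use less.prems in simp)+
      show "surj_H j (Suc l)" using less.prems surj by simp
      show "inj_H i (Suc l)" if "j = Suc i" for i using less.prems inj that by simp
      show "kernel_acyclic (Suc (Suc l)) i" if "j = Suc (Suc i)" for i
        using less.IH[of i "Suc (Suc l)"] less.prems that by simp
    qed
  qed
  show "surj_H q 0"
    unfolding surj_H_def
  proof (intro ballI impI)
    fix z assume z: "z \<in> T q 0" "D1 z = 0"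
    then obtain y where y: "y \<in> T q (Suc 0)" "D2 y = z"
      using ex[of 0] D2_T0[OF z(1)] unfolding row_exact_def by auto
    have "\<exists>u\<in>T q (Suc 0). D2 u = 0 \<and> D1 u = D1 y"
    proof (cases q)
      case 0
      then have "D1 y = 0" using y D1_T0 by simp
      then show ?thesis by (intro bexI[of _ 0]) (simp_all add: T_0)
    next
      case (Suc i)
      have "D2 (D1 y) = 0" using D1_D2[OF y(1)] y z by simp
      moreover have "D1 y \<in> T i (Suc 0)" using y Suc D1_T by simp
      moreover have "D1 (D1 y) = 0" by (rule D1_D1[OF y(1)])
      ultimately show ?thesis using ka[of 1 i] Suc unfolding kernel_acyclic_def by auto
    qed
    then obtain u where u: "u \<in> T q (Suc 0)" "D2 u = 0" "D1 u = D1 y" by blast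
    have "y - u \<in> T q (Suc 0)" "D1 (y - u) = 0" "z = D2 (y - u) + D1 0"
      using T_diff D1_diff[OF y(1) u(1)] D2_diff[OF y(1) u(1)] y u by auto
    then show "\<exists>a\<in>T q (Suc 0). D1 a = 0 \<and> (\<exists>b\<in>T (Suc q) 0. z = D2 a + D1 b)" using T_0 by blast
  qed
  show "inj_H q 0"
    unfolding inj_H_def
  proof (intro ballI impI)
    fix y assume y: "y \<in> T q (Suc 0)" "D1 y = 0" and "\<exists>b\<in>T (Suc q) 0. D2 y = D1 b"
    then obtain b where b: "b \<in> T (Suc q) 0" "D2 y = D1 b" by blast
    obtain e where e: "e \<in> T (Suc q) (Suc 0)" "D2 e = b"
      using ex[of 0] D2_T0[OF b(1)] b(1) unfolding row_exact_def by auto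
    let ?y = "y - D1 e"
    have y': "?y \<in> T q (Suc 0)" "D2 ?y = 0" "D1 ?y = 0"
      using T_diff y D1_T[OF e(1)] D2_diff[OF y(1) D1_T[OF e(1)]] D1_diff[OF y(1) D1_T[OF e(1)]] D1_D2[OF e(1)] b e
        D1_D1[OF e(1)] by auto
    then obtain s where s: "s \<in> T q (Suc (Suc 0))" "D2 s = ?y" using ex[of 1] unfolding row_exact_def by auto
    have "\<exists>f\<in>T q (Suc (Suc (Suc 0))). D1 (D2 f) = D1 s"
    proof (cases q)
      case 0
      then have "D1 s = 0" using s D1_T0 by simp
      then show ?thesis by (intro bexI[of _ 0]) (simp_all add: T_0)
    next
      case (Suc i)
      have "D2 (D1 s) = 0" using D1_D2[OF s(1)] s y' by simp
      moreover have "kernel_acyclic (Suc (Suc (Suc 0))) i'" if "i = Suc i'" for i'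
        by (rule ka) (use Suc that in auto)
      ultimately show ?thesis
        using lift_boundary[of s i "Suc (Suc 0)"] s(1) Suc ex[of "Suc (Suc 0)"] inj[of "Suc 0" i] by auto
    qed
    then obtain f where f: "f \<in> T q (Suc (Suc (Suc 0)))" "D1 (D2 f) = D1 s" by blast
    let ?s = "s - D2 f"
    have s': "?s \<in> T q (Suc (Suc 0))" "D1 ?s = 0" "D2 ?s = ?y"
      using T_diff s D2_T[OF f(1)] D1_diff[OF s(1) D2_T[OF f(1)]] D2_diff[OF s(1) D2_T[OF f(1)]] D2_D2[OF f(1)] f by auto
    then obtain g where g: "g \<in> T (Suc q) (Suc 0)" "?y = D1 g" using zero unfolding zero_H_def by fastforce
    have "y = D1 (e + g)" using D1_add[OF e(1) g(1)] g(2) by (simp add: algebra_simps)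
    then show "\<exists>e\<in>T (Suc q) (Suc 0). y = D1 e" using T_add[OF e(1) g(1)] by blast
  qed
qed

end

section \<open>The double complex of equivariant chains\<close>

abbreviation Sym :: "nat \<Rightarrow> (nat \<Rightarrow> nat) set" where
  "Sym n \<equiv> {g. g permutes {..<n}}"

abbreviation translate :: "(nat \<Rightarrow> nat) \<Rightarrow> (nat \<Rightarrow> nat) list \<Rightarrow> (nat \<Rightarrow> nat) list" where
  "translate g xs \<equiv> map ((\<circ>) g) xs"

lemma finite_Sym [simp]: "finite (Sym n)"
  using finite_permutations by blast

lemma Sym_mono: "(n::nat) \<le> N \<Longrightarrow> g permutes {..<n} \<Longrightarrow> g permutes {..<N}"
  by (erule permutes_subset) auto

lemma Sym_comp: "g permutes {..<n} \<Longrightarrow> h permutes {..<n} \<Longrightarrow> (g \<circ> h) permutes {..<n}"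
  by (rule permutes_compose)

lemma inv_comp_cancel [simp]:
  assumes "g permutes S"
  shows "inv g \<circ> (g \<circ> x) = x" "g \<circ> (inv g \<circ> x) = x" "inv g (g y) = y" "g (inv g y) = y"
  using assms permutes_inv_o[OF assms] by (auto simp: comp_assoc[symmetric] permutes_inverses)

lemma Sym_translate_bij:
  assumes "n \<le> N" "g permutes {..<n}"
  shows "bij_betw ((\<circ>) g) (Sym N) (Sym N)"
proof (rule bij_betw_byWitness[where f' = "(\<circ>) (inv g)"])
  have g: "g permutes {..<N}" "inv g permutes {..<N}" using Sym_mono[OF assms] permutes_inv by auto
  show "(\<circ>) g ` Sym N \<subseteq> Sym N" "(\<circ>) (inv g) ` Sym N \<subseteq> Sym N" using g Sym_comp by auto
  show "\<forall>a\<in>Sym N. inv g \<circ> (g \<circ> a) = a" "\<forall>a'\<in>Sym N. g \<circ> (inv g \<circ> a') = a'" using assms by auto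
qed

lemma set_translate_Sym:
  "n \<le> N \<Longrightarrow> g permutes {..<n} \<Longrightarrow> set (translate g xs) \<subseteq> Sym N \<longleftrightarrow> set xs \<subseteq> Sym N"
proof -
  assume *: "n \<le> N" "g permutes {..<n}"
  have g: "g permutes {..<N}" "inv g permutes {..<N}" using Sym_mono[OF *] permutes_inv by auto
  have "(g \<circ> x) permutes {..<N} \<longleftrightarrow> x permutes {..<N}" for x
  proof
    assume "(g \<circ> x) permutes {..<N}"
    from Sym_comp[OF g(2) this] show "x permutes {..<N}" unfolding inv_comp_cancel(1)[OF g(1)] .
  qed (rule Sym_comp[OF g(1)])
  then show ?thesis unfolding set_map image_subset_iff subset_eq mem_Collect_eq by simp
qed

lemma translate_translate: "translate g (translate h xs) = translate (g \<circ> h) xs"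
  by (simp add: comp_assoc)

lemma translate_inv [simp]:
  assumes "g permutes S"
  shows "translate (inv g) (translate g xs) = xs" "translate g (translate (inv g) xs) = xs"
  using assms by (auto simp: map_idI)

lemma map_perm_inv [simp]:
  assumes "g permutes S"
  shows "map (inv g) (map g w) = w" "map g (map (inv g) w) = w"
  using assms by (auto simp: map_idI)

lemma words_map:
  assumes "g permutes {..<n}"
  shows "map g w \<in> words {..<n} l \<longleftrightarrow> w \<in> words {..<n} l"
  using assms permutes_in_image[OF assms]
  by (auto simp: words_def distinct_map image_subset_iff subset_iff intro: inj_on_subset[OF permutes_inj])

lemma compl_map:
  assumes "g permutes {..<n}"
  shows "{..<n} - set (map g w) = g ` ({..<n} - set w)"
  using image_set_diff[OF permutes_inj[OF assms], of "{..<n}" "set w"] permutes_image[OF assms] by simp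

text \<open>S_n acts freely on S_N by composition on the left. With a representative
  \<open>r x\<close> chosen in each orbit, \<open>x\<close> is uniquely some h \<circ> r x, and
  \<rho> returns h. The orbit S_n itself is treated separately so that \<rho> fixes its
  elements.\<close>

lemma exists_retraction:
  fixes n N :: nat
  assumes "n \<le> N"
  obtains \<rho> where "\<And>x. x permutes {..<N} \<Longrightarrow> \<rho> x permutes {..<n}"
    "\<And>h x. h permutes {..<n} \<Longrightarrow> x permutes {..<N} \<Longrightarrow> \<rho> (h \<circ> x) = h \<circ> \<rho> x"
    "\<And>x. x permutes {..<n} \<Longrightarrow> \<rho> x = x"
proof -
  define r where "r x = (SOME y. \<exists>h. h permutes {..<n} \<and> y = h \<circ> x)" for x :: "nat \<Rightarrow> nat"
  define \<rho> where "\<rho> x = (if x permutes {..<n} then x else x \<circ> inv (r x))" for x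
  have r: "\<exists>h. h permutes {..<n} \<and> r x = h \<circ> x" for x :: "nat \<Rightarrow> nat"
    unfolding r_def by (rule someI[of _ "id \<circ> x"]) (use permutes_id in blast)
  have r_eq: "r (h \<circ> x) = r x" if h: "h permutes {..<n}" for h x :: "nat \<Rightarrow> nat"
  proof -
    have "(\<exists>k. k permutes {..<n} \<and> y = k \<circ> (h \<circ> x)) \<longleftrightarrow> (\<exists>k. k permutes {..<n} \<and> y = k \<circ> x)" for y :: "nat \<Rightarrow> nat"
    proof
      assume "\<exists>k. k permutes {..<n} \<and> y = k \<circ> (h \<circ> x)"
      then show "\<exists>k. k permutes {..<n} \<and> y = k \<circ> x" using Sym_comp[OF _ h] by (metis comp_assoc)
    next
      assume "\<exists>k. k permutes {..<n} \<and> y = k \<circ> x"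
      then obtain k where k: "k permutes {..<n}" "y = k \<circ> x" by blast
      then have "y = (k \<circ> inv h) \<circ> (h \<circ> x)" using h by (simp add: comp_assoc)
      then show "\<exists>k. k permutes {..<n} \<and> y = k \<circ> (h \<circ> x)" using Sym_comp[OF k(1) permutes_inv[OF h]] by blast
    qed
    then show ?thesis by (simp add: r_def)
  qed
  have inv_r: "x \<circ> inv (r x) permutes {..<n}" if "x permutes {..<N}" for x
  proof -
    obtain h where h: "h permutes {..<n}" "r x = h \<circ> x" using r by blast
    have "inv (r x) = inv x \<circ> inv h" using h that by (simp add: permutes_bij o_inv_distrib)
    then have "x \<circ> inv (r x) = inv h" using that by simp
    then show ?thesis using permutes_inv[OF h(1)] by simp
  qed
  have mem: "(h \<circ> x) permutes {..<n} \<longleftrightarrow> x permutes {..<n}" if "h permutes {..<n}" for h x :: "nat \<Rightarrow> nat"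
    using Sym_comp[OF that] Sym_comp[OF permutes_inv[OF that], of "h \<circ> x"] that by auto
  show ?thesis
  proof (rule that[of \<rho>])
    show "\<rho> x permutes {..<n}" if "x permutes {..<N}" for x using inv_r[OF that] by (simp add: \<rho>_def)
    show "\<rho> (h \<circ> x) = h \<circ> \<rho> x" if "h permutes {..<n}" "x permutes {..<N}" for h x
      using mem[OF that(1)] r_eq[OF that(1)] by (simp add: \<rho>_def comp_assoc)
    show "\<rho> x = x" if "x permutes {..<n}" for x using that by (simp add: \<rho>_def)
  qed
qed

text \<open>Transitivity of the symmetric group on injective words of length \<open>k\<close>, with
  the increasing final segment as base point. The stabiliser of that base point is the smaller
  symmetric group, which is what Shapiro's lemma needs.\<close>

lemma exists_perm_word:
  assumes "v \<in> words {..<n' + k} k"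
  shows "\<exists>g. g permutes {..<n' + k} \<and> map g [n'..<n' + k] = v"
proof -
  have v: "distinct v" "set v \<subseteq> {..<n' + k}" "length v = k" using assms by (auto simp: words_def)
  have "card {..<n'} = card ({..<n' + k} - set v)"
    using v by (simp add: card_Diff_subset distinct_card)
  then obtain f where f: "bij_betw f {..<n'} ({..<n' + k} - set v)"
    using finite_same_card_bij by blast
  define g where "g x = (if x < n' then f x else if x < n' + k then v ! (x - n') else x)" for x
  have 1: "bij_betw g {..<n'} ({..<n' + k} - set v)"
    using f by (rule bij_betw_cong[THEN iffD1, rotated]) (auto simp: g_def)
  have "bij_betw ((!) v \<circ> (\<lambda>x. x - n')) {n'..<n' + k} (set v)"
  proof (rule bij_betw_trans)
    show "bij_betw (\<lambda>x. x - n') {n'..<n' + k} {..<k}"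
      by (rule bij_betw_byWitness[where f' = "\<lambda>x. x + n'"]) auto
    show "bij_betw ((!) v) {..<k} (set v)" using v by (intro bij_betw_nth) auto
  qed
  then have 2: "bij_betw g {n'..<n' + k} (set v)"
    by (rule bij_betw_cong[THEN iffD1, rotated]) (auto simp: g_def)
  have "bij_betw g ({..<n'} \<union> {n'..<n' + k}) (({..<n' + k} - set v) \<union> set v)"
    by (rule bij_betw_combine[OF 1 2]) auto
  moreover have "{..<n'} \<union> {n'..<n' + k} = {..<n' + k}" "({..<n' + k} - set v) \<union> set v = {..<n' + k}" using v by auto
  ultimately have "g permutes {..<n' + k}"
    by (intro bij_imp_permutes) (auto simp: g_def)
  moreover have "map g [n'..<n' + k] = v"
    by (rule nth_equalityI) (use v in \<open>auto simp: g_def\<close>)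
  ultimately show ?thesis by blast
qed

lemma sum_fun_apply: "(\<Sum>i\<in>I. f i) x = (\<Sum>i\<in>I. f i x)"
  by (induction I rule: infinite_finite_induct) auto

lemma tuple_bd_fun_apply: "tuple_bd E xs F u = tuple_bd E xs (\<lambda>ys. F ys u)"
proof (induction xs arbitrary: F)
  case Nil
  then show ?case by (simp add: sum_fun_apply)
next
  case (Cons x xs)
  show ?case using Cons[of "\<lambda>ys. F (x # ys)"] by (simp add: sum_fun_apply)
qed

context fi_mod begin

text \<open>The action of \<open>g\<close> on the word module: it carries the summand M(complement
  of w) at \<open>w\<close> to the summand at \<open>map g w\<close>.\<close>

definition move :: "nat \<Rightarrow> (nat \<Rightarrow> nat) \<Rightarrow> nat list \<Rightarrow> 'v \<Rightarrow> 'v" where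
  "move n g w = setact act g ({..<n} - set w) ({..<n} - set (map g w))"

lemma card_compl: "w \<in> words {..<n} l \<Longrightarrow> card ({..<n} - set w) = n - l"
  using card_words_compl[of "{..<n}"] by simp

lemma move_side:
  fixes n :: nat
  assumes "g permutes {..<n}"
  shows "finite ({..<n} - set w)" "finite ({..<n} - set (map g w))" "inj_on g ({..<n} - set w)"
    "g ` ({..<n} - set w) \<subseteq> {..<n} - set (map g w)"
  using compl_map[OF assms, of w] permutes_inj[OF assms] finite_lessThan[of n]
  by (auto intro: inj_on_subset simp del: finite_lessThan)

lemma move_V:
  assumes "g permutes {..<n}" "w \<in> words {..<n} l" "v \<in> V (n - l)"
  shows "move n g w v \<in> V (n - l)"
  using setact_V[OF move_side[OF assms(1)], of v w] words_map[OF assms(1), of w l] assms(2,3) card_compl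
  by (metis move_def)

lemma move_0 [simp]:
  assumes "g permutes {..<n}"
  shows "move n g w 0 = 0"
  unfolding move_def by (rule setact_0[OF move_side[OF assms]])

lemma move_diff:
  assumes "g permutes {..<n}" "w \<in> words {..<n} l" "v \<in> V (n - l)" "v' \<in> V (n - l)"
  shows "move n g w (v - v') = move n g w v - move n g w v'"
  unfolding move_def by (rule setact_diff[OF move_side[OF assms(1)]]) (use assms card_compl in auto)

lemma move_comp:
  assumes "g permutes {..<n}" "h permutes {..<n}" "w \<in> words {..<n} l" "v \<in> V (n - l)"
  shows "move n g (map h w) (move n h w v) = move n (g \<circ> h) w v"
proof -
  have "move n g (map h w) (move n h w v) = setact act (g \<circ> h) ({..<n} - set w) ({..<n} - set (map g (map h w))) v"
    unfolding move_def by (rule setact_comp) (use move_side[OF assms(1), of "map h w"] move_side[OF assms(2), of w] assms card_compl in auto)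
  then show ?thesis by (simp add: move_def)
qed

lemma move_ident:
  assumes "set (map g w) = set w" "\<And>x. x \<in> {..<n} - set w \<Longrightarrow> g x = x" "w \<in> words {..<n} l" "v \<in> V (n - l)"
  shows "move n g w v = v"
  unfolding move_def assms(1) by (rule setact_ident) (use assms card_compl in auto)

text \<open>Two chains \<open>c\<close> and \<open>c'\<close> occur because equivariance compares
  the values of one function at a tuple and at its translate.\<close>

lemma ins_sum_equivariant:
  assumes g: "g permutes {..<n}" and w: "w \<in> words {..<n} l"
    and c: "is_chain V {..<n} (Suc l) c"
    and c': "\<And>u. u \<in> words {..<n} (Suc l) \<Longrightarrow> c' (map g u) = move n g u (c u)"
  shows "ins_sum act i {..<n} c' (map g w) = move n g w (ins_sum act i {..<n} c w)"
proof -
  let ?S = "{..<n} - set w" and ?S' = "{..<n} - set (map g w)"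
  have S': "?S' = g ` ?S" by (rule compl_map[OF g])
  have inj: "inj_on g ?S" using move_side[OF g] by blast
  let ?t = "\<lambda>x. take i w @ x # drop i w"
  have tx: "?t x \<in> words {..<n} (Suc l)" "{..<n} - set (?t x) = ?S - {x}" if "x \<in> ?S" for x
  proof -
    show "?t x \<in> words {..<n} (Suc l)" by (rule words_ins[OF w that])
    have "set (?t x) = insert x (set w)" using set_append[of "take i w" "drop i w"] by simp
    then show "{..<n} - set (?t x) = ?S - {x}" by auto
  qed
  have cv: "c (?t x) \<in> V (card (?S - {x}))" if "x \<in> ?S" for x
    using ins_sum_term_V(2)[OF _ w that] c tx(1)[OF that] by (auto simp: is_chain_def)
  have "ins_sum act i {..<n} c' (map g w) =
      (\<Sum>x\<in>?S. setact act id (?S' - {g x}) ?S' (c' (take i (map g w) @ g x # drop i (map g w))))"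
    unfolding ins_sum_def by (subst S', subst sum.reindex[OF inj]) simp
  also have "\<dots> = (\<Sum>x\<in>?S. move n g w (setact act id (?S - {x}) ?S (c (?t x))))"
  proof (rule sum.cong[OF refl])
    fix x assume x: "x \<in> ?S"
    have e: "take i (map g w) @ g x # drop i (map g w) = map g (?t x)" by (simp add: take_map drop_map)
    have c2: "{..<n} - set (map g (?t x)) = ?S' - {g x}"
      unfolding compl_map[OF g] tx(2)[OF x] using inj permutes_inj[OF g] by (auto dest: injD)
    have "setact act id (?S' - {g x}) ?S' (c' (map g (?t x))) =
       setact act id (?S' - {g x}) ?S' (setact act g (?S - {x}) (?S' - {g x}) (c (?t x)))"
      unfolding c'[OF tx(1)[OF x]] move_def c2 tx(2)[OF x] ..
    also have "\<dots> = setact act (id \<circ> g) (?S - {x}) ?S' (c (?t x))"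
    proof (rule setact_comp)
      show "g ` (?S - {x}) \<subseteq> ?S' - {g x}" unfolding S' using inj x by (auto dest: inj_onD)
    qed (use inj cv[OF x] in \<open>auto intro: inj_on_subset\<close>)
    also have "\<dots> = setact act (g \<circ> id) (?S - {x}) ?S' (c (?t x))" by simp
    also have "\<dots> = move n g w (setact act id (?S - {x}) ?S (c (?t x)))"
      unfolding move_def by (rule setact_comp[symmetric]) (use move_side[OF g, of w] cv[OF x] in auto)
    finally show "setact act id (?S' - {g x}) ?S' (c' (take i (map g w) @ g x # drop i (map g w))) =
       move n g w (setact act id (?S - {x}) ?S (c (?t x)))" unfolding e .
  qed
  also have "\<dots> = move n g w (ins_sum act i {..<n} c w)"
    unfolding ins_sum_def move_def
    by (rule setact_sum[symmetric, OF move_side[OF g]]) (use cv in \<open>auto intro!: setact_V\<close>)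
  finally show ?thesis .
qed

lemma word_bd_equivariant:
  assumes "g permutes {..<n}" "w \<in> words {..<n} l" "is_chain V {..<n} (Suc l) c"
    "\<And>u. u \<in> words {..<n} (Suc l) \<Longrightarrow> c' (map g u) = move n g u (c u)"
  shows "word_bd act (map g w) {..<n} c' = move n g w (word_bd act w {..<n} c)"
proof -
  have m: "ins_sum act i {..<n} c w \<in> V (card ({..<n} - set w))" for i
    using ins_sum_V[OF _ assms(3,2)] card_compl[OF assms(2)] by simp
  have "move n g w (word_bd act w {..<n} c) =
    (\<Sum>i\<le>length w. move n g w (if even i then ins_sum act i {..<n} c w else - ins_sum act i {..<n} c w))"
    unfolding word_bd_eq_sum move_def by (rule setact_sum[OF move_side[OF assms(1)]]) (use m in auto)
  also have "\<dots> = word_bd act (map g w) {..<n} c'"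
    unfolding word_bd_eq_sum using ins_sum_equivariant[where c' = c', OF assms]
    by (intro sum.cong) (simp_all add: move_def setact_uminus[OF move_side[OF assms(1)] m] del: set_map)
  finally show ?thesis by simp
qed

text \<open>
  The group S_n acts freely on the tuples of permutations of {..<N}, so equivariant functions from
  these tuples to a module compute its homology.  Here the module is the degree l part of the complex
  of injective words on {..<n}.  Using the same tuples for all n up to N makes Shapiro's lemma
  an isomorphism of complexes, namely the restriction to words with a prescribed tail.
\<close>

definition eqv_chains :: "nat \<Rightarrow> nat \<Rightarrow> nat \<Rightarrow> nat \<Rightarrow> ((nat \<Rightarrow> nat) list \<Rightarrow> nat list \<Rightarrow> 'v) set" where
  "eqv_chains N n j l = {f.
     (\<forall>xs w. \<not> (set xs \<subseteq> Sym N \<and> length xs = Suc j \<and> w \<in> words {..<n} l) \<longrightarrow> f xs w = 0) \<and>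
     (\<forall>xs w. set xs \<subseteq> Sym N \<longrightarrow> length xs = Suc j \<longrightarrow> w \<in> words {..<n} l \<longrightarrow> f xs w \<in> V (n - l) \<and>
        (\<forall>g. g permutes {..<n} \<longrightarrow> f (translate g xs) (map g w) = move n g w (f xs w)))}"

text \<open>A tuple in degree \<open>j\<close> has j + 1 entries. The value at the empty tuple would
  be the augmentation, which the condition \<open>xs \<noteq> []\<close> cuts off.\<close>

definition D1 :: "nat \<Rightarrow> ((nat \<Rightarrow> nat) list \<Rightarrow> nat list \<Rightarrow> 'v) \<Rightarrow> (nat \<Rightarrow> nat) list \<Rightarrow> nat list \<Rightarrow> 'v" where
  "D1 N f = (\<lambda>xs w. if set xs \<subseteq> Sym N \<and> xs \<noteq> [] then tuple_bd (Sym N) xs (\<lambda>ys. f ys w) else 0)"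

text \<open>The faces are kept apart from their alternating sum \<open>D2\<close>, since it is the
  single faces that are compared up to homotopy.\<close>

definition D2_at :: "nat \<Rightarrow> nat \<Rightarrow> ((nat \<Rightarrow> nat) list \<Rightarrow> nat list \<Rightarrow> 'v) \<Rightarrow> (nat \<Rightarrow> nat) list \<Rightarrow> nat list \<Rightarrow> 'v" where
  "D2_at n i f = (\<lambda>xs w. if w \<in> words {..<n} (length w) then ins_sum act i {..<n} (f xs) w else 0)"

definition D2 :: "nat \<Rightarrow> ((nat \<Rightarrow> nat) list \<Rightarrow> nat list \<Rightarrow> 'v) \<Rightarrow> (nat \<Rightarrow> nat) list \<Rightarrow> nat list \<Rightarrow> 'v" where
  "D2 n f = (\<lambda>xs w. if w \<in> words {..<n} (length w) then word_bd act w {..<n} (f xs) else 0)"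

lemma eqv_chainsI:
  assumes "\<And>xs w. \<not> (set xs \<subseteq> Sym N \<and> length xs = Suc j \<and> w \<in> words {..<n} l) \<Longrightarrow> f xs w = 0"
    "\<And>xs w. set xs \<subseteq> Sym N \<Longrightarrow> length xs = Suc j \<Longrightarrow> w \<in> words {..<n} l \<Longrightarrow> f xs w \<in> V (n - l)"
    "\<And>xs w g. set xs \<subseteq> Sym N \<Longrightarrow> length xs = Suc j \<Longrightarrow> w \<in> words {..<n} l \<Longrightarrow> g permutes {..<n} \<Longrightarrow>
       f (translate g xs) (map g w) = move n g w (f xs w)"
  shows "f \<in> eqv_chains N n j l"
  using assms unfolding eqv_chains_def by blast

lemma eqv_chains_zero: "f \<in> eqv_chains N n j l \<Longrightarrow> \<not> (set xs \<subseteq> Sym N \<and> length xs = Suc j \<and> w \<in> words {..<n} l) \<Longrightarrow> f xs w = 0"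
  unfolding eqv_chains_def by blast

lemma eqv_chains_V: "f \<in> eqv_chains N n j l \<Longrightarrow> f xs w \<in> V (n - l)"
  unfolding eqv_chains_def by (cases "set xs \<subseteq> Sym N \<and> length xs = Suc j \<and> w \<in> words {..<n} l") auto

lemma eqv_chains_equiv:
  assumes "f \<in> eqv_chains N n j l" "n \<le> N" "g permutes {..<n}"
  shows "f (translate g xs) (map g w) = move n g w (f xs w)"
proof (cases "set xs \<subseteq> Sym N \<and> length xs = Suc j \<and> w \<in> words {..<n} l")
  case True
  then show ?thesis using assms unfolding eqv_chains_def by blast
next
  case False
  then have "\<not> (set (translate g xs) \<subseteq> Sym N \<and> length (translate g xs) = Suc j \<and> map g w \<in> words {..<n} l)"
    unfolding set_translate_Sym[OF assms(2,3)] words_map[OF assms(3)] by simp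
  from eqv_chains_zero[OF assms(1) this] eqv_chains_zero[OF assms(1) False] show ?thesis using assms(3) by simp
qed

lemma eqv_chains_chain: "f \<in> eqv_chains N n j l \<Longrightarrow> is_chain V {..<n} l' (f xs)"
  unfolding is_chain_def
proof
  fix w assume f: "f \<in> eqv_chains N n j l" and w: "w \<in> words {..<n} l'"
  show "f xs w \<in> V (card {..<n} - l')"
  proof (cases "l' = l")
    case False
    then have "w \<notin> words {..<n} l" using w by (auto simp: words_def)
    then show ?thesis using eqv_chains_zero[OF f, of xs w] by simp
  qed (use eqv_chains_V[OF f] in simp)
qed

lemma eqv_chains_0: "0 \<in> eqv_chains N n j l"
  by (rule eqv_chainsI) auto

lemma eqv_chains_diff:
  assumes "f \<in> eqv_chains N n j l" "f' \<in> eqv_chains N n j l" "n \<le> N"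
  shows "f - f' \<in> eqv_chains N n j l"
proof (rule eqv_chainsI)
  fix xs w g assume "w \<in> words {..<n} l" "g permutes {..<n}"
  then show "(f - f') (translate g xs) (map g w) = move n g w ((f - f') xs w)"
    using eqv_chains_equiv[OF assms(1,3)] eqv_chains_equiv[OF assms(2,3)] move_diff eqv_chains_V[OF assms(1)] eqv_chains_V[OF assms(2)] by simp
qed (use eqv_chains_zero[OF assms(1)] eqv_chains_zero[OF assms(2)] eqv_chains_V[OF assms(1)] eqv_chains_V[OF assms(2)] in auto)

lemma D1_zero_length:
  assumes f: "f \<in> eqv_chains N n j l" and "length xs \<noteq> j \<or> w \<notin> words {..<n} l"
  shows "D1 N f xs w = 0"
proof -
  have "tuple_bd (Sym N) xs (\<lambda>ys. f ys w) = tuple_bd (Sym N) xs (\<lambda>_. 0)"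
    by (rule tuple_bd_cong, rule eqv_chains_zero[OF f]) (use assms(2) in auto)
  then show ?thesis by (simp add: D1_def)
qed

lemma D1_eqv_chains0: "f \<in> eqv_chains N n 0 l \<Longrightarrow> D1 N f = 0"
  using D1_zero_length[of f N n 0 l] by (intro ext) (metis D1_def length_0_conv zero_fun_apply)

lemma D1_eqv_chains:
  assumes f: "f \<in> eqv_chains N n (Suc j) l" and n: "n \<le> N"
  shows "D1 N f \<in> eqv_chains N n j l"
proof (rule eqv_chainsI)
  fix xs w assume "\<not> (set xs \<subseteq> Sym N \<and> length xs = Suc j \<and> w \<in> words {..<n} l)"
  then show "D1 N f xs w = 0" using D1_zero_length[OF f, of xs w] by (auto simp: D1_def)
next
  fix xs w assume "set xs \<subseteq> Sym N" "length xs = Suc j" "w \<in> words {..<n} l"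
  then show "D1 N f xs w \<in> V (n - l)"
    using tuple_bd_hom[of "V (n - l)" id xs "Sym N" "\<lambda>ys. f ys w"] eqv_chains_V[OF f] by (auto simp: D1_def)
next
  fix xs w g assume xs: "set xs \<subseteq> Sym N" "length xs = Suc j" and w: "w \<in> words {..<n} l" and g: "g permutes {..<n}"
  have "D1 N f (translate g xs) (map g w) = tuple_bd (Sym N) (translate g xs) (\<lambda>ys. f ys (map g w))"
    using xs set_translate_Sym[OF n g, of xs] by (auto simp: D1_def)
  also have "\<dots> = tuple_bd (Sym N) xs (\<lambda>ys. f (translate g ys) (map g w))"
    by (rule tuple_bd_map[OF Sym_translate_bij[OF n g]])
  also have "\<dots> = tuple_bd (Sym N) xs (\<lambda>ys. move n g w (f ys w))"
    unfolding eqv_chains_equiv[OF f n g] ..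
  also have "\<dots> = move n g w (tuple_bd (Sym N) xs (\<lambda>ys. f ys w))"
    using tuple_bd_hom[of "V (n - l)" "move n g w" xs "Sym N" "\<lambda>ys. f ys w"] move_diff[OF g w] eqv_chains_V[OF f] g by auto
  finally show "D1 N f (translate g xs) (map g w) = move n g w (D1 N f xs w)" using xs by (auto simp: D1_def)
qed

lemma D1_diff: "D1 N (f - f') = D1 N f - D1 N f'"
  by (intro ext) (simp add: D1_def tuple_bd_diff)

lemma D1_0: "D1 N 0 = 0" "D1 N (\<lambda>a b. 0) = (\<lambda>a b. 0)"
  by (auto simp: D1_def fun_eq_iff)

lemma D1_D1: "D1 N (D1 N f) = 0"
proof (intro ext)
  fix xs w
  have "tuple_bd (Sym N) xs (\<lambda>ys. D1 N f ys w) = tuple_bd (Sym N) xs (\<lambda>ys. tuple_bd (Sym N) ys (\<lambda>zs. f zs w))" if "set xs \<subseteq> Sym N"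
    by (rule tuple_bd_cong) (use that in \<open>auto simp: D1_def\<close>)
  then show "D1 N (D1 N f) xs w = 0 xs w"
    unfolding D1_def[of N "D1 N f"] by (simp add: tuple_bd_tuple_bd)
qed

lemma D2_at_zero:
  assumes f: "f \<in> eqv_chains N n j (Suc l)" and "\<not> (set xs \<subseteq> Sym N \<and> length xs = Suc j \<and> w \<in> words {..<n} l)"
  shows "D2_at n i f xs w = 0"
proof (cases "w \<in> words {..<n} (length w)")
  case True
  have "ins_sum act i {..<n} (f xs) w = ins_sum act i {..<n} (\<lambda>_. 0) w"
  proof (rule ins_sum_cong, rule eqv_chains_zero[OF f])
    fix x assume x: "x \<in> {..<n} - set w"
    show "\<not> (set xs \<subseteq> Sym N \<and> length xs = Suc j \<and> take i w @ x # drop i w \<in> words {..<n} (Suc l))"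
    proof
      assume *: "set xs \<subseteq> Sym N \<and> length xs = Suc j \<and> take i w @ x # drop i w \<in> words {..<n} (Suc l)"
      then have "length w = l" by (auto simp: words_def)
      then show False using * True assms(2) by auto
    qed
  qed
  then show ?thesis by (simp add: D2_at_def)
qed (simp add: D2_at_def)

lemma D2_at_eqv_chains:
  assumes f: "f \<in> eqv_chains N n j (Suc l)" and n: "n \<le> N"
  shows "D2_at n i f \<in> eqv_chains N n j l"
proof (rule eqv_chainsI)
  fix xs w assume "\<not> (set xs \<subseteq> Sym N \<and> length xs = Suc j \<and> w \<in> words {..<n} l)"
  then show "D2_at n i f xs w = 0" by (rule D2_at_zero[OF f])
next
  fix xs w assume w: "w \<in> words {..<n} l"
  then show "D2_at n i f xs w \<in> V (n - l)"
    using ins_sum_V[OF _ eqv_chains_chain[OF f] w] by (simp add: D2_at_def)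
next
  fix xs w g assume w: "w \<in> words {..<n} l" and g: "g permutes {..<n}"
  have w': "w \<in> words {..<n} (length w)" using w by (simp add: words_def)
  then have "map g w \<in> words {..<n} (length (map g w))" using words_map[OF g] by simp
  then show "D2_at n i f (translate g xs) (map g w) = move n g w (D2_at n i f xs w)"
    using w' ins_sum_equivariant[OF g w eqv_chains_chain[OF f], of "f (translate g xs)" xs i] eqv_chains_equiv[OF f n g]
    by (simp add: D2_at_def)
qed

lemma D2_at_D1:
  assumes f: "f \<in> eqv_chains N n j l"
  shows "D2_at n i (D1 N f) = D1 N (D2_at n i f)"
proof (intro ext)
  fix xs w
  consider "\<not> (set xs \<subseteq> Sym N \<and> xs \<noteq> [])" | "w \<notin> words {..<n} (length w)"
    | "set xs \<subseteq> Sym N" "xs \<noteq> []" "w \<in> words {..<n} (length w)" by blast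
  then show "D2_at n i (D1 N f) xs w = D1 N (D2_at n i f) xs w"
  proof cases
    case 1
    then have "D1 N f xs = (\<lambda>_. 0)" by (intro ext) (auto simp: D1_def)
    then have "D2_at n i (D1 N f) xs w = 0" by (simp add: D2_at_def)
    moreover have "D1 N (D2_at n i f) xs w = 0" unfolding D1_def using 1 by (simp only: if_False)
    ultimately show ?thesis by simp
  next
    case 3
    let ?H = "{c. is_chain V {..<n} (Suc (length w)) c}"
    have "D1 N f xs = tuple_bd (Sym N) xs f" using 3 by (intro ext) (simp add: D1_def tuple_bd_fun_apply)
    then have "D2_at n i (D1 N f) xs w = ins_sum act i {..<n} (tuple_bd (Sym N) xs f) w" using 3 by (simp add: D2_at_def)
    also have "\<dots> = tuple_bd (Sym N) xs (\<lambda>ys. ins_sum act i {..<n} (f ys) w)"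
    proof (rule conjunct2[OF tuple_bd_hom[where H = ?H and h = "\<lambda>c. ins_sum act i {..<n} c w"]])
      show "0 \<in> ?H" by (simp add: is_chain_def)
      show "x - y \<in> ?H" if "x \<in> ?H" "y \<in> ?H" for x y using that by (simp add: is_chain_def)
      show "ins_sum act i {..<n} 0 w = 0" using ins_sum_0[of "{..<n}" i w] by (simp add: zero_fun_def)
      show "ins_sum act i {..<n} (x - y) w = ins_sum act i {..<n} x w - ins_sum act i {..<n} y w"
        if "x \<in> ?H" "y \<in> ?H" for x y
        using ins_sum_diff[of "{..<n}" "length w" x y w i] that 3 by (simp add: fun_diff_def)
      show "f ys \<in> ?H" for ys using eqv_chains_chain[OF f] by simp
    qed
    also have "\<dots> = D1 N (D2_at n i f) xs w" using 3 by (simp add: D1_def D2_at_def)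
    finally show ?thesis .
  qed (simp add: D2_at_def D1_def)
qed

lemma D2_at_diff:
  assumes "f \<in> eqv_chains N n j l" "f' \<in> eqv_chains N n j l"
  shows "D2_at n i (f - f') = D2_at n i f - D2_at n i f'"
proof (intro ext)
  fix xs w
  show "D2_at n i (f - f') xs w = (D2_at n i f - D2_at n i f') xs w"
    using ins_sum_diff[of "{..<n}" "length w" "f xs" "f' xs" w i] eqv_chains_chain[OF assms(1)] eqv_chains_chain[OF assms(2)]
    by (simp add: D2_at_def fun_diff_def)
qed

lemma D2_eq_D2_at: "D2 n f xs w = (\<Sum>i\<le>length w. sgn_pow i (D2_at n i f xs w))"
  unfolding D2_def D2_at_def word_bd_eq_sum by (auto cong: if_cong intro!: sum.neutral[symmetric])

lemma D2_eq_sum: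
  assumes "f \<in> eqv_chains N n j (Suc l)"
  shows "D2 n f = (\<Sum>i\<le>l. sgn_pow i (D2_at n i f))"
proof (intro ext)
  fix xs w
  have "D2 n f xs w = (\<Sum>i\<le>l. sgn_pow i (D2_at n i f xs w))"
  proof (cases "w \<in> words {..<n} l")
    case True
    then show ?thesis unfolding D2_eq_D2_at by (simp add: words_def)
  next
    case False
    then have "D2_at n i f xs w = 0" for i using D2_at_zero[OF assms] by blast
    then show ?thesis unfolding D2_eq_D2_at by (simp cong: if_cong)
  qed
  also have "\<dots> = (\<Sum>i\<le>l. sgn_pow i (D2_at n i f)) xs w"
    unfolding sum_fun_apply by (intro sum.cong refl) auto
  finally show "D2 n f xs w = (\<Sum>i\<le>l. sgn_pow i (D2_at n i f)) xs w" .
qed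

lemma D2_eqv_chains0:
  assumes "f \<in> eqv_chains N n j 0"
  shows "D2 n f = 0"
proof (intro ext)
  fix xs w
  have "word_bd act w {..<n} (f xs) = 0" by (rule word_bd_zero, simp, rule eqv_chains_zero[OF assms]) (simp add: words_def)
  then show "D2 n f xs w = 0 xs w" by (simp add: D2_def)
qed

lemma D2_diff:
  assumes "f \<in> eqv_chains N n j l" "f' \<in> eqv_chains N n j l"
  shows "D2 n (f - f') = D2 n f - D2 n f'"
proof (intro ext)
  fix xs w
  show "D2 n (f - f') xs w = (D2 n f - D2 n f') xs w"
    unfolding fun_diff_def D2_eq_D2_at sum_subtractf[symmetric]
    by (intro sum.cong refl) (simp add: D2_at_diff[OF assms, unfolded fun_diff_def])
qed

lemma D2_D1:
  assumes f: "f \<in> eqv_chains N n j l"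
  shows "D2 n (D1 N f) = D1 N (D2 n f)"
proof (intro ext)
  fix xs w
  have "D2 n (D1 N f) xs w = (\<Sum>i\<le>length w. sgn_pow i (D1 N (D2_at n i f) xs w))"
    unfolding D2_eq_D2_at D2_at_D1[OF f] ..
  also have "\<dots> = D1 N (D2 n f) xs w"
  proof (cases "set xs \<subseteq> Sym N \<and> xs \<noteq> []")
    case True
    have "tuple_bd (Sym N) xs (\<lambda>ys. sgn_pow i (D2_at n i f ys w)) = sgn_pow i (tuple_bd (Sym N) xs (\<lambda>ys. D2_at n i f ys w))" for i
      by (simp add: tuple_bd_uminus)
    then show ?thesis unfolding D1_def D2_eq_D2_at tuple_bd_sum using True by (simp cong: if_cong)
  next
    case False
    then have "D1 N F xs w = 0" for F unfolding D1_def by (simp only: if_False)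
    then show ?thesis by (simp cong: if_cong)
  qed
  finally show "D2 n (D1 N f) xs w = D1 N (D2 n f) xs w" .
qed

lemma eqv_chains_uminus: "f \<in> eqv_chains N n j l \<Longrightarrow> n \<le> N \<Longrightarrow> - f \<in> eqv_chains N n j l"
  using eqv_chains_diff[OF eqv_chains_0, of f N n j l] by simp

lemma eqv_chains_add: "f \<in> eqv_chains N n j l \<Longrightarrow> f' \<in> eqv_chains N n j l \<Longrightarrow> n \<le> N \<Longrightarrow> f + f' \<in> eqv_chains N n j l"
  using eqv_chains_diff[of f N n j l "- f'"] eqv_chains_uminus by simp

lemma eqv_chains_sum: "n \<le> N \<Longrightarrow> (\<And>i. i \<in> I \<Longrightarrow> F i \<in> eqv_chains N n j l) \<Longrightarrow> sum F I \<in> eqv_chains N n j l"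
  by (induction I rule: infinite_finite_induct) (auto intro: eqv_chains_0 eqv_chains_add)

lemma D2_eqv_chains:
  assumes "f \<in> eqv_chains N n j (Suc l)" "n \<le> N"
  shows "D2 n f \<in> eqv_chains N n j l"
  unfolding D2_eq_sum[OF assms(1)] using D2_at_eqv_chains[OF assms] eqv_chains_uminus assms(2) by (intro eqv_chains_sum) auto

lemma D2_D2:
  assumes f: "f \<in> eqv_chains N n j l"
  shows "D2 n (D2 n f) = 0"
proof (intro ext)
  fix xs w
  show "D2 n (D2 n f) xs w = 0 xs w"
  proof (cases "w \<in> words {..<n} (length w)")
    case True
    have "word_bd act w {..<n} (D2 n f xs) = word_bd act w {..<n} (\<lambda>u. word_bd act u {..<n} (f xs))"
      by (rule word_bd_cong[OF True]) (auto simp: D2_def words_def)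
    also have "\<dots> = 0" by (rule word_bd_word_bd[OF _ eqv_chains_chain[OF f] True]) simp
    finally show ?thesis by (simp add: D2_def[of n "D2 n f"])
  qed (simp add: D2_def)
qed

lemma double_complex_eqv_chains:
  assumes "n \<le> N"
  shows "double_complex (eqv_chains N n) (D1 N) (D2 n)"
proof
  show "D1 N x = 0" if "x \<in> eqv_chains N n 0 l" for x l by (rule D1_eqv_chains0[OF that])
  show "D2 n x = 0" if "x \<in> eqv_chains N n j 0" for x j by (rule D2_eqv_chains0[OF that])
  show "D1 N (D2 n x) = D2 n (D1 N x)" if "x \<in> eqv_chains N n j l" for x j l using D2_D1[OF that] by simp
qed (use assms in \<open>auto intro: eqv_chains_0 eqv_chains_diff D1_eqv_chains D2_eqv_chains simp: D1_diff D1_D1 D2_diff D2_D2\<close>)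

end

section \<open>Exactness of the rows\<close>

context fi_mod begin

text \<open>For a single tuple this is exactness of the word complex; freeness of the action makes
  the lifts equivariant. Translating \<open>xs\<close> by the inverse of \<open>\<gamma> xs\<close>
  gives a normalised tuple that is the same along the whole orbit. The lift is chosen there and
  carried back by \<open>\<gamma> xs\<close>.\<close>

lemma row_exact_eqv_chains:
  assumes pol: "poly_sq e m V (\<lambda>_. {0}) act" and n: "n \<le> N" and nl: "int n \<ge> int l + max m (int e)"
  shows "double_complex.row_exact (eqv_chains N n) (D2 n) l"
proof -
  interpret DC: double_complex "eqv_chains N n" "D1 N" "D2 n" by (rule double_complex_eqv_chains[OF n])
  have "fi_mod (\<lambda>_. {0}) act"
  proof
    show "act f a b x = act g a b x" if "fi_mor f a b" "\<And>i. i < a \<Longrightarrow> f i = g i" "x \<in> {0}" for f g a b x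
      using act_cong[OF that(1,2), of 0] that by simp
    show "act (g \<circ> f) a c x = act g b c (act f a b x)" if "fi_mor f a b" "fi_mor g b c" "x \<in> {0}" for f g a b c x
      using act_comp[OF that(1,2), of 0] that by simp
  qed (auto intro: act_id[OF V_0])
  then have sq: "fi_sq V (\<lambda>_. {0}) act" unfolding fi_sq_def using fi_mod_axioms V_0 by blast
  obtain \<rho> where rho: "\<And>x. x permutes {..<N} \<Longrightarrow> \<rho> x permutes {..<n}"
    "\<And>h x. h permutes {..<n} \<Longrightarrow> x permutes {..<N} \<Longrightarrow> \<rho> (h \<circ> x) = h \<circ> \<rho> x"
    using exists_retraction[OF n] by metis
  \<comment> \<open>The chosen lift depends on the cycle alone, so all members of an orbit, having
    the same normalised tuple, use the same lift.\<close>
  define L where "L c = (SOME b. is_chain V {..<n} (Suc l) b \<and> (\<forall>w\<in>words {..<n} l. word_bd act w {..<n} b = c w))" for c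
  have L: "is_chain V {..<n} (Suc l) (L c)" "\<And>w. w \<in> words {..<n} l \<Longrightarrow> word_bd act w {..<n} (L c) = c w"
    if c: "is_chain V {..<n} l c" "is_cyc (\<lambda>_. {0}) act {..<n} l c" for c
  proof -
    have "\<exists>b. is_chain V {..<n} (Suc l) b \<and> is_chain (\<lambda>_. {0}) {..<n} l (\<lambda>w. c w - word_bd act w {..<n} b)"
      by (rule word_complex_exact[OF sq pol _ _ c]) (use nl in auto)
    then have "\<exists>b. is_chain V {..<n} (Suc l) b \<and> (\<forall>w\<in>words {..<n} l. word_bd act w {..<n} b = c w)"
      by (auto simp: is_chain_def)
    from someI_ex[OF this] show "is_chain V {..<n} (Suc l) (L c)"
      "\<And>w. w \<in> words {..<n} l \<Longrightarrow> word_bd act w {..<n} (L c) = c w" unfolding L_def by blast+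
  qed
  show ?thesis
    unfolding DC.row_exact_def
  proof (intro allI ballI impI)
    fix j z assume z: "z \<in> eqv_chains N n j l" and D2z: "D2 n z = 0"
    have cyc: "is_chain V {..<n} l (z xs)" "is_cyc (\<lambda>_. {0}) act {..<n} l (z xs)" for xs
    proof -
      show "is_chain V {..<n} l (z xs)" by (rule eqv_chains_chain[OF z])
      show "is_cyc (\<lambda>_. {0}) act {..<n} l (z xs)"
        unfolding is_cyc_def
      proof (intro allI impI)
        fix k w assume "w \<in> words {..<n} k"
        then have "w \<in> words {..<n} (length w)" by (simp add: words_def)
        then show "word_bd act w {..<n} (z xs) \<in> {0}" using fun_cong[OF fun_cong[OF D2z], of xs w] by (simp add: D2_def)
      qed
    qed
    define \<gamma> where "\<gamma> xs = \<rho> (hd xs)" for xs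
    define y where "y xs w = (if set xs \<subseteq> Sym N \<and> length xs = Suc j \<and> w \<in> words {..<n} (Suc l)
      then move n (\<gamma> xs) (map (inv (\<gamma> xs)) w) (L (z (translate (inv (\<gamma> xs)) xs)) (map (inv (\<gamma> xs)) w)) else 0)" for xs w
    have g: "\<gamma> xs permutes {..<n}" if "set xs \<subseteq> Sym N" "length xs = Suc j" for xs
      unfolding \<gamma>_def using that by (cases xs) (auto intro: rho)
    have y: "y \<in> eqv_chains N n j (Suc l)"
    proof (rule eqv_chainsI)
      fix xs w assume *: "set xs \<subseteq> Sym N" "length xs = Suc j" "w \<in> words {..<n} (Suc l)"
      let ?g = "\<gamma> xs"
      have u: "map (inv ?g) w \<in> words {..<n} (Suc l)" using words_map[OF permutes_inv[OF g[OF *(1,2)]]] * by blast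
      have Lu: "L (z (translate (inv ?g) xs)) (map (inv ?g) w) \<in> V (n - Suc l)"
        using L(1)[OF cyc] u by (auto simp: is_chain_def)
      show "y xs w \<in> V (n - Suc l)" using move_V[OF g[OF *(1,2)] u Lu] * by (simp add: y_def)
      fix h assume h: "h permutes {..<n}"
      have gh: "\<gamma> (translate h xs) = h \<circ> ?g" using * rho(2)[OF h] by (cases xs) (auto simp: \<gamma>_def)
      have ig: "inv (h \<circ> ?g) = inv ?g \<circ> inv h" using h g[OF *(1,2)] by (simp add: permutes_bij o_inv_distrib)
      have e1: "translate (inv (h \<circ> ?g)) (translate h xs) = translate (inv ?g) xs"
        unfolding ig translate_translate[symmetric] translate_inv(1)[OF h] ..
      have e2: "map (inv (h \<circ> ?g)) (map h w) = map (inv ?g) w"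
        unfolding ig map_map[symmetric] map_perm_inv(1)[OF h] ..
      have "set (translate h xs) \<subseteq> Sym N" "map h w \<in> words {..<n} (Suc l)"
        using set_translate_Sym[OF n h] words_map[OF h] * by blast+
      then have "y (translate h xs) (map h w) = move n (h \<circ> ?g) (map (inv ?g) w) (L (z (translate (inv ?g) xs)) (map (inv ?g) w))"
        using * by (simp add: y_def gh e1 e2 del: map_map set_map)
      also have "\<dots> = move n h w (y xs w)"
        using move_comp[OF h g[OF *(1,2)] u Lu] * g[OF *(1,2)] by (simp add: y_def del: map_map)
      finally show "y (translate h xs) (map h w) = move n h w (y xs w)" .
    qed (auto simp: y_def)
    have "D2 n y = z"
    proof (intro ext)
      fix xs w
      show "D2 n y xs w = z xs w"
      proof (cases "set xs \<subseteq> Sym N \<and> length xs = Suc j \<and> w \<in> words {..<n} l")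
        case False
        then show ?thesis using eqv_chains_zero[OF D2_eqv_chains[OF y n] False] eqv_chains_zero[OF z False] by simp
      next
        case True
        let ?g = "\<gamma> xs"
        have gp: "?g permutes {..<n}" using g True by blast
        let ?u = "map (inv ?g) w" and ?c = "z (translate (inv ?g) xs)"
        have u: "?u \<in> words {..<n} l" using words_map[OF permutes_inv[OF gp]] True by blast
        have "D2 n y xs w = word_bd act (map ?g ?u) {..<n} (y xs)"
          unfolding map_perm_inv(2)[OF gp] using True by (auto simp: D2_def words_def)
        also have "\<dots> = move n ?g ?u (word_bd act ?u {..<n} (L ?c))"
        proof (rule word_bd_equivariant[OF gp u L(1)[OF cyc]])
          fix v assume v: "v \<in> words {..<n} (Suc l)"
          then have "map ?g v \<in> words {..<n} (Suc l)" using words_map[OF gp] by blast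
          then show "y xs (map ?g v) = move n ?g v (L ?c v)" using True gp by (simp add: y_def del: map_map)
        qed
        also have "\<dots> = move n ?g ?u (?c ?u)" using L(2)[OF cyc u] by simp
        also have "\<dots> = z (translate ?g (translate (inv ?g) xs)) (map ?g ?u)"
          by (rule eqv_chains_equiv[OF z n gp, symmetric])
        finally show ?thesis using gp by (simp del: map_map)
      qed
    qed
    then show "\<exists>y\<in>eqv_chains N n j (Suc l). D2 n y = z" using y by blast
  qed
qed

section \<open>Homotopies between the faces of the word complex\<close>

definition swap_letters :: "nat \<Rightarrow> nat list \<Rightarrow> nat list" where
  "swap_letters i w = map (transpose (w ! i) (w ! Suc i)) w"

lemma swap_letters_ins:
  assumes "w \<in> words {..<n} l" "y \<in> {..<n} - set w" "i < l"
  shows "swap_letters i (take i w @ y # drop i w) = take (Suc i) w @ y # drop (Suc i) w"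
proof -
  have w: "w = take i w @ w ! i # drop (Suc i) w" using assms by (simp add: words_def id_take_nth_drop)
  have d: "distinct w" "i < length w" using assms by (auto simp: words_def)
  let ?t = "transpose y (w ! i)"
  have nth: "(take i w @ y # drop i w) ! i = y" "(take i w @ y # drop i w) ! Suc i = w ! i"
    using d by (auto simp: nth_append)
  have d2: "distinct (take i w @ w ! i # drop (Suc i) w)" using d w by simp
  have ni: "w ! i \<notin> set (take i w)" "w ! i \<notin> set (drop (Suc i) w)" "y \<notin> set (take i w)" "y \<notin> set (drop (Suc i) w)"
    using d2 assms(2) by (auto dest: in_set_takeD in_set_dropD)
  have m: "map ?t (take i w) = take i w" "map ?t (drop (Suc i) w) = drop (Suc i) w"
    using ni by (auto intro!: map_idI transpose_apply_other)
  have "swap_letters i (take i w @ y # drop i w) = map ?t (take i w @ y # w ! i # drop (Suc i) w)"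
    unfolding swap_letters_def nth using d by (simp add: Cons_nth_drop_Suc)
  also have "\<dots> = take i w @ w ! i # y # drop (Suc i) w" by (simp add: m)
  also have "\<dots> = take (Suc i) w @ y # drop (Suc i) w" using d by (simp add: take_Suc_conv_app_nth)
  finally show ?thesis .
qed

text \<open>A family \<beta> of self-maps of S_N, one for each word and compatible with the action
  of S_n, changes cycles by boundaries only: compatibility makes the prism equivariant through
  \<open>prism_map\<close>. It is used for translations by transpositions and for the retraction
  onto S_n.\<close>

lemma prism_eqv_chains:
  fixes \<beta> :: "nat list \<Rightarrow> (nat \<Rightarrow> nat) \<Rightarrow> nat \<Rightarrow> nat"
  assumes f: "f \<in> eqv_chains N n j l" and D1f: "D1 N f = 0" and n: "n \<le> N"
    and \<beta>: "\<And>w y. w \<in> words {..<n} l \<Longrightarrow> y permutes {..<N} \<Longrightarrow> \<beta> w y permutes {..<N}"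
    and eqv: "\<And>w y g. w \<in> words {..<n} l \<Longrightarrow> y permutes {..<N} \<Longrightarrow> g permutes {..<n} \<Longrightarrow>
      \<beta> (map g w) (g \<circ> y) = g \<circ> \<beta> w y"
  shows "\<exists>p\<in>eqv_chains N n (Suc j) l. \<forall>xs w. set xs \<subseteq> Sym N \<longrightarrow> w \<in> words {..<n} l \<longrightarrow>
      pushforward (Sym N) (\<beta> w) xs (\<lambda>ys. f ys w) - f xs w = D1 N p xs w"
proof -
  define p where "p xs w = (if set xs \<subseteq> Sym N \<and> w \<in> words {..<n} l
     then prism (Sym N) (\<beta> w) xs (\<lambda>ys. f ys w) else 0)" for xs w
  have p: "p \<in> eqv_chains N n (Suc j) l"
  proof (rule eqv_chainsI)
    fix xs w assume *: "\<not> (set xs \<subseteq> Sym N \<and> length xs = Suc (Suc j) \<and> w \<in> words {..<n} l)"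
    show "p xs w = 0"
    proof (cases "length xs = Suc (Suc j)")
      case False
      have "prism (Sym N) (\<beta> w) xs (\<lambda>ys. f ys w) = prism (Sym N) (\<beta> w) xs (\<lambda>_. 0)"
        by (rule prism_cong, rule eqv_chains_zero[OF f]) (use False in auto)
      then show ?thesis by (simp add: p_def)
    qed (use * in \<open>auto simp: p_def\<close>)
  next
    fix xs w
    show "p xs w \<in> V (n - l)"
      using prism_hom[of "V (n - l)" id xs "Sym N" "\<lambda>ys. f ys w"] eqv_chains_V[OF f] by (auto simp: p_def)
  next
    fix xs w g assume *: "set xs \<subseteq> Sym N" "w \<in> words {..<n} l" and g: "g permutes {..<n}"
    have gw: "map g w \<in> words {..<n} l" using * words_map[OF g] by blast
    have "prism (Sym N) (\<beta> (map g w)) (translate g xs) (\<lambda>ys. f ys (map g w)) =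
       prism (Sym N) (\<beta> w) xs (\<lambda>ys. f (translate g ys) (map g w))"
    proof (rule prism_map)
      show "inj_on ((\<circ>) g) (Sym N)" "(\<circ>) g ` Sym N = Sym N"
        using Sym_translate_bij[OF n g] by (auto simp: bij_betw_def)
    qed (use * gw \<beta> eqv g in auto)
    also have "\<dots> = prism (Sym N) (\<beta> w) xs (\<lambda>ys. move n g w (f ys w))" unfolding eqv_chains_equiv[OF f n g] ..
    also have "\<dots> = move n g w (prism (Sym N) (\<beta> w) xs (\<lambda>ys. f ys w))"
      using prism_hom[of "V (n - l)" "move n g w" xs "Sym N" "\<lambda>ys. f ys w"] move_diff[OF g *(2)] eqv_chains_V[OF f] g by auto
    finally show "p (translate g xs) (map g w) = move n g w (p xs w)"
      unfolding p_def using * gw set_translate_Sym[OF n g, of xs] by simp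
  qed
  have "pushforward (Sym N) (\<beta> w) xs (\<lambda>ys. f ys w) - f xs w = D1 N p xs w"
    if xs: "set xs \<subseteq> Sym N" and w: "w \<in> words {..<n} l" for xs w
  proof (cases "xs = []")
    case False
    let ?E = "Sym N" and ?\<beta> = "\<beta> w"
    have "D1 N p xs w = tuple_bd ?E xs (\<lambda>ys. prism ?E ?\<beta> ys (\<lambda>zs. f zs w))"
      unfolding D1_def using xs False w by (simp, intro tuple_bd_cong) (auto simp: p_def)
    also have "\<dots> = pushforward ?E ?\<beta> xs (\<lambda>zs. f zs w) - f xs w - prism ?E ?\<beta> xs (\<lambda>ys. tuple_bd ?E ys (\<lambda>zs. f zs w))"
      using prism_homotopy[where E = ?E and \<beta> = ?\<beta> and xs = xs and g = "\<lambda>zs. f zs w"] xs \<beta>[OF w]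
      by (simp add: algebra_simps)
    also have "prism ?E ?\<beta> xs (\<lambda>ys. tuple_bd ?E ys (\<lambda>zs. f zs w)) = 0"
    proof (cases "length xs = 1")
      \<comment> \<open>One-entry tuples are separate: the boundary at the empty tuple is the
        augmentation, about which \<open>D1 N f = 0\<close> says nothing, but here the prism itself
        is zero.\<close>
      case True
      then show ?thesis by (auto simp: length_Suc_conv)
    next
      case len: False
      have "prism ?E ?\<beta> xs (\<lambda>ys. tuple_bd ?E ys (\<lambda>zs. f zs w)) = prism ?E ?\<beta> xs (\<lambda>_. 0)"
      proof (rule prism_cong)
        fix ys assume "Suc (length ys) = length xs" "set ys \<subseteq> ?E \<union> set xs"
        then have "set ys \<subseteq> ?E" "ys \<noteq> []" using xs len by auto
        then show "tuple_bd ?E ys (\<lambda>zs. f zs w) = 0" using fun_cong[OF fun_cong[OF D1f], of ys w] by (simp add: D1_def)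
      qed
      then show ?thesis by simp
    qed
    finally show ?thesis by simp
  qed (simp add: D1_def)
  then show ?thesis using p by blast
qed

text \<open>
  Exchanging two letters of a word w amounts to translating the tuples by a transposition that
  commutes with the stabiliser of w, and such a translation is homotopic to the identity.
\<close>

lemma swap_letters_homotopy:
  assumes f: "f \<in> eqv_chains N n j l" and D1f: "D1 N f = 0" and n: "n \<le> N" and i: "Suc i < l"
  shows "\<exists>p\<in>eqv_chains N n (Suc j) l. \<forall>xs w. w \<in> words {..<n} l \<longrightarrow> f xs (swap_letters i w) - f xs w = D1 N p xs w"
proof -
  define t where "t w = transpose (w ! i) (w ! Suc i)" for w :: "nat list"
  have tp: "t w permutes {..<n}" "inv (t w) = t w" "set (map (t w) w) = set w" "\<And>z. z \<notin> set w \<Longrightarrow> t w z = z"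
    if w: "w \<in> words {..<n} l" for w
  proof -
    have m: "w ! i \<in> set w" "w ! Suc i \<in> set w" "set w \<subseteq> {..<n}" "length w = l" using w i by (auto simp: words_def)
    show "t w permutes {..<n}" unfolding t_def using m by (intro permutes_swap_id) auto
    show "inv (t w) = t w" by (simp add: t_def)
    show "set (map (t w) w) = set w" using m by (simp add: t_def)
    show "t w z = z" if "z \<notin> set w" for z using that m unfolding t_def by (intro transpose_apply_other) auto
  qed
  \<comment> \<open>The transposition attached to \<open>map g w\<close> is the conjugate by
    \<open>g\<close> of the one attached to \<open>w\<close>.\<close>
  have teq: "t (map g w) \<circ> (g \<circ> y) = g \<circ> (t w \<circ> y)"
    if w: "w \<in> words {..<n} l" and g: "g permutes {..<n}" for w g and y :: "nat \<Rightarrow> nat"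
  proof -
    have "t (map g w) (g z) = g (t w z)" for z
      using w i permutes_inj[OF g] by (auto simp: t_def words_def transpose_def inj_eq)
    then show ?thesis by auto
  qed
  obtain p where p: "p \<in> eqv_chains N n (Suc j) l"
    "\<And>xs w. set xs \<subseteq> Sym N \<Longrightarrow> w \<in> words {..<n} l \<Longrightarrow>
       pushforward (Sym N) ((\<circ>) (t w)) xs (\<lambda>ys. f ys w) - f xs w = D1 N p xs w"
    using prism_eqv_chains[where \<beta> = "\<lambda>w. (\<circ>) (t w)", OF f D1f n Sym_comp[OF Sym_mono[OF n tp(1)]] teq] by auto
  have "f xs (swap_letters i w) - f xs w = D1 N p xs w" if w: "w \<in> words {..<n} l" for xs w
  proof (cases "set xs \<subseteq> Sym N")
    case False
    then have "f xs u = 0" for u using eqv_chains_zero[OF f, of xs u] by auto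
    then show ?thesis unfolding D1_def using False by simp
  next
    case True
    note tw = tp[OF w]
    have "pushforward (Sym N) ((\<circ>) (t w)) (map ((\<circ>) (t w)) (translate (inv (t w)) xs)) (\<lambda>zs. f zs w) = f (translate (inv (t w)) xs) w"
      by (rule pushforward_inj) (use Sym_translate_bij[OF n tw(1)] set_translate_Sym[OF n permutes_inv[OF tw(1)]] True
        in \<open>auto simp: bij_betw_def simp del: set_map\<close>)
    then have "pushforward (Sym N) ((\<circ>) (t w)) xs (\<lambda>zs. f zs w) = f (translate (inv (t w)) xs) w"
      unfolding translate_inv(2)[OF tw(1)] .
    also have "f (translate (inv (t w)) xs) w = f xs (swap_letters i w)"
    proof -
      have "f (translate (inv (t w)) xs) (map (inv (t w)) (map (t w) w)) = move n (inv (t w)) (map (t w) w) (f xs (map (t w) w))"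
        by (rule eqv_chains_equiv[OF f n permutes_inv[OF tw(1)]])
      \<comment> \<open>The transposition fixes every point outside \<open>w\<close>, so it acts
        trivially on the coefficients in M(complement of w).\<close>
      also have "\<dots> = f xs (map (t w) w)"
      proof (rule move_ident)
        show "map (t w) w \<in> words {..<n} l" using words_map[OF tw(1)] w by blast
        show "set (map (inv (t w)) (map (t w) w)) = set (map (t w) w)" unfolding map_perm_inv(1)[OF tw(1)] tw(3) ..
        show "inv (t w) x = x" if "x \<in> {..<n} - set (map (t w) w)" for x using that unfolding tw(3) tw(2) by (intro tw(4)) simp
      qed (rule eqv_chains_V[OF f])
      finally show ?thesis unfolding map_perm_inv(1)[OF tw(1)] by (simp add: swap_letters_def t_def)
    qed
    finally show ?thesis using p(2)[OF True w] by simp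
  qed
  then show ?thesis using p(1) by blast
qed

text \<open>Adjacent faces are homotopic: by \<open>swap_letters_ins\<close>, exchanging the letters
  \<open>i\<close> and \<open>i + 1\<close> turns insertion at \<open>i\<close> into insertion at
  \<open>i + 1\<close>, and this exchange changes \<open>f\<close> by a boundary
  \<open>D1 N p\<close>. Face \<open>i\<close> commutes with \<open>D1\<close>, so the difference of
  the faces is a boundary too.\<close>

lemma insertion_homotopy:
  assumes f: "f \<in> eqv_chains N n j (Suc l)" and D1f: "D1 N f = 0" and n: "n \<le> N" and i: "i \<le> l"
  shows "\<exists>b\<in>eqv_chains N n (Suc j) l. D2_at n i f - D2_at n 0 f = D1 N b"
  using i
proof (induction i)
  case 0
  show ?case using eqv_chains_0 by (intro bexI[of _ 0]) (auto simp: D1_0)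
next
  case (Suc i)
  then obtain b where b: "b \<in> eqv_chains N n (Suc j) l" "D2_at n i f - D2_at n 0 f = D1 N b" using Suc_leD by blast
  obtain p where p: "p \<in> eqv_chains N n (Suc j) (Suc l)"
    "\<And>xs w. w \<in> words {..<n} (Suc l) \<Longrightarrow> f xs (swap_letters i w) - f xs w = D1 N p xs w"
    using swap_letters_homotopy[OF f D1f n, of i] Suc.prems by auto
  have "D2_at n (Suc i) f - D2_at n i f = D2_at n i (D1 N p)"
  proof (intro ext)
    fix xs w
    show "(D2_at n (Suc i) f - D2_at n i f) xs w = D2_at n i (D1 N p) xs w"
    proof (cases "w \<in> words {..<n} l")
      case False
      then show ?thesis using D2_at_zero[OF f, of xs w] D2_at_zero[OF D1_eqv_chains[OF p(1) n], of xs w] by simp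
    next
      case True
      have w': "w \<in> words {..<n} (length w)" using True by (simp add: words_def)
      have "ins_sum act i {..<n} (D1 N p xs) w = ins_sum act i {..<n} (\<lambda>u. f xs (swap_letters i u) - f xs u) w"
        by (rule ins_sum_cong) (use p(2) words_ins[OF True] in auto)
      also have "\<dots> = ins_sum act i {..<n} (\<lambda>u. f xs (swap_letters i u)) w - ins_sum act i {..<n} (f xs) w"
        by (rule ins_sum_diff[OF _ _ eqv_chains_chain[OF f] True]) (auto simp: is_chain_def intro: eqv_chains_V[OF f])
      also have "ins_sum act i {..<n} (\<lambda>u. f xs (swap_letters i u)) w = ins_sum act (Suc i) {..<n} (f xs) w"
        unfolding ins_sum_def
        by (intro sum.cong refl, subst swap_letters_ins[OF True]) (use Suc.prems in auto)
      finally show ?thesis using w' by (simp add: D2_at_def)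
    qed
  qed
  also have "\<dots> = D1 N (D2_at n i p)" by (rule D2_at_D1[OF p(1)])
  finally have "D2_at n (Suc i) f - D2_at n 0 f = D1 N (D2_at n i p) + D1 N b"
    using b(2) by (simp add: algebra_simps)
  also have "\<dots> = D1 N (D2_at n i p - (- b))"
    using D1_diff[of N "D2_at n i p" "- b"] D1_diff[of N 0 b] D1_diff[of N 0 0] by simp
  finally show ?case using eqv_chains_add[OF D2_at_eqv_chains[OF p(1) n] b(1) n] by auto
qed

lemma D2_homotopy:
  assumes f: "f \<in> eqv_chains N n j (Suc l)" and D1f: "D1 N f = 0" and n: "n \<le> N"
  shows "\<exists>b\<in>eqv_chains N n (Suc j) l. D2 n f - (if even l then D2_at n 0 f else 0) = D1 N b"
proof -
  have "\<exists>b\<in>eqv_chains N n (Suc j) l. (\<Sum>i\<le>k. sgn_pow i (D2_at n i f)) - (if even k then D2_at n 0 f else 0) = D1 N b"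
    if "k \<le> l" for k
    using that
  proof (induction k)
    case 0
    show ?case using eqv_chains_0 by (intro bexI[of _ 0]) (auto simp: D1_0)
  next
    case (Suc k)
    then obtain b where b: "b \<in> eqv_chains N n (Suc j) l"
      "(\<Sum>i\<le>k. sgn_pow i (D2_at n i f)) - (if even k then D2_at n 0 f else 0) = D1 N b" using Suc_leD by blast
    obtain b' where b': "b' \<in> eqv_chains N n (Suc j) l" "D2_at n (Suc k) f - D2_at n 0 f = D1 N b'"
      using insertion_homotopy[OF f D1f n Suc.prems] by blast
    have um: "D1 N (b + b') = D1 N b + D1 N b'"
      using D1_diff[of N b "- b'"] D1_diff[of N 0 b'] D1_diff[of N 0 0] by simp
    show ?case
    proof (cases "even k")
      case True
      then have "(\<Sum>i\<le>Suc k. sgn_pow i (D2_at n i f)) - (if even (Suc k) then D2_at n 0 f else 0) = D1 N (b - b')"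
        unfolding D1_diff using b(2) b'(2) by (simp add: algebra_simps)
      then show ?thesis using eqv_chains_diff[OF b(1) b'(1) n] by blast
    next
      case False
      then have "(\<Sum>i\<le>Suc k. sgn_pow i (D2_at n i f)) - (if even (Suc k) then D2_at n 0 f else 0) = D1 N (b + b')"
        unfolding um using b(2) b'(2) by (simp add: algebra_simps)
      then show ?thesis using eqv_chains_add[OF b(1) b'(1) n] by blast
    qed
  qed
  from this[OF order_refl] show ?thesis unfolding D2_eq_sum[OF f] .
qed

lemma zero_H_eqv_chains:
  assumes n: "n \<le> N"
  shows "double_complex.zero_H (eqv_chains N n) (D1 N) (D2 n) q 1"
proof -
  interpret DC: double_complex "eqv_chains N n" "D1 N" "D2 n" by (rule double_complex_eqv_chains[OF n])
  show ?thesis unfolding DC.zero_H_def using D2_homotopy[OF _ _ n, of _ q 1] by auto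
qed

end

section \<open>Shapiro's lemma and the induction on n\<close>

context fi_mod begin

definition restrict_tail :: "nat \<Rightarrow> nat \<Rightarrow> ((nat \<Rightarrow> nat) list \<Rightarrow> nat list \<Rightarrow> 'v) \<Rightarrow> (nat \<Rightarrow> nat) list \<Rightarrow> nat list \<Rightarrow> 'v" where
  "restrict_tail n k f = (\<lambda>xs u. if u \<in> words {..<n} (length u) then f xs (u @ [n..<n + k]) else 0)"

lemma words_tail: "u \<in> words {..<n} r \<Longrightarrow> u @ [n..<n + k] \<in> words {..<n + k} (k + r)"
  by (auto simp: words_def)

lemma words_length: "u \<in> words X r \<Longrightarrow> u \<in> words X (length u)"
  by (simp add: words_def)

lemma compl_tail: "{..<n + k} - set (u @ [n..<n + k]) = {..<n} - set u"
  by auto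

lemma perm_tail:
  assumes "g permutes {..<n}"
  shows "g permutes {..<n + k}" "map g [n..<n + k] = [n..<n + k]"
  using Sym_mono[OF _ assms, of "n + k"] permutes_not_in[OF assms] by (auto intro: map_idI)

lemma perm_fixing_tail:
  assumes "g permutes {..<n + k}" "map g [n..<n + k] = [n..<n + k]"
  shows "g permutes {..<n}"
proof -
  have "g x = x" if "x \<notin> {..<n}" for x
  proof (cases "x < n + k")
    case True
    then show ?thesis using assms(2) that map_eq_conv[of g "[n..<n + k]" id] by auto
  next
    case False
    then show ?thesis by (intro permutes_not_in[OF assms(1)]) simp
  qed
  then show ?thesis using assms(1) by (auto simp: permutes_def)
qed

lemma move_tail:
  assumes "g permutes {..<n}"
  shows "move (n + k) g (u @ [n..<n + k]) = move n g u"
  unfolding move_def map_append perm_tail(2)[OF assms] compl_tail ..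

lemma restrict_tail_eqv_chains:
  assumes f: "f \<in> eqv_chains N (n + k) j (k + r)" and N: "n + k \<le> N"
  shows "restrict_tail n k f \<in> eqv_chains N n j r"
proof (rule eqv_chainsI)
  fix xs u assume *: "\<not> (set xs \<subseteq> Sym N \<and> length xs = Suc j \<and> u \<in> words {..<n} r)"
  show "restrict_tail n k f xs u = 0"
  proof (cases "length u = r \<and> set xs \<subseteq> Sym N \<and> length xs = Suc j")
    case False
    then have "f xs (u @ [n..<n + k]) = 0" by (intro eqv_chains_zero[OF f]) (auto simp: words_def)
    then show ?thesis by (simp add: restrict_tail_def)
  qed (use * in \<open>auto simp: restrict_tail_def\<close>)
next
  fix xs u assume "u \<in> words {..<n} r"
  then show "restrict_tail n k f xs u \<in> V (n - r)"
    using eqv_chains_V[OF f, of xs "u @ [n..<n + k]"] by (simp add: restrict_tail_def)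
next
  fix xs u g assume u: "u \<in> words {..<n} r" and g: "g permutes {..<n}"
  have gu: "map g u \<in> words {..<n} r" using words_map[OF g] u by blast
  have "restrict_tail n k f (translate g xs) (map g u) = f (translate g xs) (map g (u @ [n..<n + k]))"
    using words_length[OF gu] by (simp add: restrict_tail_def perm_tail(2)[OF g])
  also have "\<dots> = move n g u (f xs (u @ [n..<n + k]))"
    unfolding eqv_chains_equiv[OF f N perm_tail(1)[OF g]] move_tail[OF g] ..
  finally show "restrict_tail n k f (translate g xs) (map g u) = move n g u (restrict_tail n k f xs u)"
    using words_length[OF u] by (simp add: restrict_tail_def)
qed

lemma restrict_tail_D1: "restrict_tail n k (D1 N f) = D1 N (restrict_tail n k f)"
  by (intro ext) (simp add: restrict_tail_def D1_def)

lemma restrict_tail_diff: "restrict_tail n k (f - f') = restrict_tail n k f - restrict_tail n k f'"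
  by (intro ext) (simp add: restrict_tail_def)

text \<open>Insertion in front leaves the tail untouched. This is why face 0 serves as the reference
  for the other faces and why the fixed letters stand at the end of the word.\<close>

lemma restrict_tail_D2_at:
  assumes "f \<in> eqv_chains N (n + k) j (k + Suc 0)"
  shows "restrict_tail n k (D2_at (n + k) 0 f) = D2_at n 0 (restrict_tail n k f)"
proof (intro ext)
  fix xs u
  show "restrict_tail n k (D2_at (n + k) 0 f) xs u = D2_at n 0 (restrict_tail n k f) xs u"
  proof (cases "u \<in> words {..<n} (length u)")
    case True
    have "ins_sum act 0 {..<n + k} (f xs) (u @ [n..<n + k]) = ins_sum act 0 {..<n} (restrict_tail n k f xs) u"
      unfolding ins_sum_def compl_tail
    proof (intro sum.cong refl)
      fix x assume "x \<in> {..<n} - set u"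
      then have "x # u \<in> words {..<n} (length (x # u))" using True by (auto simp: words_def)
      then show "setact act id ({..<n} - set u - {x}) ({..<n} - set u) (f xs (take 0 (u @ [n..<n + k]) @ x # drop 0 (u @ [n..<n + k]))) =
         setact act id ({..<n} - set u - {x}) ({..<n} - set u) (restrict_tail n k f xs (take 0 u @ x # drop 0 u))"
        by (simp add: restrict_tail_def)
    qed
    then show ?thesis using True words_length[OF words_tail[OF True]] by (simp add: restrict_tail_def D2_at_def)
  qed (simp add: restrict_tail_def D2_at_def)
qed

text \<open>Every word lies in the orbit of one ending in the standard tail, so an equivariant
  function is determined by its values on such words.\<close>

lemma restrict_tail_inj:
  assumes f: "f \<in> eqv_chains N (n + k) j (k + r)" and N: "n + k \<le> N" and z: "restrict_tail n k f = 0"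
  shows "f = 0"
proof (intro ext)
  fix xs w
  show "f xs w = 0 xs w"
  proof (cases "set xs \<subseteq> Sym N \<and> length xs = Suc j \<and> w \<in> words {..<n + k} (k + r)")
    case False
    then show ?thesis using eqv_chains_zero[OF f False] by simp
  next
    case True
    then have "drop r w \<in> words {..<n + k} k" by (auto simp: words_def dest: in_set_dropD)
    then obtain g where g: "g permutes {..<n + k}" "map g [n..<n + k] = drop r w" using exists_perm_word by blast
    define u where "u = map (inv g) (take r w)"
    have gu: "map g u = take r w" unfolding u_def by (rule map_perm_inv(2)[OF g(1)])
    then have w: "w = map g (u @ [n..<n + k])" using g(2) by simp
    have "u @ [n..<n + k] \<in> words {..<n + k} (k + r)" using True words_map[OF g(1)] w by blast
    then have "u \<in> words {..<n} (length u)"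
      unfolding words_def by (auto simp: subset_iff)
    then have "f (translate (inv g) xs) (u @ [n..<n + k]) = 0"
      using fun_cong[OF fun_cong[OF z], of "translate (inv g) xs" u] by (simp add: restrict_tail_def)
    moreover have "f (translate g (translate (inv g) xs)) (map g (u @ [n..<n + k])) =
        move (n + k) g (u @ [n..<n + k]) (f (translate (inv g) xs) (u @ [n..<n + k]))"
      by (rule eqv_chains_equiv[OF f N g(1)])
    ultimately show ?thesis unfolding translate_inv(2)[OF g(1)] w[symmetric] using g(1) by simp
  qed
qed

text \<open>Extend from words with the standard tail by translation. Two permutations producing the
  same tail differ by one that fixes the standard tail, hence by an element of S_n
  (\<open>perm_fixing_tail\<close>), for which \<open>F\<close> is already equivariant; so the
  choices do not matter.\<close>

lemma restrict_tail_surj: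
  assumes F: "F \<in> eqv_chains N n j r" and N: "n + k \<le> N"
  shows "\<exists>f\<in>eqv_chains N (n + k) j (k + r). restrict_tail n k f = F"
proof -
  have "\<forall>v\<in>words {..<n + k} k. \<exists>g. g permutes {..<n + k} \<and> map g [n..<n + k] = v"
    using exists_perm_word by blast
  from bchoice[OF this] obtain \<gamma> where gam: "\<And>v. v \<in> words {..<n + k} k \<Longrightarrow> \<gamma> v permutes {..<n + k}"
    "\<And>v. v \<in> words {..<n + k} k \<Longrightarrow> map (\<gamma> v) [n..<n + k] = v" by blast
  have nN: "n \<le> N" using N by simp
  define G where "G w = \<gamma> (drop r w)" for w
  define U where "U w = map (inv (G w)) (take r w)" for w
  define f where "f xs w = (if set xs \<subseteq> Sym N \<and> length xs = Suc j \<and> w \<in> words {..<n + k} (k + r)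
     then move (n + k) (G w) (U w @ [n..<n + k]) (F (translate (inv (G w)) xs) (U w)) else 0)" for xs w
  have G: "G w permutes {..<n + k}" "map (G w) (U w @ [n..<n + k]) = w" "U w \<in> words {..<n} r"
    "U w @ [n..<n + k] \<in> words {..<n + k} (k + r)"
    if w: "w \<in> words {..<n + k} (k + r)" for w
  proof -
    have d: "drop r w \<in> words {..<n + k} k" using w by (auto simp: words_def dest: in_set_dropD)
    show g: "G w permutes {..<n + k}" unfolding G_def by (rule gam(1)[OF d])
    have "map (G w) (U w) = take r w" unfolding U_def by (rule map_perm_inv(2)[OF g])
    then show e: "map (G w) (U w @ [n..<n + k]) = w" using gam(2)[OF d] by (simp add: G_def)
    show m: "U w @ [n..<n + k] \<in> words {..<n + k} (k + r)" using w words_map[OF g, of "U w @ [n..<n + k]"] e by simp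
    have "length (U w) = r" using w by (simp add: U_def words_def)
    then show "U w \<in> words {..<n} r" using m unfolding words_def
      by (auto simp: subset_iff)
  qed
  have FV: "F xs u \<in> V (n + k - (k + r))" for xs u using eqv_chains_V[OF F, of xs u] by simp
  have f: "f \<in> eqv_chains N (n + k) j (k + r)"
  proof (rule eqv_chainsI)
    fix xs w assume *: "set xs \<subseteq> Sym N" "length xs = Suc j" "w \<in> words {..<n + k} (k + r)"
    note Gw = G[OF *(3)]
    show "f xs w \<in> V (n + k - (k + r))"
      using move_V[OF Gw(1,4) FV] * by (simp add: f_def)
    fix h assume h: "h permutes {..<n + k}"
    have hw: "map h w \<in> words {..<n + k} (k + r)" using words_map[OF h] * by blast
    note Ghw = G[OF hw]
    \<comment> \<open>\<open>c\<close> measures how far the chosen permutations \<open>G\<close> are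
      from being equivariant; it fixes the tail and therefore lies in S_n.\<close>
    define c where "c = inv (G (map h w)) \<circ> (h \<circ> G w)"
    have Gc: "G (map h w) \<circ> c = h \<circ> G w" unfolding c_def using Ghw(1) by simp
    have cp: "c permutes {..<n + k}" unfolding c_def
      using Sym_comp[OF permutes_inv[OF Ghw(1)] Sym_comp[OF h Gw(1)]] .
    have c_map: "map c u = map (inv (G (map h w))) (map h (map (G w) u))" for u by (simp add: c_def)
    have "map c (U w @ [n..<n + k]) = map (inv (G (map h w))) (map h w)" unfolding c_map Gw(2) ..
    also have "\<dots> = U (map h w) @ [n..<n + k]" using map_perm_inv(1)[OF Ghw(1), of "U (map h w) @ [n..<n + k]"] unfolding Ghw(2) .
    finally have ce: "map c (U w) @ map c [n..<n + k] = U (map h w) @ [n..<n + k]" by simp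
    moreover have "length (map c (U w)) = length (U (map h w))" using Gw(3) Ghw(3) by (simp add: words_def)
    ultimately have cU: "map c (U w) = U (map h w)" and ct: "map c [n..<n + k] = [n..<n + k]" by auto
    have cn: "c permutes {..<n}" by (rule perm_fixing_tail[OF cp ct])
    have tr: "translate (inv (G (map h w))) (translate h xs) = translate c (translate (inv (G w)) xs)"
    proof -
      have "inv (G (map h w)) \<circ> h = c \<circ> inv (G w)" unfolding c_def using Gw(1)
        by (simp add: comp_assoc permutes_inv_o)
      then show ?thesis unfolding translate_translate by simp
    qed
    have Feq: "F (translate c ys) (U (map h w)) = move n c (U w) (F ys (U w))" for ys
      using eqv_chains_equiv[OF F nN cn, of ys "U w"] unfolding cU .
    have "f (translate h xs) (map h w) = move (n + k) (G (map h w)) (U (map h w) @ [n..<n + k])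
        (F (translate c (translate (inv (G w)) xs)) (U (map h w)))"
      unfolding f_def tr using * hw set_translate_Sym[OF N h, of xs] by simp
    also have "\<dots> = move (n + k) (G (map h w)) (map c (U w @ [n..<n + k]))
        (move (n + k) c (U w @ [n..<n + k]) (F (translate (inv (G w)) xs) (U w)))"
      unfolding Feq move_tail[OF cn] map_append cU ct ..
    also have "\<dots> = move (n + k) (h \<circ> G w) (U w @ [n..<n + k]) (F (translate (inv (G w)) xs) (U w))"
      unfolding move_comp[OF Ghw(1) cp Gw(4) FV] Gc ..
    also have "\<dots> = move (n + k) h w (move (n + k) (G w) (U w @ [n..<n + k]) (F (translate (inv (G w)) xs) (U w)))"
      using move_comp[OF h Gw(1,4) FV] unfolding Gw(2) by simp
    finally show "f (translate h xs) (map h w) = move (n + k) h w (f xs w)" using * by (simp add: f_def)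
  qed (auto simp: f_def)
  have "restrict_tail n k f = F"
  proof (intro ext)
    fix xs u
    show "restrict_tail n k f xs u = F xs u"
    proof (cases "set xs \<subseteq> Sym N \<and> length xs = Suc j \<and> u \<in> words {..<n} r")
      case False
      then show ?thesis using eqv_chains_zero[OF restrict_tail_eqv_chains[OF f N] False] eqv_chains_zero[OF F False] by simp
    next
      case True
      let ?w = "u @ [n..<n + k]"
      have w: "?w \<in> words {..<n + k} (k + r)" using words_tail True by blast
      note Gw = G[OF w]
      have lu: "length u = r" using True by (simp add: words_def)
      have "map (G ?w) (U ?w) @ map (G ?w) [n..<n + k] = u @ [n..<n + k]" using Gw(2) by simp
      moreover have "length (map (G ?w) (U ?w)) = length u" using Gw(3) lu by (simp add: words_def)
      ultimately have e: "map (G ?w) (U ?w) = u" "map (G ?w) [n..<n + k] = [n..<n + k]" by auto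
      have gn: "G ?w permutes {..<n}" by (rule perm_fixing_tail[OF Gw(1) e(2)])
      have "restrict_tail n k f xs u = move (n + k) (G ?w) (U ?w @ [n..<n + k]) (F (translate (inv (G ?w)) xs) (U ?w))"
        using True w words_length[of u "{..<n}" r] by (simp add: restrict_tail_def f_def)
      also have "\<dots> = F (translate (G ?w) (translate (inv (G ?w)) xs)) (map (G ?w) (U ?w))"
        unfolding move_tail[OF gn] eqv_chains_equiv[OF F nN gn] ..
      also have "\<dots> = F xs u" unfolding translate_inv(2)[OF gn] e(1) ..
      finally show ?thesis .
    qed
  qed
  then show ?thesis using f by blast
qed

text \<open>From column 1 to column 0 there is a single place of insertion, so face 0 on the larger
  set restricts to all of \<open>D2\<close> on the smaller one.\<close>

lemma D2_restrict:
  assumes f: "f \<in> eqv_chains N (n + k) j (Suc k)" and N: "n + k \<le> N"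
  shows "D2 n (restrict_tail n k f) = restrict_tail n k (D2_at (n + k) 0 f)"
proof -
  have f': "f \<in> eqv_chains N (n + k) j (k + Suc 0)" using f by simp
  show ?thesis unfolding restrict_tail_D2_at[OF f'] using D2_eq_sum[OF restrict_tail_eqv_chains[OF f' N]] by simp
qed

text \<open>Restriction to the tail is a bijection on chains and commutes with \<open>D1\<close>,
  but with \<open>D2\<close> only after \<open>D2_homotopy\<close> has replaced \<open>D2\<close> by
  face 0, which requires \<open>k\<close> even. The data found for \<open>n\<close> are lifted to
  \<open>n + k\<close>, and the homotopy is absorbed into the boundary term.\<close>

lemma stability_transfer:
  assumes N: "n + k \<le> N" and k: "even k"
  shows "double_complex.surj_H (eqv_chains N n) (D1 N) (D2 n) j 0 \<Longrightarrow>
      double_complex.surj_H (eqv_chains N (n + k)) (D1 N) (D2 (n + k)) j k"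
    and "double_complex.inj_H (eqv_chains N n) (D1 N) (D2 n) j 0 \<Longrightarrow>
      double_complex.inj_H (eqv_chains N (n + k)) (D1 N) (D2 (n + k)) j k"
proof -
  have nN: "n \<le> N" using N by simp
  interpret A: double_complex "eqv_chains N n" "D1 N" "D2 n" by (rule double_complex_eqv_chains[OF nN])
  interpret B: double_complex "eqv_chains N (n + k)" "D1 N" "D2 (n + k)" by (rule double_complex_eqv_chains[OF N])
  let ?R = "restrict_tail n k"
  have R: "?R f \<in> eqv_chains N n i r" if "f \<in> eqv_chains N (n + k) i (k + r)" for f i r by (rule restrict_tail_eqv_chains[OF that N])
  have Rk: "?R f \<in> eqv_chains N n i 0" if "f \<in> eqv_chains N (n + k) i k" for f i using R[of f i 0] that by simp
  have RSk: "?R f \<in> eqv_chains N n i (Suc 0)" if "f \<in> eqv_chains N (n + k) i (Suc k)" for f i using R[of f i "Suc 0"] that by simp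
  have inj: "f = 0" if "f \<in> eqv_chains N (n + k) i k" "?R f = 0" for f i using restrict_tail_inj[of f N n k i 0] that N by simp
  have injS: "f = 0" if "f \<in> eqv_chains N (n + k) i (Suc k)" "?R f = 0" for f i using restrict_tail_inj[of f N n k i "Suc 0"] that N by simp
  have sur: "\<exists>f\<in>eqv_chains N (n + k) i k. ?R f = F" if "F \<in> eqv_chains N n i 0" for F i using restrict_tail_surj[OF that N] by simp
  have surS: "\<exists>f\<in>eqv_chains N (n + k) i (Suc k). ?R f = F" if "F \<in> eqv_chains N n i (Suc 0)" for F i
    using restrict_tail_surj[OF that N] by simp
  have R0: "?R 0 = 0" by (intro ext) (simp add: restrict_tail_def)
  show "B.surj_H j k" if s: "A.surj_H j 0"
    unfolding B.surj_H_def
  proof (intro ballI impI)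
    fix y assume y: "y \<in> eqv_chains N (n + k) j k" "D1 N y = 0"
    have "D1 N (?R y) = 0" using restrict_tail_D1[of n k N y] y(2) R0 by simp
    then obtain a' b' where ab': "a' \<in> eqv_chains N n j (Suc 0)" "D1 N a' = 0" "b' \<in> eqv_chains N n (Suc j) 0" "?R y = D2 n a' + D1 N b'"
      using s Rk[OF y(1)] unfolding A.surj_H_def by metis
    obtain a b where a: "a \<in> eqv_chains N (n + k) j (Suc k)" "?R a = a'" and b: "b \<in> eqv_chains N (n + k) (Suc j) k" "?R b = b'"
      using surS[OF ab'(1)] sur[OF ab'(3)] by metis
    have D1a: "D1 N a = 0"
    proof (cases j)
      case 0
      then show ?thesis using a B.D1_T0 by blast
    next
      case (Suc i)
      then show ?thesis using injS[of "D1 N a" i] B.D1_T[of a i "Suc k"] a ab'(2) restrict_tail_D1[of n k N a] by simp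
    qed
    obtain e where e: "e \<in> eqv_chains N (n + k) (Suc j) k" "D2 (n + k) a - D2_at (n + k) 0 a = D1 N e"
      using D2_homotopy[OF a(1) D1a N] k by auto
    \<comment> \<open>The error of the lifted decomposition with face 0 in place of
      \<open>D2\<close>. It vanishes after restriction to the tail, hence exactly.\<close>
    let ?z = "y - (D2_at (n + k) 0 a - D1 N (- b))"
    have m: "D2_at (n + k) 0 a \<in> eqv_chains N (n + k) j k" "D1 N (- b) \<in> eqv_chains N (n + k) j k"
      using D2_at_eqv_chains[OF a(1) N] B.D1_T[OF eqv_chains_uminus[OF b(1) N]] by auto
    have "?R ?z = ?R y - (D2 n a' - D1 N (?R (- b)))"
      unfolding restrict_tail_diff restrict_tail_D1 D2_restrict[OF a(1) N, symmetric] a(2) ..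
    also have "?R (- b) = - b'" using restrict_tail_diff[of n k 0 b] R0 b(2) by simp
    also have "D1 N (- b') = - D1 N b'" by (rule A.D1_uminus[OF ab'(3)])
    also have "?R y - (D2 n a' - - D1 N b') = 0" unfolding ab'(4) by (simp only: diff_minus_eq_add diff_self)
    finally have "?R ?z = 0" .
    then have "?z = 0" using inj[of ?z j] B.T_diff m y(1) by simp
    then have "y = D2_at (n + k) 0 a + D1 N b" using B.D1_uminus[OF b(1)] by (simp add: algebra_simps)
    also have "\<dots> = D2 (n + k) a + (D1 N b - D1 N e)" using e(2) by (simp add: algebra_simps)
    also have "D1 N b - D1 N e = D1 N (b - e)" by (simp add: D1_diff)
    finally show "\<exists>a\<in>eqv_chains N (n + k) j (Suc k). D1 N a = 0 \<and> (\<exists>b\<in>eqv_chains N (n + k) (Suc j) k. y = D2 (n + k) a + D1 N b)"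
      using a(1) D1a B.T_diff[OF b(1) e(1)] by blast
  qed
  show "B.inj_H j k" if i: "A.inj_H j 0"
    unfolding B.inj_H_def
  proof (intro ballI impI)
    fix s assume s: "s \<in> eqv_chains N (n + k) j (Suc k)" "D1 N s = 0" and "\<exists>b\<in>eqv_chains N (n + k) (Suc j) k. D2 (n + k) s = D1 N b"
    then obtain b where b: "b \<in> eqv_chains N (n + k) (Suc j) k" "D2 (n + k) s = D1 N b" by blast
    obtain e where e: "e \<in> eqv_chains N (n + k) (Suc j) k" "D2 (n + k) s - D2_at (n + k) 0 s = D1 N e"
      using D2_homotopy[OF s N] k by auto
    have "D2_at (n + k) 0 s = D1 N (b - e)" unfolding D1_diff using b e by (simp add: algebra_simps)
    then have "D2 n (?R s) = D1 N (?R (b - e))" using D2_restrict[OF s(1) N] restrict_tail_D1 by metis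
    moreover have "?R (b - e) \<in> eqv_chains N n (Suc j) 0" using Rk B.T_diff[OF b(1) e(1)] by blast
    moreover have "D1 N (?R s) = 0" using restrict_tail_D1[of n k N s] s(2) R0 by simp
    ultimately obtain e' where e': "e' \<in> eqv_chains N n (Suc j) (Suc 0)" "?R s = D1 N e'"
      using i RSk[OF s(1)] unfolding A.inj_H_def by metis
    obtain f where f: "f \<in> eqv_chains N (n + k) (Suc j) (Suc k)" "?R f = e'" using surS[OF e'(1)] by blast
    have "?R (s - D1 N f) = 0" unfolding restrict_tail_diff restrict_tail_D1 using e' f by simp
    then have "s - D1 N f = 0" using injS[of "s - D1 N f" j] B.T_diff s(1) B.D1_T[OF f(1)] by blast
    then show "\<exists>e\<in>eqv_chains N (n + k) (Suc j) (Suc k). s = D1 N e" using f(1) by auto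
  qed
qed

text \<open>Strong induction on \<open>n\<close> for all \<open>q\<close> at once, with
  \<open>N\<close> fixed so that all groups involved act on the same tuples. The hypothesis on
  \<open>n\<close> is exactness of the rows up to 2 q + 1.\<close>

theorem eqv_chains_stability:
  assumes pol: "poly_sq e m V (\<lambda>_. {0}) act"
    and n: "n \<le> N" "int n \<ge> 2 * int q + max m (int e) + 1"
  shows "double_complex.surj_H (eqv_chains N n) (D1 N) (D2 n) q 0 \<and> double_complex.inj_H (eqv_chains N n) (D1 N) (D2 n) q 0"
  using n
proof (induction n arbitrary: q rule: less_induct)
  case (less n)
  interpret DC: double_complex "eqv_chains N n" "D1 N" "D2 n" by (rule double_complex_eqv_chains[OF less.prems(1)])
  have ex: "DC.row_exact l" if "l \<le> 2 * q + 1" for l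
    by (rule row_exact_eqv_chains[OF pol less.prems(1)]) (use less.prems(2) that in simp)
  have st: "DC.surj_H j (Suc l) \<and> DC.inj_H j (Suc l)" if l: "odd l" "l + 2 * j < 2 * q" for j l
  proof -
    have "int n \<ge> 2 * int q + 1 + int e" using less.prems(2) by linarith
    then have nl: "n - Suc l + Suc l = n" "n - Suc l < n" using l by linarith+
    \<comment> \<open>For odd \<open>l\<close> the condition l + 2 j < 2 q sharpens to l + 1 + 2 j
      \<le> 2 q, so the bound for n and q yields the bound for n - l - 1 and j.\<close>
    have "int (n - Suc l) \<ge> 2 * int j + max m (int e) + 1" using less.prems(2) l nl by linarith
    then have "double_complex.surj_H (eqv_chains N (n - Suc l)) (D1 N) (D2 (n - Suc l)) j 0 \<and>
        double_complex.inj_H (eqv_chains N (n - Suc l)) (D1 N) (D2 (n - Suc l)) j 0"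
      using less.IH[OF nl(2)] less.prems(1) by simp
    then show ?thesis using stability_transfer[of "n - Suc l" "Suc l" N j] nl(1) less.prems(1) l(1) by simp
  qed
  show ?case
    using DC.stability_step[of q] ex st zero_H_eqv_chains[OF less.prems(1), of q] by blast
qed

end

section \<open>Comparison with the bar complex\<close>

text \<open>Homogeneous tuples against bar notation: \<open>quots\<close> sends (x_0, ..., x_k) to
  the successive quotients, forgetting x_0, and \<open>pprods\<close> recovers the tuple from its
  first entry and these quotients.\<close>

fun quots :: "(nat \<Rightarrow> nat) list \<Rightarrow> (nat \<Rightarrow> nat) list" where
  "quots [] = []"
| "quots [x] = []"
| "quots (x # y # ys) = (inv x \<circ> y) # quots (y # ys)"

primrec pprods :: "(nat \<Rightarrow> nat) \<Rightarrow> (nat \<Rightarrow> nat) list \<Rightarrow> (nat \<Rightarrow> nat) list" where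
  "pprods x [] = [x]"
| "pprods x (g # gs) = x # pprods (x \<circ> g) gs"

lemma length_quots [simp]: "length (quots xs) = length xs - 1"
  by (induction xs rule: quots.induct) auto

lemma length_pprods [simp]: "length (pprods x gs) = Suc (length gs)"
  by (induction gs arbitrary: x) auto

lemma hd_pprods [simp]: "hd (pprods x gs) = x"
  by (cases gs) auto

lemma pprods_not_Nil [simp]: "pprods x gs \<noteq> []"
  by (cases gs) auto

lemma quots_Sym: "set xs \<subseteq> Sym n \<Longrightarrow> set (quots xs) \<subseteq> Sym n"
  by (induction xs rule: quots.induct) (auto intro: Sym_comp permutes_inv)

lemma pprods_Sym: "x permutes {..<n} \<Longrightarrow> set gs \<subseteq> Sym n \<Longrightarrow> set (pprods x gs) \<subseteq> Sym n"
  by (induction gs arbitrary: x) (auto intro: Sym_comp)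

lemma quots_pprods: "x permutes {..<n} \<Longrightarrow> set gs \<subseteq> Sym n \<Longrightarrow> quots (pprods x gs) = gs"
proof (induction gs arbitrary: x)
  case (Cons g gs)
  have xg: "(x \<circ> g) permutes {..<n}" using Cons.prems by (intro Sym_comp) auto
  have "quots (pprods x (g # gs)) = (inv x \<circ> (x \<circ> g)) # quots (pprods (x \<circ> g) gs)" by (cases gs) auto
  also have "quots (pprods (x \<circ> g) gs) = gs" by (rule Cons.IH[OF xg]) (use Cons.prems in auto)
  also have "inv x \<circ> (x \<circ> g) = g" by (rule inv_comp_cancel(1)[OF Cons.prems(1)])
  finally show ?case .
qed simp

lemma pprods_quots: "set (x # xs) \<subseteq> Sym n \<Longrightarrow> pprods x (quots (x # xs)) = x # xs"
  by (induction xs arbitrary: x) auto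

lemma quots_translate: "g permutes {..<n} \<Longrightarrow> set xs \<subseteq> Sym N \<Longrightarrow> quots (translate g xs) = quots xs"
proof (induction xs rule: quots.induct)
  case (3 x y ys)
  have "inv (g \<circ> x) = inv x \<circ> inv g" using 3 by (auto simp: permutes_bij o_inv_distrib)
  then have e: "inv (g \<circ> x) \<circ> (g \<circ> y) = inv x \<circ> y" using 3(2) by (simp add: comp_assoc)
  have IH: "quots ((g \<circ> y) # translate g ys) = quots (y # ys)" using 3 by (simp only: list.map) simp
  show ?case unfolding list.map quots.simps e IH ..
qed auto

lemma translate_pprods: "translate g (pprods x gs) = pprods (g \<circ> x) gs"
  by (induction gs arbitrary: x) (auto simp: comp_assoc)

lemma ptuplesI: "set gs \<subseteq> Sym n \<Longrightarrow> length gs = k \<Longrightarrow> gs \<in> ptuples n k"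
  by (auto simp: ptuples_def)

lemma ptuplesD: "gs \<in> ptuples n k \<Longrightarrow> set gs \<subseteq> Sym n" "gs \<in> ptuples n k \<Longrightarrow> length gs = k"
  by (auto simp: ptuples_def)

lemma finite_ptuples: "finite (ptuples n k)"
proof -
  have "ptuples n k = {gs. set gs \<subseteq> Sym n \<and> length gs = k}" by (auto simp: ptuples_def)
  then show ?thesis using finite_lists_length_eq[OF finite_Sym] by simp
qed

definition merge :: "nat \<Rightarrow> (nat \<Rightarrow> nat) list \<Rightarrow> (nat \<Rightarrow> nat) list" where
  "merge i gs = (if i = 0 then tl gs else if i = length gs then butlast gs
     else take (i - 1) gs @ [gs ! (i - 1) \<circ> gs ! i] @ drop (i + 1) gs)"

lemma face_eq: "face act n i gs v = (merge i gs, if i = 0 then act (inv (hd gs)) n n v else v)"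
  by (simp add: face_def merge_def)

lemma merge_simps:
  "merge (Suc 0) [g] = []"
  "merge (Suc 0) (g # h # gs) = (g \<circ> h) # gs"
  "gs \<noteq> [] \<Longrightarrow> merge (Suc (Suc i)) (g # gs) = g # merge (Suc i) gs"
  by (auto simp: merge_def)

text \<open>In homogeneous form a face deletes one entry. Face 0 is not covered: it deletes the
  first entry, thereby moving the base point, and this is where the action on coefficients comes
  in.\<close>

lemma pprods_merge:
  assumes "i < length gs"
  shows "pprods x (merge (Suc i) gs) = take (Suc i) (pprods x gs) @ drop (Suc (Suc i)) (pprods x gs)"
  using assms
proof (induction gs arbitrary: x i)
  case (Cons g gs)
  show ?case
  proof (cases i)
    case 0
    then show ?thesis by (cases gs) (simp_all add: merge_simps comp_assoc)
  next
    case (Suc i')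
    then have "gs \<noteq> []" using Cons.prems by auto
    have "pprods (x \<circ> g) (merge (Suc i') gs) = take (Suc i') (pprods (x \<circ> g) gs) @ drop (Suc (Suc i')) (pprods (x \<circ> g) gs)"
      by (rule Cons.IH) (use Cons.prems Suc in simp)
    then show ?thesis unfolding Suc merge_simps(3)[OF \<open>gs \<noteq> []\<close>] by (simp only: pprods.simps take_Suc_Cons drop_Suc_Cons append_Cons)
  qed
qed simp

lemma merge_Sym: "set gs \<subseteq> Sym n \<Longrightarrow> i \<le> length gs \<Longrightarrow> gs \<noteq> [] \<Longrightarrow> set (merge i gs) \<subseteq> Sym n"
  unfolding merge_def
  by (auto dest: in_set_butlastD in_set_takeD in_set_dropD list.set_sel(2) intro!: Sym_comp)
     (auto simp: subset_iff Suc_le_eq)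

lemma length_merge: "i \<le> length gs \<Longrightarrow> gs \<noteq> [] \<Longrightarrow> length (merge i gs) = length gs - 1"
  unfolding merge_def by (auto simp: min_def)

lemma merge_ptuples: "gs \<in> ptuples n (Suc k) \<Longrightarrow> i \<le> Suc k \<Longrightarrow> merge i gs \<in> ptuples n k"
proof -
  assume gs: "gs \<in> ptuples n (Suc k)" and i: "i \<le> Suc k"
  have *: "i \<le> length gs" "gs \<noteq> []" using ptuplesD(2)[OF gs] i by auto
  show ?thesis
    using merge_Sym[OF ptuplesD(1)[OF gs] *] length_merge[OF *] ptuplesD(2)[OF gs] by (intro ptuplesI) simp_all
qed

text \<open>Sorting by the index of the face brings the bar differential into the shape of
  \<open>tuple_bd_eq_sum\<close>, so that the two can be compared face by face.\<close>

lemma bar_bd_eq: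
  "bar_bd act n (Suc k) c hs =
    (\<Sum>i\<le>Suc k. \<Sum>gs\<in>{gs \<in> ptuples n (Suc k). merge i gs = hs}. sgn_pow i (if i = 0 then act (inv (hd gs)) n n (c gs) else c gs))"
proof -
  have "bar_bd act n (Suc k) c hs =
    (\<Sum>gs\<in>ptuples n (Suc k). \<Sum>i\<le>Suc k. if merge i gs = hs then sgn_pow i (if i = 0 then act (inv (hd gs)) n n (c gs) else c gs) else 0)"
    unfolding bar_bd_def face_eq by (simp add: atMost_atLeast0 cong: if_cong)
  also have "\<dots> = (\<Sum>i\<le>Suc k. \<Sum>gs\<in>ptuples n (Suc k).
      if merge i gs = hs then sgn_pow i (if i = 0 then act (inv (hd gs)) n n (c gs) else c gs) else 0)"
    by (rule sum.swap)
  also have "\<dots> = (\<Sum>i\<le>Suc k. \<Sum>gs\<in>{gs \<in> ptuples n (Suc k). merge i gs = hs}.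
      sgn_pow i (if i = 0 then act (inv (hd gs)) n n (c gs) else c gs))"
    by (rule sum.cong[OF refl], rule sum.inter_filter[OF finite_ptuples, symmetric])
  finally show ?thesis .
qed

lemma bar_bd_outside: "hs \<notin> ptuples n k \<Longrightarrow> bar_bd act n (Suc k) c hs = 0"
proof -
  assume hs: "hs \<notin> ptuples n k"
  have "{gs \<in> ptuples n (Suc k). merge i gs = hs} = {}" if "i \<le> Suc k" for i
    using merge_ptuples[OF _ that, of _ n] hs by auto
  then show ?thesis unfolding bar_bd_eq by (intro sum.neutral ballI) (simp only: atMost_iff empty_iff)
qed

text \<open>Only entries of \<open>A\<close> contribute, and such an entry equals its image under
  \<rho>.\<close>

lemma pushforward_support:
  assumes "finite E" "A \<subseteq> E" "\<And>x. x \<in> A \<Longrightarrow> \<rho> x = x" "\<And>ys. \<not> set ys \<subseteq> A \<Longrightarrow> g ys = 0"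
  shows "pushforward E \<rho> xs g = g xs"
  using assms(4)
proof (induction xs arbitrary: g)
  case (Cons x xs)
  have "pushforward E \<rho> xs (\<lambda>ys. g (y # ys)) = (if y = x then g (x # xs) else 0)" if "y \<in> {y \<in> E. \<rho> y = x}" for y
  proof (cases "y \<in> A")
    case True
    then have "y = x" using assms(3) that by auto
    then show ?thesis using Cons.IH[of "\<lambda>ys. g (x # ys)"] Cons.prems by simp
  next
    case False
    then have "(\<lambda>ys. g (y # ys)) = (\<lambda>_. 0)" using Cons.prems by auto
    moreover have "g (x # xs) = 0" if "y = x" using Cons.prems[of "x # xs"] False that by simp
    ultimately show ?thesis by auto
  qed
  then have "pushforward E \<rho> (x # xs) g = (\<Sum>y\<in>{y \<in> E. \<rho> y = x}. if y = x then g (x # xs) else 0)" by (simp cong: if_cong)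
  also have "\<dots> = g (x # xs)"
    using assms(1-3) Cons.prems[of "x # xs"] by (auto simp: sum.delta)
  finally show ?case .
qed simp

lemma pushforward_image:
  assumes "\<And>x. x \<in> E \<Longrightarrow> \<rho> x \<in> A" "\<not> set xs \<subseteq> A"
  shows "pushforward E \<rho> xs g = 0"
  using assms(2)
proof (induction xs arbitrary: g)
  case (Cons x xs)
  show ?case
  proof (cases "x \<in> A")
    case True
    then show ?thesis using Cons by simp
  next
    case False
    then have "{y \<in> E. \<rho> y = x} = {}" using assms(1) by auto
    then show ?thesis by (simp only: pushforward.simps sum.empty)
  qed
qed simp

context fi_mod begin

text \<open>A bar chain becomes the equivariant function whose value at (1, g_1, g_1 g_2, ...) is
  the coefficient of [g_1|...|g_k]. Extension by zero from tuples in S_n to tuples in S_N is the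
  inclusion of one free resolution into another.\<close>

definition from_bar :: "nat \<Rightarrow> ((nat \<Rightarrow> nat) list \<Rightarrow> 'v) \<Rightarrow> (nat \<Rightarrow> nat) list \<Rightarrow> nat list \<Rightarrow> 'v" where
  "from_bar n c = (\<lambda>xs w. if w = [] \<and> xs \<noteq> [] \<and> set xs \<subseteq> Sym n then act (hd xs) n n (c (quots xs)) else 0)"

lemma Sym_fi_mor: "g permutes {..<n} \<Longrightarrow> fi_mor g n n"
  unfolding fi_mor_def by (metis permutes_image permutes_inj inj_on_subset order_refl subset_UNIV)

lemma chains_V: "c \<in> chains V n k \<Longrightarrow> c gs \<in> V n"
  unfolding chains_def by (cases "gs \<in> ptuples n k") auto

lemma chains_outside: "c \<in> chains V n k \<Longrightarrow> gs \<notin> ptuples n k \<Longrightarrow> c gs = 0"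
  unfolding chains_def by auto

lemma move_Nil: "g permutes {..<n} \<Longrightarrow> v \<in> V n \<Longrightarrow> move n g [] v = act g n n v"
  unfolding move_def using setact_lessThan[OF Sym_fi_mor] by simp

lemma words_0: "w \<in> words X 0 \<longleftrightarrow> w = []"
  by (auto simp: words_def)

lemma act_act_Sym: "g permutes {..<n} \<Longrightarrow> h permutes {..<n} \<Longrightarrow> v \<in> V n \<Longrightarrow> act g n n (act h n n v) = act (g \<circ> h) n n v"
  using act_comp[OF Sym_fi_mor Sym_fi_mor] by simp

lemma from_bar_eqv_chains:
  assumes c: "c \<in> chains V n k" and n: "n \<le> N"
  shows "from_bar n c \<in> eqv_chains N n k 0"
proof (rule eqv_chainsI)
  fix xs w assume *: "\<not> (set xs \<subseteq> Sym N \<and> length xs = Suc k \<and> w \<in> words {..<n} 0)"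
  show "from_bar n c xs w = 0"
  proof (cases "w = [] \<and> xs \<noteq> [] \<and> set xs \<subseteq> Sym n")
    case True
    then have "length xs \<noteq> Suc k" using * Sym_mono[OF n] by (auto simp: words_0)
    then have "quots xs \<notin> ptuples n k" using True by (cases xs) (auto dest: ptuplesD)
    then have "c (quots xs) = 0" by (rule chains_outside[OF c])
    then show ?thesis using True Sym_fi_mor[of "hd xs" n] by (cases xs) (auto simp: from_bar_def)
  qed (auto simp: from_bar_def)
next
  fix xs w
  show "from_bar n c xs w \<in> V (n - 0)"
    using act_V[OF Sym_fi_mor chains_V[OF c], of "hd xs"] by (cases xs) (auto simp: from_bar_def)
next
  fix xs w g assume *: "set xs \<subseteq> Sym N" "length xs = Suc k" "w \<in> words {..<n} 0" and g: "g permutes {..<n}"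
  have w: "w = []" using * by (simp add: words_0)
  have s: "set (translate g xs) \<subseteq> Sym n \<longleftrightarrow> set xs \<subseteq> Sym n" by (rule set_translate_Sym[OF order_refl g])
  show "from_bar n c (translate g xs) (map g w) = move n g w (from_bar n c xs w)"
  proof (cases "set xs \<subseteq> Sym n")
    case True
    obtain x ys where xs: "xs = x # ys" using *(2) by (cases xs) auto
    then have x: "x permutes {..<n}" using True by auto
    have "from_bar n c (translate g xs) (map g w) = act (g \<circ> x) n n (c (quots xs))"
      unfolding from_bar_def using s True quots_translate[OF g True] xs w by (auto simp del: set_map)
    also have "\<dots> = move n g w (act x n n (c (quots xs)))"
      using move_Nil[OF g act_V[OF Sym_fi_mor[OF x] chains_V[OF c]]] act_act_Sym[OF g x chains_V[OF c]] w by simp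
    finally show ?thesis using True xs w by (simp add: from_bar_def)
  next
    case False
    then show ?thesis unfolding from_bar_def using s g by (simp del: set_map)
  qed
qed

lemma from_bar_pprods:
  assumes "c \<in> chains V n k" "gs \<in> ptuples n k"
  shows "from_bar n c (pprods id gs) [] = c gs"
  using assms pprods_Sym[OF permutes_id, of gs n] quots_pprods[OF permutes_id, of gs n] ptuplesD[OF assms(2)]
    act_id[OF chains_V[OF assms(1)]] by (simp add: from_bar_def)

lemma from_bar_inj:
  assumes "c \<in> chains V n k" "c' \<in> chains V n k" "from_bar n c = from_bar n c'"
  shows "c = c'"
proof
  fix gs
  show "c gs = c' gs"
    using from_bar_pprods[OF assms(1), of gs] from_bar_pprods[OF assms(2), of gs] assms(3)
      chains_outside[OF assms(1), of gs] chains_outside[OF assms(2), of gs] by (cases "gs \<in> ptuples n k") auto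
qed

lemma act_uminus: "fi_mor f a b \<Longrightarrow> x \<in> V a \<Longrightarrow> act f a b (- x) = - act f a b x"
  using act_add[of f a b x "- x"] by (simp add: eq_neg_iff_add_eq_0 add.commute)

lemma act_diff: "fi_mor f a b \<Longrightarrow> x \<in> V a \<Longrightarrow> y \<in> V a \<Longrightarrow> act f a b (x - y) = act f a b x - act f a b y"
  using act_add[of f a b x "- y"] act_uminus[of f a b y] by simp

lemma act_sum: "fi_mor f a b \<Longrightarrow> (\<And>i. i \<in> I \<Longrightarrow> x i \<in> V a) \<Longrightarrow> act f a b (sum x I) = (\<Sum>i\<in>I. act f a b (x i))"
  by (induction I rule: infinite_finite_induct) (auto simp: act_add V_sum)

lemma bar_term_V:
  assumes "c \<in> chains V n k" "gs \<in> ptuples n (Suc j)"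
  shows "sgn_pow i (if i = 0 then act (inv (hd gs)) n n (c gs) else c gs) \<in> V n"
proof -
  have "hd gs permutes {..<n}" using ptuplesD[OF assms(2)] by (cases gs) auto
  then show ?thesis using act_V[OF Sym_fi_mor[OF permutes_inv] chains_V[OF assms(1)]] chains_V[OF assms(1)] by auto
qed

lemma bar_bd_chains:
  assumes "c \<in> chains V n (Suc k)"
  shows "bar_bd act n (Suc k) c \<in> chains V n k"
proof -
  have "bar_bd act n (Suc k) c hs \<in> V n" for hs
    unfolding bar_bd_eq by (intro V_sum) (use bar_term_V[OF assms] in blast)
  then show ?thesis unfolding chains_def using bar_bd_outside by auto
qed

text \<open>Bar tuples whose face \<open>i\<close> is \<open>quots xs\<close> correspond to the
  entries \<open>y\<close> that can be inserted into \<open>xs\<close> at place \<open>i\<close>,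
  through \<open>quots\<close> of the enlarged tuple. For i = 0 the new entry becomes the base
  point, and \<open>y = x \<circ> inv (hd gs)\<close> accounts for the action of the first bar
  entry. For positive \<open>i\<close> the base point stays, and \<open>y\<close> is a partial
  product.\<close>

lemma from_bar_face_sum:
  assumes c: "c \<in> chains V n (Suc k)" and xs: "set xs \<subseteq> Sym n" "length xs = Suc k" and i: "i \<le> Suc k"
  shows "(\<Sum>gs\<in>{gs \<in> ptuples n (Suc k). merge i gs = quots xs}.
      act (hd xs) n n (sgn_pow i (if i = 0 then act (inv (hd gs)) n n (c gs) else c gs))) =
    (\<Sum>y\<in>Sym n. sgn_pow i (from_bar n c (take i xs @ y # drop i xs) []))"
proof -
  obtain x ys where xys: "xs = x # ys" using xs by (cases xs) auto
  have x: "x permutes {..<n}" using xs xys by auto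
  show ?thesis
  proof (cases i)
    case 0
    show ?thesis
    proof (rule sum.reindex_bij_witness[where i = "\<lambda>y. quots (y # xs)" and j = "\<lambda>gs. x \<circ> inv (hd gs)"])
      fix gs assume "gs \<in> {gs \<in> ptuples n (Suc k). merge i gs = quots xs}"
      then have gs: "gs \<in> ptuples n (Suc k)" "tl gs = quots xs" using 0 by (auto simp: merge_def)
      then obtain g where g: "gs = g # quots xs" "g permutes {..<n}"
        using ptuplesD[OF gs(1)] by (cases gs) auto
      have "inv (x \<circ> inv g) = g \<circ> inv x" 
        unfolding o_inv_distrib[OF permutes_bij[OF x] permutes_bij[OF permutes_inv[OF g(2)]]] permutes_inv_inv[OF g(2)] ..
      then show e: "quots ((x \<circ> inv (hd gs)) # xs) = gs" using g x xys by (simp add: comp_assoc permutes_inv_o)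
      show y: "x \<circ> inv (hd gs) \<in> Sym n" using g Sym_comp[OF x permutes_inv] by auto
      have "from_bar n c ((x \<circ> inv (hd gs)) # xs) [] = act (x \<circ> inv (hd gs)) n n (c gs)"
        using y xs(1) e by (auto simp: from_bar_def)
      also have "\<dots> = act x n n (act (inv (hd gs)) n n (c gs))"
        using g(2) act_act_Sym[OF x permutes_inv chains_V[OF c]] by (simp add: g(1))
      finally show "sgn_pow i (from_bar n c (take i xs @ (x \<circ> inv (hd gs)) # drop i xs) []) =
         act (hd xs) n n (sgn_pow i (if i = 0 then act (inv (hd gs)) n n (c gs) else c gs))"
        using 0 xys by simp
    next
      fix y assume y: "y \<in> Sym n"
      then show "x \<circ> inv (hd (quots (y # xs))) = y"
        using x xys o_inv_distrib[OF permutes_bij[OF permutes_inv] permutes_bij[OF x], of y "{..<n}"]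
        by (simp add: permutes_inv_inv)
      have "quots (y # xs) \<in> ptuples n (Suc k)" using quots_Sym[of "y # xs" n] y xs by (intro ptuplesI) auto
      then show "quots (y # xs) \<in> {gs \<in> ptuples n (Suc k). merge i gs = quots xs}"
        using 0 xys by (simp add: merge_def)
    qed
  next
    case (Suc i')
    have ins: "take i xs @ y # drop i xs = x # take i' ys @ y # drop i' ys" for y using Suc xys by simp
    have del: "zs = take i (take i zs @ drop (Suc i) zs) @ zs ! i # drop i (take i zs @ drop (Suc i) zs)"
      if "i < length zs" for zs :: "(nat \<Rightarrow> nat) list"
      using that by (simp add: min_def id_take_nth_drop[symmetric])
    show ?thesis
    proof (rule sum.reindex_bij_witness[where i = "\<lambda>y. quots (take i xs @ y # drop i xs)" and j = "\<lambda>gs. pprods x gs ! i"])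
      fix gs assume "gs \<in> {gs \<in> ptuples n (Suc k). merge i gs = quots xs}"
      then have gs: "set gs \<subseteq> Sym n" "length gs = Suc k" "merge i gs = quots xs" by (auto dest: ptuplesD)
      have "take i (pprods x gs) @ drop (Suc i) (pprods x gs) = pprods x (quots xs)"
        using pprods_merge[of i' gs x] gs Suc i by simp
      also have "\<dots> = xs" using pprods_quots[of x ys n] xs xys by simp
      finally have e: "take i xs @ pprods x gs ! i # drop i xs = pprods x gs"
        using del[of "pprods x gs"] gs i by simp
      show q: "quots (take i xs @ pprods x gs ! i # drop i xs) = gs"
        unfolding e by (rule quots_pprods[OF x gs(1)])
      show y: "pprods x gs ! i \<in> Sym n" 
        by (rule subsetD[OF pprods_Sym[OF x gs(1)]], rule nth_mem) (use gs i in simp)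
      have "from_bar n c (take i xs @ pprods x gs ! i # drop i xs) [] = act x n n (c gs)"
        unfolding e from_bar_def using pprods_Sym[OF x gs(1)] quots_pprods[OF x gs(1)] by simp
      then show "sgn_pow i (from_bar n c (take i xs @ pprods x gs ! i # drop i xs) []) =
         act (hd xs) n n (sgn_pow i (if i = 0 then act (inv (hd gs)) n n (c gs) else c gs))"
        using Suc xys act_uminus[OF Sym_fi_mor[OF x] chains_V[OF c]] by simp
    next
      fix y assume y: "y \<in> Sym n"
      let ?zs = "take i xs @ y # drop i xs"
      have zs: "set ?zs \<subseteq> Sym n" using xs(1) y by (auto dest: in_set_takeD in_set_dropD)
      have pq: "pprods x (quots ?zs) = ?zs"
        using pprods_quots[of x "take i' ys @ y # drop i' ys" n] zs unfolding ins by simp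
      then show "pprods x (quots ?zs) ! i = y" using xs i by (simp add: nth_append)
      have qp: "quots ?zs \<in> ptuples n (Suc k)" using quots_Sym[OF zs] xs i by (intro ptuplesI) auto
      have "pprods x (merge i (quots ?zs)) = xs"
        using pprods_merge[of i' "quots ?zs" x] xs i Suc unfolding pq by simp
      moreover have "quots (pprods x (merge i (quots ?zs))) = merge i (quots ?zs)"
        by (rule quots_pprods[OF x]) (use merge_ptuples[OF qp i] in \<open>auto dest: ptuplesD\<close>)
      ultimately have "merge i (quots ?zs) = quots xs" by simp
      then show "quots ?zs \<in> {gs \<in> ptuples n (Suc k). merge i gs = quots xs}" using qp by simp
    qed
  qed
qed

lemma from_bar_bd:
  assumes c: "c \<in> chains V n (Suc k)" and n: "n \<le> N"
  shows "D1 N (from_bar n c) = from_bar n (bar_bd act n (Suc k) c)"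
proof (intro ext)
  fix xs w
  have L: "D1 N (from_bar n c) \<in> eqv_chains N n k 0" by (rule D1_eqv_chains[OF from_bar_eqv_chains[OF c n] n])
  have R: "from_bar n (bar_bd act n (Suc k) c) \<in> eqv_chains N n k 0" by (rule from_bar_eqv_chains[OF bar_bd_chains[OF c] n])
  show "D1 N (from_bar n c) xs w = from_bar n (bar_bd act n (Suc k) c) xs w"
  proof (cases "set xs \<subseteq> Sym N \<and> length xs = Suc k \<and> w \<in> words {..<n} 0")
    case False
    then show ?thesis using eqv_chains_zero[OF L False] eqv_chains_zero[OF R False] by simp
  next
    case True
    then have w: "w = []" and ne: "xs \<noteq> []" by (auto simp: words_0)
    have D: "D1 N (from_bar n c) xs w = (\<Sum>i\<le>Suc k. \<Sum>y\<in>Sym N. sgn_pow i (from_bar n c (take i xs @ y # drop i xs) []))"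
      unfolding D1_def w using True ne by (simp add: tuple_bd_eq_sum)
    show ?thesis
    proof (cases "set xs \<subseteq> Sym n")
      case False
      have "from_bar n c (take i xs @ y # drop i xs) [] = 0" for i y
      proof -
        have "set xs \<subseteq> set (take i xs @ y # drop i xs)" using set_append[of "take i xs" "drop i xs"] by auto
        then show ?thesis using False by (auto simp: from_bar_def)
      qed
      then have "D1 N (from_bar n c) xs w = 0" unfolding D by (simp cong: if_cong)
      then show ?thesis using False by (simp add: from_bar_def)
    next
      case xs: True
      have hx: "hd xs permutes {..<n}" using xs ne by (cases xs) auto
      let ?S = "\<lambda>i. {gs \<in> ptuples n (Suc k). merge i gs = quots xs}"
      let ?t = "\<lambda>i gs. sgn_pow i (if i = 0 then act (inv (hd gs)) n n (c gs) else c gs)"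
      have tV: "?t i gs \<in> V n" if "gs \<in> ?S i'" for i i' gs using bar_term_V[OF c] that by blast
      have "from_bar n (bar_bd act n (Suc k) c) xs w = act (hd xs) n n (\<Sum>i\<le>Suc k. \<Sum>gs\<in>?S i. ?t i gs)"
        using xs ne w by (simp add: from_bar_def bar_bd_eq[of act n k c "quots xs"] del: sum.atMost_Suc)
      also have "\<dots> = (\<Sum>i\<le>Suc k. act (hd xs) n n (\<Sum>gs\<in>?S i. ?t i gs))"
        by (rule act_sum[OF Sym_fi_mor[OF hx]], rule V_sum, rule tV)
      also have "\<dots> = (\<Sum>i\<le>Suc k. \<Sum>gs\<in>?S i. act (hd xs) n n (?t i gs))"
        by (rule sum.cong[OF refl], rule act_sum[OF Sym_fi_mor[OF hx]], rule tV)
      also have "\<dots> = (\<Sum>i\<le>Suc k. \<Sum>y\<in>Sym n. sgn_pow i (from_bar n c (take i xs @ y # drop i xs) []))"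
        by (rule sum.cong[OF refl], rule from_bar_face_sum[OF c xs]) (use True in auto)
      also have "\<dots> = D1 N (from_bar n c) xs w"
        unfolding D
      proof (rule sum.cong[OF refl], rule sum.mono_neutral_left)
        fix i
        show "Sym n \<subseteq> Sym N" using Sym_mono[OF n] by auto
        show "\<forall>y\<in>Sym N - Sym n. sgn_pow i (from_bar n c (take i xs @ y # drop i xs) []) = 0"
          by (auto simp: from_bar_def)
      qed simp
      finally show ?thesis by simp
    qed
  qed
qed

lemma from_bar_diff:
  assumes "c \<in> chains V n k" "c' \<in> chains V n k"
  shows "from_bar n (\<lambda>gs. c gs - c' gs) = from_bar n c - from_bar n c'"
proof (intro ext)
  fix xs w
  show "from_bar n (\<lambda>gs. c gs - c' gs) xs w = (from_bar n c - from_bar n c') xs w"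
    using act_diff[OF Sym_fi_mor chains_V[OF assms(1)] chains_V[OF assms(2)], of "hd xs"]
    by (cases xs) (auto simp: from_bar_def)
qed

lemma chains_diff: "c \<in> chains V n k \<Longrightarrow> c' \<in> chains V n k \<Longrightarrow> (\<lambda>gs. c gs - c' gs) \<in> chains V n k"
  by (auto simp: chains_def)

lemma from_bar_0: "from_bar n (\<lambda>_. 0) = 0"
proof (intro ext)
  fix xs w
  show "from_bar n (\<lambda>_. 0) xs w = 0 xs w"
    using act_0[OF Sym_fi_mor, of "hd xs" n] by (cases xs) (auto simp: from_bar_def)
qed

lemma cycles_iff:
  assumes c: "c \<in> chains V n k" and n: "n \<le> N"
  shows "c \<in> cycles V act n k \<longleftrightarrow> D1 N (from_bar n c) = 0"
proof (cases k)
  case 0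
  then have "bar_bd act n k c = (\<lambda>_. 0)" by (simp add: bar_bd_def)
  moreover have "D1 N (from_bar n c) = 0" using D1_eqv_chains0 from_bar_eqv_chains[OF c n] 0 by blast
  ultimately show ?thesis using c by (simp add: cycles_def)
next
  case (Suc j)
  have z: "(\<lambda>_. 0) \<in> chains V n j" by (simp add: chains_def)
  have b: "bar_bd act n k c \<in> chains V n j" using bar_bd_chains c unfolding Suc by blast
  have "from_bar n (bar_bd act n k c) = 0 \<longleftrightarrow> bar_bd act n k c = (\<lambda>_. 0)"
    using from_bar_inj[OF b z] from_bar_0 by metis
  moreover have "D1 N (from_bar n c) = from_bar n (bar_bd act n k c)"
    using from_bar_bd[OF _ n] c unfolding Suc by blast
  ultimately show ?thesis using c by (simp only: cycles_def mem_Collect_eq simp_thms)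
qed

text \<open>Equivariance recovers the value at any tuple from the value at its translate starting
  with the identity, and there it can be read off as a bar chain.\<close>

lemma from_bar_onto:
  assumes f: "f \<in> eqv_chains N n k 0" and n: "n \<le> N" and supp: "\<And>xs. \<not> set xs \<subseteq> Sym n \<Longrightarrow> f xs [] = 0"
  shows "\<exists>c\<in>chains V n k. from_bar n c = f"
proof
  let ?c = "\<lambda>gs. if gs \<in> ptuples n k then f (pprods id gs) [] else 0"
  show c: "?c \<in> chains V n k" using eqv_chains_V[OF f] by (auto simp: chains_def)
  show "from_bar n ?c = f"
  proof (intro ext)
    fix xs w
    show "from_bar n ?c xs w = f xs w"
    proof (cases "set xs \<subseteq> Sym n \<and> length xs = Suc k \<and> w = []")
      case False
      have *: "\<not> (set xs \<subseteq> Sym N \<and> length xs = Suc k \<and> w \<in> words {..<n} 0)" if "length xs \<noteq> Suc k \<or> w \<noteq> []"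
        using that by (auto simp: words_0)
      show ?thesis
      proof (cases "length xs \<noteq> Suc k \<or> w \<noteq> []")
        case True
        show ?thesis unfolding eqv_chains_zero[OF f *[OF True]] by (rule eqv_chains_zero[OF from_bar_eqv_chains[OF c n] *[OF True]])
      next
        case F: False
        then have "\<not> set xs \<subseteq> Sym n" "w = []" using False by auto
        then show ?thesis using supp by (simp add: from_bar_def)
      qed
    next
      case True
      then obtain x ys where xs: "xs = x # ys" by (cases xs) auto
      have x: "x permutes {..<n}" using True xs by auto
      have q: "quots xs \<in> ptuples n k" using quots_Sym True by (intro ptuplesI) auto
      have "from_bar n ?c xs w = act x n n (f (pprods id (quots xs)) [])"
        using True q xs by (simp add: from_bar_def)
      also have "\<dots> = f (translate x (pprods id (quots xs))) (map x [])"
        unfolding eqv_chains_equiv[OF f n x] using move_Nil[OF x] eqv_chains_V[OF f] by simp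
      also have "\<dots> = f xs w" unfolding translate_pprods using pprods_quots[of x ys n] True xs by simp
      finally show ?thesis .
    qed
  qed
qed

text \<open>The chain map induced by a retraction of S_N onto S_n; it is the homotopy inverse of
  extension by zero.\<close>

definition retract :: "nat \<Rightarrow> ((nat \<Rightarrow> nat) \<Rightarrow> nat \<Rightarrow> nat) \<Rightarrow> ((nat \<Rightarrow> nat) list \<Rightarrow> nat list \<Rightarrow> 'v) \<Rightarrow> (nat \<Rightarrow> nat) list \<Rightarrow> nat list \<Rightarrow> 'v" where
  "retract N \<rho> f = (\<lambda>xs w. if set xs \<subseteq> Sym N then pushforward (Sym N) \<rho> xs (\<lambda>ys. f ys w) else 0)"

lemma retract_eqv_chains:
  assumes f: "f \<in> eqv_chains N n j l" and n: "n \<le> N"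
    and \<rho>: "\<And>x. x permutes {..<N} \<Longrightarrow> \<rho> x permutes {..<n}"
      "\<And>h x. h permutes {..<n} \<Longrightarrow> x permutes {..<N} \<Longrightarrow> \<rho> (h \<circ> x) = h \<circ> \<rho> x"
  shows "retract N \<rho> f \<in> eqv_chains N n j l"
proof (rule eqv_chainsI)
  fix xs w assume *: "\<not> (set xs \<subseteq> Sym N \<and> length xs = Suc j \<and> w \<in> words {..<n} l)"
  show "retract N \<rho> f xs w = 0"
  proof (cases "length xs = Suc j \<and> w \<in> words {..<n} l")
    case False
    have "pushforward (Sym N) \<rho> xs (\<lambda>ys. f ys w) = pushforward (Sym N) \<rho> xs (\<lambda>_. 0)"
      by (rule pushforward_cong, rule eqv_chains_zero[OF f]) (use False in auto)
    then show ?thesis by (simp add: retract_def)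
  qed (use * in \<open>auto simp: retract_def\<close>)
next
  fix xs w
  show "retract N \<rho> f xs w \<in> V (n - l)"
    using pushforward_hom[of "V (n - l)" id xs "Sym N" "\<lambda>ys. f ys w"] eqv_chains_V[OF f] by (auto simp: retract_def)
next
  fix xs w g assume *: "set xs \<subseteq> Sym N" "w \<in> words {..<n} l" and g: "g permutes {..<n}"
  have "pushforward (Sym N) \<rho> (translate g xs) (\<lambda>ys. f ys (map g w)) = pushforward (Sym N) \<rho> xs (\<lambda>ys. f (translate g ys) (map g w))"
  proof (rule pushforward_map)
    show "inj_on ((\<circ>) g) (Sym N)" "(\<circ>) g ` Sym N = Sym N"
      using Sym_translate_bij[OF n g] by (auto simp: bij_betw_def)
  qed (use * \<rho> Sym_mono[OF n] g in auto)
  also have "\<dots> = pushforward (Sym N) \<rho> xs (\<lambda>ys. move n g w (f ys w))" unfolding eqv_chains_equiv[OF f n g] ..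
  also have "\<dots> = move n g w (pushforward (Sym N) \<rho> xs (\<lambda>ys. f ys w))"
    using pushforward_hom[of "V (n - l)" "move n g w" xs "Sym N" "\<lambda>ys. f ys w"] move_diff[OF g *(2)] eqv_chains_V[OF f] g by auto
  finally show "retract N \<rho> f (translate g xs) (map g w) = move n g w (retract N \<rho> f xs w)"
    unfolding retract_def using * set_translate_Sym[OF n g, of xs] by simp
qed

lemma retract_D1:
  assumes n: "n \<le> N" and \<rho>: "\<And>x. x permutes {..<N} \<Longrightarrow> \<rho> x permutes {..<n}"
  shows "D1 N (retract N \<rho> f) = retract N \<rho> (D1 N f)"
proof (intro ext)
  fix xs w
  show "D1 N (retract N \<rho> f) xs w = retract N \<rho> (D1 N f) xs w"
  proof (cases "set xs \<subseteq> Sym N \<and> xs \<noteq> []")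
    case True
    have "D1 N (retract N \<rho> f) xs w = tuple_bd (Sym N) xs (\<lambda>ys. pushforward (Sym N) \<rho> ys (\<lambda>zs. f zs w))"
      unfolding D1_def using True by (simp, intro tuple_bd_cong) (auto simp: retract_def)
    also have "\<dots> = pushforward (Sym N) \<rho> xs (\<lambda>ys. tuple_bd (Sym N) ys (\<lambda>zs. f zs w))"
      using \<rho> Sym_mono[OF n] by (intro pushforward_chain_map) auto
    also have "\<dots> = pushforward (Sym N) \<rho> xs (\<lambda>ys. D1 N f ys w)"
      by (rule pushforward_cong) (use True in \<open>auto simp: D1_def\<close>)
    finally show ?thesis using True by (simp add: retract_def)
  qed (auto simp: D1_def retract_def)
qed

lemma retract_0: "retract N \<rho> 0 = 0"
  by (intro ext) (simp add: retract_def)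

text \<open>Extension by zero followed by \<open>retract\<close> is the identity
  (\<open>pushforward_support\<close>); the opposite composite is joined to the identity by the
  prism for \<rho>, taken independent of the word. The first claim is surjectivity of
  \<open>from_bar\<close> on homology, the second injectivity.\<close>

lemma bar_comparison:
  assumes n: "n \<le> N"
  shows "\<lbrakk>z \<in> eqv_chains N n k 0; D1 N z = 0\<rbrakk> \<Longrightarrow> \<exists>c\<in>cycles V act n k. \<exists>b\<in>eqv_chains N n (Suc k) 0. z - from_bar n c = D1 N b"
    and "\<lbrakk>c \<in> chains V n k; f \<in> eqv_chains N n (Suc k) 0; from_bar n c = D1 N f\<rbrakk> \<Longrightarrow> c \<in> boundaries V act n k"
proof -
  obtain \<rho> where rho: "\<And>x. x permutes {..<N} \<Longrightarrow> \<rho> x permutes {..<n}"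
    "\<And>h x. h permutes {..<n} \<Longrightarrow> x permutes {..<N} \<Longrightarrow> \<rho> (h \<circ> x) = h \<circ> \<rho> x"
    "\<And>x. x permutes {..<n} \<Longrightarrow> \<rho> x = x"
    using exists_retraction[OF n] by metis
  have im: "\<exists>c\<in>chains V n j. from_bar n c = retract N \<rho> f" if "f \<in> eqv_chains N n j 0" for f j
  proof (rule from_bar_onto[OF retract_eqv_chains[OF that n rho(1,2)] n])
    fix xs assume xs: "\<not> set xs \<subseteq> Sym n"
    have "pushforward (Sym N) \<rho> xs (\<lambda>ys. f ys []) = 0"
      by (rule pushforward_image[where A = "Sym n"]) (use rho(1) xs in auto)
    then show "retract N \<rho> f xs [] = 0" by (simp add: retract_def)
  qed
  show "\<exists>c\<in>cycles V act n k. \<exists>b\<in>eqv_chains N n (Suc k) 0. z - from_bar n c = D1 N b" if z: "z \<in> eqv_chains N n k 0" "D1 N z = 0"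
  proof -
    obtain c where c: "c \<in> chains V n k" "from_bar n c = retract N \<rho> z" using im[OF z(1)] by blast
    have "D1 N (from_bar n c) = 0"
      using retract_D1[where \<rho> = \<rho> and f = z, OF n rho(1)] c(2) z(2) retract_0[of N \<rho>] by simp
    then have cyc: "c \<in> cycles V act n k" using cycles_iff[OF c(1) n] by blast
    obtain p where p: "p \<in> eqv_chains N n (Suc k) 0" "\<And>xs w. set xs \<subseteq> Sym N \<Longrightarrow> w \<in> words {..<n} 0 \<Longrightarrow>
       pushforward (Sym N) \<rho> xs (\<lambda>ys. z ys w) - z xs w = D1 N p xs w"
      using prism_eqv_chains[where \<beta> = "\<lambda>_. \<rho>", OF z n] rho Sym_mono[OF n] by blast
    have "z - from_bar n c = D1 N (- p)"
    proof (intro ext)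
      fix xs w
      have "D1 N (- p) xs w = - D1 N p xs w" by (simp add: D1_def tuple_bd_uminus)
      moreover have r: "retract N \<rho> z xs w - z xs w = D1 N p xs w"
        using p(2)[of xs w] eqv_chains_zero[OF z(1), of xs w] eqv_chains_zero[OF retract_eqv_chains[OF z(1) n rho(1,2)], of xs w]
          eqv_chains_zero[OF D1_eqv_chains[OF p(1) n], of xs w]
        by (cases "set xs \<subseteq> Sym N \<and> w \<in> words {..<n} 0") (auto simp: retract_def)
      ultimately show "(z - from_bar n c) xs w = D1 N (- p) xs w"
        unfolding c(2) minus_apply using minus_diff_eq[of "retract N \<rho> z xs w" "z xs w"] by (simp only: r)
    qed
    then show ?thesis using cyc eqv_chains_uminus[OF p(1) n] by blast
  qed
  show "c \<in> boundaries V act n k" if c: "c \<in> chains V n k" and f: "f \<in> eqv_chains N n (Suc k) 0" "from_bar n c = D1 N f"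
  proof -
    obtain c' where c': "c' \<in> chains V n (Suc k)" "from_bar n c' = retract N \<rho> f" using im[OF f(1)] by blast
    have "retract N \<rho> (from_bar n c) = from_bar n c"
    proof (intro ext)
      fix xs w
      show "retract N \<rho> (from_bar n c) xs w = from_bar n c xs w"
      proof (cases "set xs \<subseteq> Sym N")
        case True
        have "pushforward (Sym N) \<rho> xs (\<lambda>ys. from_bar n c ys w) = from_bar n c xs w"
          by (rule pushforward_support[where A = "Sym n"]) (use Sym_mono[OF n] rho(3) in \<open>auto simp: from_bar_def\<close>)
        then show ?thesis using True by (simp add: retract_def)
      next
        case False
        then show ?thesis using eqv_chains_zero[OF from_bar_eqv_chains[OF c n], of xs w] by (simp add: retract_def)
      qed
    qed
    then have "from_bar n c = retract N \<rho> (D1 N f)" unfolding f(2) by (rule sym)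
    also have "\<dots> = D1 N (retract N \<rho> f)" by (rule retract_D1[where \<rho> = \<rho>, OF n rho(1), symmetric])
    also have "\<dots> = from_bar n (bar_bd act n (Suc k) c')" unfolding c'(2)[symmetric] by (rule from_bar_bd[OF c'(1) n])
    finally have "from_bar n c = from_bar n (bar_bd act n (Suc k) c')" .
    then have "c = bar_bd act n (Suc k) c'" by (rule from_bar_inj[OF c bar_bd_chains[OF c'(1)]])
    then show ?thesis using c' by (simp add: boundaries_def)
  qed
qed

end

section \<open>The stabilisation map on bar chains\<close>

context fi_mod begin

lemma chain_incl_chains:
  assumes "c \<in> chains V n k"
  shows "chain_incl act n k c \<in> chains V (Suc n) k"
proof -
  have "ptuples n k \<subseteq> ptuples (Suc n) k"
    unfolding ptuples_def using Sym_mono[of n "Suc n"] by auto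
  then show ?thesis
    using act_V[OF fi_mor_id[of n "Suc n"] chains_V[OF assms]] by (auto simp: chains_def chain_incl_def)
qed

text \<open>Stabilisation is \<open>D2\<close> from column 1 to column 0, already on chains:
  \<open>G\<close> spreads \<open>c\<close> by equivariance from the letter \<open>n\<close> to all
  one-letter words. At a tuple beginning with \<open>x\<close> only the letter \<open>x n\<close>
  contributes, because a nonzero value forces the tuple to be the translate by \<open>x\<close> of
  one in S_n.\<close>

lemma D2_extension:
  assumes c: "c \<in> chains V n k" and G: "G \<in> eqv_chains (Suc n) (Suc n) k (Suc 0)" and R: "restrict_tail n 1 G = from_bar n c"
  shows "D2 (Suc n) G = from_bar (Suc n) (chain_incl act n k c)"
proof (intro ext)
  fix xs w
  let ?N = "Suc n"
  note ic = chain_incl_chains[OF c]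
  have nN: "n \<le> ?N" by simp
  show "D2 ?N G xs w = from_bar ?N (chain_incl act n k c) xs w"
  proof (cases "set xs \<subseteq> Sym ?N \<and> length xs = Suc k \<and> w \<in> words {..<?N} 0")
    case False
    then show ?thesis using eqv_chains_zero[OF D2_eqv_chains[OF G order_refl] False] eqv_chains_zero[OF from_bar_eqv_chains[OF ic order_refl] False] by simp
  next
    case True
    then have w: "w = []" by (simp add: words_0)
    obtain x ys where xs: "xs = x # ys" using True by (cases xs) auto
    have x: "x permutes {..<?N}" using True xs by auto
    let ?J = "\<lambda>y. setact act id ({..<?N} - {y}) {..<?N}"
    have D: "D2 ?N G xs w = (\<Sum>y\<in>{..<?N}. ?J y (G xs [y]))"
      unfolding D2_def w by (simp add: words_def ins_sum_def)
    have Gval: "G (translate g us) [g n] = move ?N g [n] (from_bar n c us [])" if g: "g permutes {..<?N}" for g us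
    proof -
      have "G (translate g us) (map g [n]) = move ?N g [n] (G us [n])" by (rule eqv_chains_equiv[OF G order_refl g])
      also have "G us [n] = restrict_tail n 1 G us []" by (simp add: restrict_tail_def words_def)
      finally show ?thesis by (simp only: R list.map)
    qed
    \<comment> \<open>Write y = g n. A nonzero value at \<open>[y]\<close> makes the translate of
      \<open>xs\<close> by \<open>inv g\<close> a tuple in S_n; its first entry is the
      \<open>h\<close> with x = g \<circ> h, and \<open>h\<close> fixes \<open>n\<close>.\<close>
    have C: "x n = y \<and> set (translate (inv x) xs) \<subseteq> Sym n" if y: "y < ?N" and nz: "G xs [y] \<noteq> 0" for y
    proof -
      have "[y] \<in> words {..<n + 1} 1" using y by (auto simp: words_def)
      then obtain g where g: "g permutes {..<?N}" "map g [n..<n + 1] = [y]" using exists_perm_word by fastforce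
      then have gn: "g n = y" by simp
      have "G (translate g (translate (inv g) xs)) [g n] = move ?N g [n] (from_bar n c (translate (inv g) xs) [])"
        by (rule Gval[OF g(1)])
      then have "from_bar n c (translate (inv g) xs) [] \<noteq> 0" using nz g(1) unfolding translate_inv(2)[OF g(1)] gn by auto
      then have s: "set (translate (inv g) xs) \<subseteq> Sym n" unfolding from_bar_def by (meson)
      define h where "h = inv g \<circ> x"
      have h: "h permutes {..<n}" using s xs by (simp add: h_def)
      have xh: "x = g \<circ> h" using g(1) by (simp add: h_def)
      have "x n = y" using xh gn permutes_not_in[OF h, of n] by simp
      moreover have "translate (inv x) xs = translate (inv h) (translate (inv g) xs)"
      proof -
        have "inv x = inv h \<circ> inv g" unfolding xh by (rule o_inv_distrib[OF permutes_bij[OF g(1)] permutes_bij[OF h]])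
        then show ?thesis unfolding translate_translate by simp
      qed
      moreover have "set (translate (inv h) (translate (inv g) xs)) \<subseteq> Sym n"
        using set_translate_Sym[OF order_refl permutes_inv[OF h]] s by blast
      ultimately show ?thesis by simp
    qed
    have tr: "pprods id (quots xs) = translate (inv x) xs"
    proof -
      have "translate (inv x) (pprods x (quots xs)) = pprods (inv x \<circ> x) (quots xs)" by (rule translate_pprods)
      then show ?thesis using pprods_quots[of x ys ?N] True xs x by (simp add: permutes_inv_o)
    qed
    have RHS: "from_bar ?N (chain_incl act n k c) xs w = act x ?N ?N (chain_incl act n k c (quots xs))"
      using True xs w by (simp add: from_bar_def)
    show ?thesis
    proof (cases "set (translate (inv x) xs) \<subseteq> Sym n")
      case False
      then have "G xs [y] = 0" if "y < ?N" for y using C[OF that] by blast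
      then have "D2 ?N G xs w = 0" unfolding D by (intro sum.neutral ballI) (simp add: setact_0)
      moreover have "quots xs \<notin> ptuples n k"
        using False pprods_Sym[OF permutes_id, of "quots xs" n] unfolding tr by (auto dest: ptuplesD)
      ultimately show ?thesis unfolding RHS using act_0[OF Sym_fi_mor[OF x]] by (simp add: chain_incl_def)
    next
      case s: True
      let ?q = "quots xs"
      let ?v = "c ?q"
      have qt: "quots (translate (inv x) xs) = ?q" using quots_translate[OF permutes_inv[OF x]] True by blast
      have q: "?q \<in> ptuples n k" using quots_Sym[OF s] True unfolding qt by (intro ptuplesI) auto
      have v: "?v \<in> V n" by (rule chains_V[OF c])
      have xn: "x n < ?N" using permutes_in_image[OF x, of n] by simp
      have "hd (translate (inv x) xs) = id" using x xs by (simp add: permutes_inv_o)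
      then have "from_bar n c (translate (inv x) xs) [] = ?v"
        using s xs qt act_id[OF v] by (simp add: from_bar_def del: set_map)
      then have G1: "G xs [x n] = move ?N x [n] ?v"
        using Gval[OF x, of "translate (inv x) xs"] unfolding translate_inv(2)[OF x] by simp
      have Gz: "G xs [y] = 0" if "y < ?N" "y \<noteq> x n" for y using C[OF that(1)] that(2) by blast
      have "D2 ?N G xs w = ?J (x n) (G xs [x n])"
      proof -
        have "(\<Sum>y\<in>{..<?N} - {x n}. ?J y (G xs [y])) = 0"
          by (intro sum.neutral ballI) (simp add: Gz setact_0)
        then show ?thesis unfolding D using sum.remove[of "{..<?N}" "x n" "\<lambda>y. ?J y (G xs [y])"] xn by simp
      qed
      also have "\<dots> = ?J (x n) (setact act x {..<n} ({..<?N} - {x n}) ?v)"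
      proof -
        have "{..<?N} - set [n] = {..<n}" by auto
        then show ?thesis unfolding G1 move_def by (simp only: list.map list.set)
      qed
      also have "\<dots> = setact act (id \<circ> x) {..<n} {..<?N} ?v"
      proof (rule setact_comp)
        show "x ` {..<n} \<subseteq> {..<?N} - {x n}"
        proof (rule image_subsetI)
          fix i assume i: "i \<in> {..<n}"
          then have "x i < ?N" using permutes_in_image[OF x, of i] by simp
          moreover have "x i \<noteq> x n" using i by (simp add: inj_eq[OF permutes_inj[OF x]])
          ultimately show "x i \<in> {..<?N} - {x n}" by simp
        qed
      qed (use permutes_inj[OF x] v in \<open>auto intro: inj_on_subset\<close>)
      also have "\<dots> = setact act (x \<circ> id) {..<n} {..<?N} ?v" by simp
      also have "\<dots> = setact act x {..<?N} {..<?N} (setact act id {..<n} {..<?N} ?v)"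
        by (rule setact_comp[symmetric]) (use permutes_inj[OF x] permutes_image[OF x] v in \<open>auto intro: inj_on_subset\<close>)
      also have "setact act id {..<n} {..<?N} ?v = act id n ?N ?v" by (rule setact_lessThan[OF fi_mor_id[OF nN] v])
      also have "setact act x {..<?N} {..<?N} (act id n ?N ?v) = act x ?N ?N (act id n ?N ?v)"
        by (rule setact_lessThan[OF Sym_fi_mor[OF x] act_V[OF fi_mor_id[OF nN] v]])
      finally show ?thesis unfolding RHS using q by (simp add: chain_incl_def)
    qed
  qed
qed

lemma exists_extension:
  assumes "c \<in> chains V n k"
  shows "\<exists>G\<in>eqv_chains (Suc n) (Suc n) k (Suc 0). restrict_tail n 1 G = from_bar n c"
  using restrict_tail_surj[OF from_bar_eqv_chains[OF assms, of "Suc n"], of 1] by simp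

text \<open>Compatibility of \<open>chain_incl\<close> with the bar differential is inherited from
  the commutation of \<open>D1\<close> and \<open>D2\<close>, by \<open>D2_extension\<close> and
  injectivity of \<open>from_bar\<close>.\<close>

lemma chain_incl_boundaries:
  assumes "c \<in> boundaries V act n k"
  shows "chain_incl act n k c \<in> boundaries V act (Suc n) k"
proof -
  obtain c1 where c1: "c1 \<in> chains V n (Suc k)" "c = bar_bd act n (Suc k) c1" using assms by (auto simp: boundaries_def)
  have c: "c \<in> chains V n k" using bar_bd_chains[OF c1(1)] c1(2) by simp
  obtain G where G: "G \<in> eqv_chains (Suc n) (Suc n) (Suc k) (Suc 0)" "restrict_tail n 1 G = from_bar n c1"
    using exists_extension[OF c1(1)] by blast
  have "restrict_tail n 1 (D1 (Suc n) G) = from_bar n c"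
    unfolding restrict_tail_D1 G(2) c1(2) by (rule from_bar_bd[OF c1(1)]) simp
  then have "from_bar (Suc n) (chain_incl act n k c) = D2 (Suc n) (D1 (Suc n) G)"
    using D2_extension[OF c D1_eqv_chains[OF G(1) order_refl]] by simp
  also have "\<dots> = D1 (Suc n) (from_bar (Suc n) (chain_incl act n (Suc k) c1))"
    unfolding D2_D1[OF G(1)] D2_extension[OF c1(1) G] ..
  also have "\<dots> = from_bar (Suc n) (bar_bd act (Suc n) (Suc k) (chain_incl act n (Suc k) c1))"
    by (rule from_bar_bd[OF chain_incl_chains[OF c1(1)] order_refl])
  finally have "chain_incl act n k c = bar_bd act (Suc n) (Suc k) (chain_incl act n (Suc k) c1)"
    by (rule from_bar_inj[OF chain_incl_chains[OF c] bar_bd_chains[OF chain_incl_chains[OF c1(1)]]])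
  then show ?thesis using chain_incl_chains[OF c1(1)] by (simp add: boundaries_def)
qed

lemma restrict_tail_0: "restrict_tail n k 0 = 0"
  by (intro ext) (simp add: restrict_tail_def)

lemma D1_extension:
  assumes c: "c \<in> cycles V act n k" and G: "G \<in> eqv_chains (Suc n) (Suc n) k (Suc 0)" "restrict_tail n 1 G = from_bar n c"
  shows "D1 (Suc n) G = 0"
proof (cases k)
  case 0
  then show ?thesis using D1_eqv_chains0 G by blast
next
  case (Suc j)
  have "c \<in> chains V n k" using c by (simp add: cycles_def)
  then have "D1 (Suc n) (from_bar n c) = 0" using cycles_iff[of c n k "Suc n"] c by simp
  then have "restrict_tail n 1 (D1 (Suc n) G) = 0" using restrict_tail_D1[of n 1 "Suc n" G] G(2) by simp
  moreover have "D1 (Suc n) G \<in> eqv_chains (Suc n) (n + 1) j (1 + 0)" using D1_eqv_chains G(1) Suc by simp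
  ultimately show ?thesis using restrict_tail_inj[of "D1 (Suc n) G" "Suc n" n 1 j 0] by simp
qed

lemma chain_incl_cycles:
  assumes "c \<in> cycles V act n k"
  shows "chain_incl act n k c \<in> cycles V act (Suc n) k"
proof -
  have c: "c \<in> chains V n k" using assms by (simp add: cycles_def)
  obtain G where G: "G \<in> eqv_chains (Suc n) (Suc n) k (Suc 0)" "restrict_tail n 1 G = from_bar n c"
    using exists_extension[OF c] by blast
  have "D1 (Suc n) (from_bar (Suc n) (chain_incl act n k c)) = D2 (Suc n) (D1 (Suc n) G)"
    unfolding D2_extension[OF c G, symmetric] D2_D1[OF G(1)] ..
  also have "\<dots> = 0" unfolding D1_extension[OF assms G] using D2_eqv_chains0[OF eqv_chains_0] .
  finally show ?thesis using cycles_iff[OF chain_incl_chains[OF c] order_refl] by blast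
qed

text \<open>The cycle \<open>a\<close> in column 1 supplied by surjectivity need not come from a bar
  chain. Its restriction to the tail is homologous to one by \<open>bar_comparison\<close>, and
  bijectivity of the restriction lifts this to \<open>a = G + D1 f\<close>, where \<open>G\<close>
  extends a bar cycle.\<close>

lemma bar_surjective:
  assumes "double_complex.surj_H (eqv_chains (Suc n) (Suc n)) (D1 (Suc n)) (D2 (Suc n)) k 0" and z: "z \<in> cycles V act (Suc n) k"
  shows "\<exists>c\<in>cycles V act n k. (\<lambda>gs. z gs - chain_incl act n k c gs) \<in> boundaries V act (Suc n) k"
proof -
  let ?N = "Suc n"
  have n: "n \<le> ?N" by simp
  interpret DC: double_complex "eqv_chains ?N ?N" "D1 ?N" "D2 ?N" by (rule double_complex_eqv_chains) simp
  have zc: "z \<in> chains V ?N k" using z by (simp add: cycles_def)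
  have "D1 ?N (from_bar ?N z) = 0" using cycles_iff[OF zc order_refl] z by blast
  then obtain a b where a: "a \<in> eqv_chains ?N ?N k (Suc 0)" "D1 ?N a = 0" and b: "b \<in> eqv_chains ?N ?N (Suc k) 0"
    and e: "from_bar ?N z = D2 ?N a + D1 ?N b"
    using assms(1) from_bar_eqv_chains[OF zc order_refl] unfolding DC.surj_H_def by metis
  have a': "restrict_tail n 1 a \<in> eqv_chains ?N n k 0" using restrict_tail_eqv_chains[of a ?N n 1 k 0] a(1) by simp
  have "D1 ?N (restrict_tail n 1 a) = 0" using restrict_tail_D1[of n 1 ?N a] a(2) restrict_tail_0 by simp
  then obtain c b' where c: "c \<in> cycles V act n k" and b': "b' \<in> eqv_chains ?N n (Suc k) 0"
    and e': "restrict_tail n 1 a - from_bar n c = D1 ?N b'"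
    using bar_comparison(1)[OF n a'] by blast
  have cc: "c \<in> chains V n k" using c by (simp add: cycles_def)
  obtain G where G: "G \<in> eqv_chains ?N ?N k (Suc 0)" "restrict_tail n 1 G = from_bar n c" using exists_extension[OF cc] by blast
  obtain f where f: "f \<in> eqv_chains ?N ?N (Suc k) (Suc 0)" "restrict_tail n 1 f = b'"
    using restrict_tail_surj[OF b', of 1] by auto
  have m: "a - G - D1 ?N f \<in> eqv_chains ?N (n + 1) k (1 + 0)" using DC.T_diff DC.D1_T[OF f(1)] a(1) G(1) by simp
  have r: "restrict_tail n 1 (a - G - D1 ?N f) = 0"
    unfolding restrict_tail_diff restrict_tail_D1 f(2) G(2) e' by simp
  have "a - G - D1 ?N f = 0" by (rule restrict_tail_inj[OF m _ r]) simp
  then have "a = G + D1 ?N f" by (simp only: diff_eq_eq add_0_left add.commute)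
  then have "D2 ?N a = D2 ?N G + D2 ?N (D1 ?N f)" using DC.D2_add[OF G(1) DC.D1_T[OF f(1)]] by (simp only:)
  then have "from_bar ?N z = from_bar ?N (chain_incl act n k c) + D1 ?N (D2 ?N f) + D1 ?N b"
    using e D2_extension[OF cc G] DC.D1_D2[OF f(1)] by (simp only:)
  then have "from_bar ?N z - from_bar ?N (chain_incl act n k c) = D1 ?N (D2 ?N f + b)"
    unfolding DC.D1_add[OF DC.D2_T[OF f(1)] b] by (simp only: add.assoc add_diff_cancel_left')
  then have "from_bar ?N (\<lambda>gs. z gs - chain_incl act n k c gs) = D1 ?N (D2 ?N f + b)"
    unfolding from_bar_diff[OF zc chain_incl_chains[OF cc]] .
  then have "(\<lambda>gs. z gs - chain_incl act n k c gs) \<in> boundaries V act ?N k"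
    by (rule bar_comparison(2)[OF order_refl chains_diff[OF zc chain_incl_chains[OF cc]] DC.T_add[OF DC.D2_T[OF f(1)] b]])
  then show ?thesis using c by blast
qed

text \<open>By \<open>D2_extension\<close> the assumption says that \<open>D2\<close> of the
  extension \<open>G\<close> of \<open>c\<close> is a boundary. Injectivity makes \<open>G\<close>
  itself a boundary, and restriction to the tail carries this back to \<open>c\<close>.\<close>

lemma bar_injective:
  assumes "double_complex.inj_H (eqv_chains (Suc n) (Suc n)) (D1 (Suc n)) (D2 (Suc n)) k 0"
    and c: "c \<in> cycles V act n k" and word_bd: "chain_incl act n k c \<in> boundaries V act (Suc n) k"
  shows "c \<in> boundaries V act n k"
proof -
  let ?N = "Suc n"
  have n: "n \<le> ?N" by simp
  interpret DC: double_complex "eqv_chains ?N ?N" "D1 ?N" "D2 ?N" by (rule double_complex_eqv_chains) simp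
  have cc: "c \<in> chains V n k" using c by (simp add: cycles_def)
  obtain c' where c': "c' \<in> chains V ?N (Suc k)" "chain_incl act n k c = bar_bd act ?N (Suc k) c'"
    using word_bd by (auto simp: boundaries_def)
  obtain G where G: "G \<in> eqv_chains ?N ?N k (Suc 0)" "restrict_tail n 1 G = from_bar n c" using exists_extension[OF cc] by blast
  have "D2 ?N G = D1 ?N (from_bar ?N c')"
    unfolding D2_extension[OF cc G] c'(2) from_bar_bd[OF c'(1) order_refl] ..
  then obtain e where e: "e \<in> eqv_chains ?N ?N (Suc k) (Suc 0)" "G = D1 ?N e"
    using assms(1) G(1) D1_extension[OF c G] from_bar_eqv_chains[OF c'(1) order_refl] unfolding DC.inj_H_def by blast
  have "restrict_tail n 1 e \<in> eqv_chains ?N n (Suc k) 0" using restrict_tail_eqv_chains[of e ?N n 1 "Suc k" 0] e(1) by simp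
  moreover have "from_bar n c = D1 ?N (restrict_tail n 1 e)" using restrict_tail_D1[of n 1 ?N e] e(2) G(2) by simp
  ultimately show ?thesis by (rule bar_comparison(2)[OF n cc])
qed

section \<open>Passage to homology classes\<close>

lemma boundaries_0: "(\<lambda>_. 0) \<in> boundaries V act n k"
proof -
  have "(\<lambda>_. 0) \<in> chains V n k" "0 \<in> eqv_chains n n (Suc k) 0" by (simp_all add: chains_def eqv_chains_0)
  then show ?thesis using bar_comparison(2)[OF order_refl] from_bar_0 D1_0(1) by metis
qed

lemma boundaries_diff:
  assumes "c \<in> boundaries V act n k" "c' \<in> boundaries V act n k"
  shows "(\<lambda>gs. c gs - c' gs) \<in> boundaries V act n k"
proof -
  obtain b b' where b: "b \<in> chains V n (Suc k)" "c = bar_bd act n (Suc k) b"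
    and b': "b' \<in> chains V n (Suc k)" "c' = bar_bd act n (Suc k) b'" using assms by (auto simp: boundaries_def)
  have cc: "c \<in> chains V n k" "c' \<in> chains V n k" using b b' bar_bd_chains by auto
  have "from_bar n (\<lambda>gs. c gs - c' gs) = from_bar n c - from_bar n c'" by (rule from_bar_diff[OF cc])
  also have "\<dots> = D1 n (from_bar n b) - D1 n (from_bar n b')"
    unfolding b(2) b'(2) from_bar_bd[OF b(1) order_refl] from_bar_bd[OF b'(1) order_refl] ..
  also have "\<dots> = D1 n (from_bar n (\<lambda>gs. b gs - b' gs))"
    unfolding from_bar_diff[OF b(1) b'(1)] D1_diff ..
  finally show ?thesis
    by (rule bar_comparison(2)[OF order_refl chains_diff[OF cc] from_bar_eqv_chains[OF chains_diff[OF b(1) b'(1)] order_refl]])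
qed

lemma hom_rel_equiv: "equiv (cycles V act n k) (hom_rel V act n k)"
proof (rule equivI)
  show "refl_on (cycles V act n k) (hom_rel V act n k)"
    unfolding refl_on_def hom_rel_def using boundaries_0 by auto
  show "sym (hom_rel V act n k)"
  proof (rule symI)
    fix x y assume "(x, y) \<in> hom_rel V act n k"
    moreover from this have "(\<lambda>gs. 0 - (x gs - y gs)) \<in> boundaries V act n k"
      by (intro boundaries_diff[OF boundaries_0, of "\<lambda>gs. x gs - y gs"]) (simp add: hom_rel_def)
    ultimately show "(y, x) \<in> hom_rel V act n k" by (simp add: hom_rel_def)
  qed
  show "trans (hom_rel V act n k)"
  proof (rule transI)
    fix x y z assume *: "(x, y) \<in> hom_rel V act n k" "(y, z) \<in> hom_rel V act n k"
    then have "(\<lambda>gs. x gs - y gs) \<in> boundaries V act n k" "(\<lambda>gs. y gs - z gs) \<in> boundaries V act n k"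
      by (simp_all add: hom_rel_def)
    from boundaries_diff[OF this(1) boundaries_diff[OF boundaries_0 this(2)]] show "(x, z) \<in> hom_rel V act n k" using * by (simp add: hom_rel_def)
  qed
qed (auto simp: hom_rel_def)

lemma chain_incl_diff:
  assumes "c \<in> chains V n k" "c' \<in> chains V n k"
  shows "chain_incl act n k (\<lambda>gs. c gs - c' gs) = (\<lambda>gs. chain_incl act n k c gs - chain_incl act n k c' gs)"
  using act_diff[OF fi_mor_id[of n "Suc n"] chains_V[OF assms(1)] chains_V[OF assms(2)]] by (auto simp: chain_incl_def)

lemma chain_incl_hom_rel:
  assumes "(x, y) \<in> hom_rel V act n k"
  shows "(chain_incl act n k x, chain_incl act n k y) \<in> hom_rel V act (Suc n) k"
proof -
  have *: "x \<in> cycles V act n k" "y \<in> cycles V act n k" "(\<lambda>gs. x gs - y gs) \<in> boundaries V act n k"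
    using assms by (auto simp: hom_rel_def)
  have "(\<lambda>gs. chain_incl act n k x gs - chain_incl act n k y gs) \<in> boundaries V act (Suc n) k"
    using chain_incl_boundaries[OF *(3)] chain_incl_diff[of x n k y] * by (simp add: cycles_def)
  then show ?thesis using chain_incl_cycles * by (simp add: hom_rel_def)
qed

text \<open>The representative picked by \<open>SOME\<close> is immaterial because
  \<open>chain_incl\<close> respects the homology relation.\<close>

lemma homology_map_class:
  assumes "x \<in> cycles V act n k"
  shows "homology_map V act n k (hom_rel V act n k `` {x}) = hom_rel V act (Suc n) k `` {chain_incl act n k x}"
proof -
  let ?y = "SOME y. y \<in> hom_rel V act n k `` {x}"
  have "x \<in> hom_rel V act n k `` {x}" using equiv_class_self[OF hom_rel_equiv assms] .
  then have "?y \<in> hom_rel V act n k `` {x}" by (rule someI[where P = "\<lambda>y. y \<in> hom_rel V act n k `` {x}"])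
  then have "(chain_incl act n k x, chain_incl act n k ?y) \<in> hom_rel V act (Suc n) k"
    by (intro chain_incl_hom_rel) simp
  then show ?thesis unfolding homology_map_def using equiv_class_eq[OF hom_rel_equiv] by metis
qed

lemma homology_map_surj:
  assumes "double_complex.surj_H (eqv_chains (Suc n) (Suc n)) (D1 (Suc n)) (D2 (Suc n)) k 0"
  shows "homology_map V act n k ` group_homology V act n k = group_homology V act (Suc n) k"
proof (intro equalityI subsetI)
  fix X assume "X \<in> homology_map V act n k ` group_homology V act n k"
  then obtain x where "x \<in> cycles V act n k" "X = homology_map V act n k (hom_rel V act n k `` {x})"
    unfolding group_homology_def by (auto elim!: quotientE)
  then show "X \<in> group_homology V act (Suc n) k"
    unfolding group_homology_def using homology_map_class chain_incl_cycles by (auto intro: quotientI)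
next
  fix Z assume "Z \<in> group_homology V act (Suc n) k"
  then obtain z where z: "z \<in> cycles V act (Suc n) k" "Z = hom_rel V act (Suc n) k `` {z}"
    unfolding group_homology_def by (auto elim: quotientE)
  obtain c where c: "c \<in> cycles V act n k" "(\<lambda>gs. z gs - chain_incl act n k c gs) \<in> boundaries V act (Suc n) k"
    using bar_surjective[OF assms z(1)] by blast
  have "(z, chain_incl act n k c) \<in> hom_rel V act (Suc n) k"
    using z c chain_incl_cycles[OF c(1)] by (simp add: hom_rel_def)
  then have "Z = homology_map V act n k (hom_rel V act n k `` {c})"
    unfolding z(2) homology_map_class[OF c(1)] by (rule equiv_class_eq[OF hom_rel_equiv])
  moreover have "hom_rel V act n k `` {c} \<in> group_homology V act n k"
    unfolding group_homology_def using c(1) by (rule quotientI)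
  ultimately show "Z \<in> homology_map V act n k ` group_homology V act n k" by blast
qed

lemma homology_map_inj:
  assumes "double_complex.inj_H (eqv_chains (Suc n) (Suc n)) (D1 (Suc n)) (D2 (Suc n)) k 0"
  shows "inj_on (homology_map V act n k) (group_homology V act n k)"
proof (rule inj_onI)
  fix X Y assume X: "X \<in> group_homology V act n k" and Y: "Y \<in> group_homology V act n k"
    and eq: "homology_map V act n k X = homology_map V act n k Y"
  obtain x where x: "x \<in> cycles V act n k" "X = hom_rel V act n k `` {x}"
    using X unfolding group_homology_def by (auto elim: quotientE)
  obtain y where y: "y \<in> cycles V act n k" "Y = hom_rel V act n k `` {y}"
    using Y unfolding group_homology_def by (auto elim: quotientE)
  have cc: "x \<in> chains V n k" "y \<in> chains V n k" using x y by (auto simp: cycles_def)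
  have "hom_rel V act (Suc n) k `` {chain_incl act n k x} = hom_rel V act (Suc n) k `` {chain_incl act n k y}"
    using eq x y homology_map_class by simp
  then have "(chain_incl act n k x, chain_incl act n k y) \<in> hom_rel V act (Suc n) k"
    using eq_equiv_class[OF _ hom_rel_equiv chain_incl_cycles[OF y(1)]] by blast
  then have "chain_incl act n k (\<lambda>gs. x gs - y gs) \<in> boundaries V act (Suc n) k"
    unfolding chain_incl_diff[OF cc] by (simp add: hom_rel_def)
  moreover have "(\<lambda>gs. x gs - y gs) \<in> cycles V act n k"
    using cycles_iff[OF cc(1) order_refl] cycles_iff[OF cc(2) order_refl] cycles_iff[OF chains_diff[OF cc] order_refl]
      x(1) y(1) unfolding from_bar_diff[OF cc] D1_diff by simp
  ultimately have "(\<lambda>gs. x gs - y gs) \<in> boundaries V act n k" using bar_injective[OF assms] by blast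
  then have "(x, y) \<in> hom_rel V act n k" using x y by (simp add: hom_rel_def)
  then show "X = Y" unfolding x(2) y(2) by (rule equiv_class_eq[OF hom_rel_equiv])
qed

end

section \<open>Application to FI-modules over a commutative ring\<close>

lemma fi_module_fi_mod:
  assumes "fi_module scale V act"
  shows "fi_mod V act"
proof -
  interpret module scale using assms by (simp add: fi_module_def)
  have scale_V: "\<forall>n. 0 \<in> V n \<and> (\<forall>x\<in>V n. \<forall>y\<in>V n. x + y \<in> V n) \<and> (\<forall>c. \<forall>x\<in>V n. scale c x \<in> V n)"
    and act_lin: "\<forall>f a b. fi_mor f a b \<longrightarrow> (\<forall>x\<in>V a. act f a b x \<in> V b) \<and>
        (\<forall>x\<in>V a. \<forall>y\<in>V a. act f a b (x + y) = act f a b x + act f a b y) \<and>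
        (\<forall>r. \<forall>x\<in>V a. act f a b (scale r x) = scale r (act f a b x))"
    and act_ident: "\<forall>a. \<forall>x\<in>V a. act id a a x = x"
    and act_o: "\<forall>f g a b c. fi_mor f a b \<and> fi_mor g b c \<longrightarrow>
        (\<forall>x\<in>V a. act (g \<circ> f) a c x = act g b c (act f a b x))"
    using assms unfolding fi_module_def by - (elim conjE, assumption)+
  show ?thesis
  proof
    fix n x assume "x \<in> V n"
    then have "scale (- 1) x \<in> V n" using scale_V by blast
    then show "- x \<in> V n" by simp
  next
    fix f g a b x assume "fi_mor f a b" "\<And>i. i < a \<Longrightarrow> f i = g i" "x \<in> V a"
    then show "act f a b x = act g a b x" using assms unfolding fi_module_def by blast
  next
    fix f a b x assume "fi_mor f a b" "x \<in> V a"
    then show "act f a b x \<in> V b" using act_lin by blast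
  next
    fix f a b x y assume "fi_mor f a b" "x \<in> V a" "y \<in> V a"
    then show "act f a b (x + y) = act f a b x + act f a b y" using act_lin by blast
  next
    fix f a b g c x assume "fi_mor f a b" "fi_mor g b c" "x \<in> V a"
    then show "act (g \<circ> f) a c x = act g b c (act f a b x)" using act_o[rule_format, of f a b g c x] by simp
  qed (use scale_V act_ident in simp_all)
qed

theorem theoremA:
  fixes scale :: "'k::comm_ring_1 \<Rightarrow> 'v::ab_group_add \<Rightarrow> 'v"
    and V :: "nat \<Rightarrow> 'v set"
    and act :: "'v fi_action"
    and d m :: int
  assumes "fi_module scale V act"
    and "polynomial d m V act"
    and "m \<ge> 0"
  shows "\<forall>k n. (int n \<ge> 2 * int k + max d (m - 1) + 2 \<longrightarrow>
              bij_betw (homology_map V act n k) (group_homology V act n k) (group_homology V act (Suc n) k))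
          \<and> (int n = 2 * int k + max d (m - 1) + 1 \<longrightarrow>
              homology_map V act n k ` group_homology V act n k = group_homology V act (Suc n) k)"
proof (intro allI)
  fix k n
  interpret fi_mod V act by (rule fi_module_fi_mod[OF assms(1)])
  have pol: "d \<ge> -1" "poly_sq (nat (d + 1)) m V (\<lambda>_. {0}) act" using assms(2) by (auto simp: polynomial_def)
  \<comment> \<open>Stability is applied to the target group S_(n+1), with both parameters equal to
    n + 1 and with e = d + 1. Its condition n + 1 \<ge> 2 k + max m (d + 1) + 1 is the bound below,
    from which on both properties are available.\<close>
  have "double_complex.surj_H (eqv_chains (Suc n) (Suc n)) (D1 (Suc n)) (D2 (Suc n)) k 0 \<and>
      double_complex.inj_H (eqv_chains (Suc n) (Suc n)) (D1 (Suc n)) (D2 (Suc n)) k 0"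
    if "int n \<ge> 2 * int k + max d (m - 1) + 1"
    by (rule eqv_chains_stability[OF pol(2)]) (use that pol(1) in auto)
  then show "(int n \<ge> 2 * int k + max d (m - 1) + 2 \<longrightarrow>
              bij_betw (homology_map V act n k) (group_homology V act n k) (group_homology V act (Suc n) k))
          \<and> (int n = 2 * int k + max d (m - 1) + 1 \<longrightarrow>
              homology_map V act n k ` group_homology V act n k = group_homology V act (Suc n) k)"
    using homology_map_surj[of n k] homology_map_inj[of n k] by (auto simp: bij_betw_def)
qed

end
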